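(* The minimal admissible $Sp_{1,n}$-manifold of the class II is the manifold $M=Sp_{1,n}/(Sp_1\times Sp_{n-1})$ with the reductive decomposition $$\mathfrak{sp}_{1,n}=\mathfrak h+\mathfrak m=(\mathfrak{sp}_1+\mathfrak{sp}_{n-1})+\bigl(\mathrm{Im}\,\mathbb H+\mathfrak n'+\mathbb Rv+(\mathrm{Im}\,\mathbb H)v+\mathfrak p'\bigr),$$ where $\mathfrak n'\simeq\mathfrak p'\simeq\mathbb H^{n-1}$. In particular, the space $\mathfrak m^H=\mathbb Rv$ is one-dimensional. As an $(\mathfrak{sp}_1+\mathfrak{sp}_{n-1})$-module, the tangent space $\mathfrak m$ is isomorphic to $$\mathfrak m=\mathbb Rv+\mathfrak{sp}_1\otimes\mathbb R^2+\mathbb H^{n-1}\otimes\mathbb R^2$$ with the natural action of $\mathfrak h=\mathfrak{sp}_1+\mathfrak{sp}_{n-1}$. Any invariant Lorentzian metric in $M$ is defined by a scalar product of the form $$g=-\lambda\,v^*\otimes v^*+g_1\otimes h_1+g_2\otimes h_2,$$ where $g_1,g_2$ are invariant Euclidean scalar products on $\mathfrak{sp}_1$ and $\mathbb H^{n-1}$ respectively, $h_1,h_2$ are any Euclidean scalar products in $\mathbb R^2$, and $\lambda$ is a positive constant.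
   Context: $V=\mathbb H^{1,n}$ is the quaternionic vector space with Hermitian form of quaternionic signature $(1,n)$, orthonormal basis $e_0,\dots,e_n$ with $\langle e_0,e_0\rangle=-1=-\langle e_1,e_1\rangle$, and orthogonal decomposition $V=\mathbb He_0+\mathbb He_1+W$, $W\simeq \mathbb H^{n-1}$. $K=Sp_1\times Sp_n$ is the maximal compact subgroup of $Sp_{1,n}$, with symmetric decomposition $\mathfrak{sp}_{1,n}=\mathfrak k+\mathfrak p$, $\mathfrak k=\{\mathrm{diag}(\alpha,A):\alpha\in\mathrm{Im}\,\mathbb H=\mathfrak{sp}_1, A\in\mathfrak{sp}_n\}$, $\mathfrak p=\left\{\begin{pmatrix} 0 & X^* \\ X & 0 \end{pmatrix}:X\in\mathbb H^n\right\}$, $X^*=\bar X^t$. With respect to $\mathbb He_0+\mathbb He_1+W$: $v=\begin{pmatrix} 0 & 1 & 0 \\ 1 & 0 & 0 \\ 0 & 0 & 0_{n-1} \end{pmatrix}$; $H=K_v$ is the connected stabilizer of $v$, with Lie algebra $\mathfrak h=\mathfrak{sp}_1+\mathfrak{sp}_{n-1}=\{\mathrm{diag}(\alpha,\alpha,A):\alpha\in\mathrm{Im}\,\mathbb H,A\in\mathfrak{sp}_{n-1}\}$ (so $H\simeq Sp_1\times Sp_{n-1}$); $\mathfrak p=\mathbb Hv+\mathfrak p'$ consists of matrices $(x,X)=\begin{pmatrix} 0 & x^* & X^* \\ x & 0 & 0 \\ X & 0 & 0 \end{pmatrix}$, $x\in\mathbb H$, $X\in\mathbb H^{n-1}$,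 where $\mathbb Hv=\mathbb Rv+(\mathrm{Im}\,\mathbb H)v=\{X=0\}$ with $\mathbb Rv=\{X=0,x\in\mathbb R\}$, $(\mathrm{Im}\,\mathbb H)v=\{X=0,x\in\mathrm{Im}\,\mathbb H\}$, and $\mathfrak p'=\{x=0\}$; $\mathfrak n=\mathrm{Im}\,\mathbb H+\mathfrak n'$, a complement to $\mathfrak h$ in $\mathfrak k$, consists of matrices $(y',Y)=\begin{pmatrix} -y' & 0 & 0 \\ 0 & y' & -Y^* \\ 0 & Y & 0_{n-1} \end{pmatrix}$, $y'\in\mathrm{Im}\,\mathbb H$, $Y\in\mathbb H^{n-1}$, with $\mathfrak n'=\{y'=0\}$. The element $(\alpha,A)\in\mathfrak h$ acts by $(x,X)\mapsto(\alpha x-x\alpha,AX-X\alpha)$ and $(y',Y)\mapsto(\alpha y'-y'\alpha,AY-Y\alpha)$. $v^*$ is the linear form on $\mathfrak m$ with $v^*(v)=1$ vanishing on the other summands. $\mathfrak m^H$ (resp. $\mathfrak p^H$) is the space of $\mathrm{Ad}_H$-invariant vectors in $\mathfrak m$ (resp. $\mathfrak p$). Lie groups and stability subgroups are connected. A homogeneous manifold $G/H$ with compact connected $H$ is admissible if it admits a $G$-invariant Lorentzian metric; it is minimal admissible if there is no connected compact subgroup $\tilde H$ containing $H$ properly with $G/\tilde H$ admissible. For $H\subset K$, an admissible manifold $G/H$ belongs to the class II if $\mathfrak p^H\neq0$. *)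

theory Defs
  imports "HOL-Analysis.Analysis"
begin

section \<open>Quaternions\<close>

datatype quat = Quat (qre: real) (qi: real) (qj: real) (qk: real)

lemma quat_eq_iff: "x = y \<longleftrightarrow> qre x = qre y \<and> qi x = qi y \<and> qj x = qj y \<and> qk x = qk y"
  by (cases x; cases y) simp

instantiation quat :: ring_1
begin
definition "0 = Quat 0 0 0 0"
definition "1 = Quat 1 0 0 0"
definition "x + y = Quat (qre x + qre y) (qi x + qi y) (qj x + qj y) (qk x + qk y)"
definition "x - y = Quat (qre x - qre y) (qi x - qi y) (qj x - qj y) (qk x - qk y)"
definition "- x = Quat (- qre x) (- qi x) (- qj x) (- qk x)"
definition "x * y = Quat
   (qre x * qre y - qi x * qi y - qj x * qj y - qk x * qk y)
   (qre x * qi y + qi x * qre y + qj x * qk y - qk x * qj y)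
   (qre x * qj y - qi x * qk y + qj x * qre y + qk x * qi y)
   (qre x * qk y + qi x * qj y - qj x * qi y + qk x * qre y)"
instance
  by standard
    (simp_all add: quat_eq_iff zero_quat_def one_quat_def plus_quat_def minus_quat_def
      uminus_quat_def times_quat_def algebra_simps)
end

instantiation quat :: real_algebra_1
begin
definition "c *\<^sub>R x = Quat (c * qre x) (c * qi x) (c * qj x) (c * qk x)"
instance
  by standard
    (simp_all add: quat_eq_iff plus_quat_def one_quat_def times_quat_def scaleR_quat_def algebra_simps)
end

lemma quat_sel [simp]:
  "qre 0 = 0" "qi 0 = 0" "qj 0 = 0" "qk 0 = 0"
  "qre 1 = 1" "qi 1 = 0" "qj 1 = 0" "qk 1 = 0"
  "qre (x + y) = qre x + qre y" "qi (x + y) = qi x + qi y"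
  "qj (x + y) = qj x + qj y" "qk (x + y) = qk x + qk y"
  "qre (x - y) = qre x - qre y" "qi (x - y) = qi x - qi y"
  "qj (x - y) = qj x - qj y" "qk (x - y) = qk x - qk y"
  "qre (- x) = - qre x" "qi (- x) = - qi x" "qj (- x) = - qj x" "qk (- x) = - qk x"
  "qre (c *\<^sub>R x) = c * qre x" "qi (c *\<^sub>R x) = c * qi x"
  "qj (c *\<^sub>R x) = c * qj x" "qk (c *\<^sub>R x) = c * qk x"
  by (simp_all add: zero_quat_def one_quat_def plus_quat_def minus_quat_def uminus_quat_def
      scaleR_quat_def)

instantiation quat :: euclidean_space
begin
definition "x \<bullet> y = qre x * qre y + qi x * qi y + qj x * qj y + qk x * qk y"
definition "norm (x :: quat) = sqrt (x \<bullet> x)"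
definition "sgn (x :: quat) = x /\<^sub>R norm x"
definition "dist (x :: quat) y = norm (x - y)"
definition
  "(uniformity :: (quat \<times> quat) filter) = (INF e\<in>{0<..}. principal {(x, y). dist x y < e})"
definition
  "open (U :: quat set) \<longleftrightarrow> (\<forall>x\<in>U. eventually (\<lambda>(x', y). x' = x \<longrightarrow> y \<in> U) uniformity)"
definition "Basis = {Quat 1 0 0 0, Quat 0 1 0 0, Quat 0 0 1 0, Quat 0 0 0 1}"
instance
proof
  fix x y z u :: quat and c :: real and U :: "quat set"
  show "x \<bullet> y = y \<bullet> x" "(x + y) \<bullet> z = x \<bullet> z + y \<bullet> z" "(c *\<^sub>R x) \<bullet> y = c * (x \<bullet> y)"
    by (simp_all add: inner_quat_def algebra_simps)
  show "0 \<le> x \<bullet> x" by (simp add: inner_quat_def)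
  show "x \<bullet> x = 0 \<longleftrightarrow> x = 0"
  proof
    assume "x \<bullet> x = 0"
    moreover have "qre x * qre x \<ge> 0" "qi x * qi x \<ge> 0" "qj x * qj x \<ge> 0" "qk x * qk x \<ge> 0"
      by simp_all
    ultimately have "qre x * qre x = 0" "qi x * qi x = 0" "qj x * qj x = 0" "qk x * qk x = 0"
      unfolding inner_quat_def by linarith+
    then show "x = 0" by (simp add: quat_eq_iff)
  qed (simp add: inner_quat_def)
  show "norm x = sqrt (x \<bullet> x)" "sgn x = x /\<^sub>R norm x" "dist x y = norm (x - y)"
    by (rule norm_quat_def sgn_quat_def dist_quat_def)+
  show "(uniformity :: (quat \<times> quat) filter) = (INF e\<in>{0<..}. principal {(x, y). dist x y < e})"
    by (rule uniformity_quat_def)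
  show "open U \<longleftrightarrow> (\<forall>x\<in>U. eventually (\<lambda>(x', y). x' = x \<longrightarrow> y \<in> U) uniformity)"
    by (rule open_quat_def)
  show "(Basis :: quat set) \<noteq> {}" "finite (Basis :: quat set)"
    by (simp_all add: Basis_quat_def)
  show "u \<in> Basis \<Longrightarrow> z \<in> Basis \<Longrightarrow> u \<bullet> z = (if u = z then 1 else 0)"
    unfolding Basis_quat_def by (elim insertE emptyE) (simp_all add: inner_quat_def)
  show "(\<forall>u\<in>Basis. x \<bullet> u = 0) \<longleftrightarrow> x = 0"
    unfolding quat_eq_iff[of x 0] by (simp add: Basis_quat_def inner_quat_def)
qed
end

definition qcnj :: "quat \<Rightarrow> quat" where
  "qcnj x = Quat (qre x) (- qi x) (- qj x) (- qk x)"

definition ImH :: "quat set" where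
  "ImH = {x. qre x = 0}"


section \<open>Quaternionic vectors and matrices\<close>

text \<open>
  \<open>\<bbbH>\<^sup>n\<close> is \<open>quat ^ 'n\<close>, regarded as a right quaternionic vector space on which matrices act from
  the left. The standard basis of \<open>\<bbbH>\<^sup>1\<^sup>,\<^sup>n\<close> is indexed by \<open>'n option\<close>: \<open>None\<close> is the index of \<open>e\<^sub>0\<close>, and
  \<open>Some i\<close> for \<open>i :: 'n\<close> are the indices of the other \<open>n\<close> basis vectors. One index \<open>l :: 'n\<close>, that of
  \<open>e\<^sub>1\<close>, is distinguished. So every \<open>n \<ge> 1\<close> is covered, and \<open>\<bbbH>\<^sup>n\<^sup>-\<^sup>1\<close> is the subspace \<open>W l\<close> of
  \<open>\<bbbH>\<^sup>n\<close> (zero if \<open>n = 1\<close>).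
\<close>

type_synonym 'n qmat = "((quat, 'n) vec, 'n) vec"
type_synonym 'n qmat1 = "((quat, 'n option) vec, 'n option) vec"

definition vcnj :: "quat ^ 'n \<Rightarrow> quat ^ 'n" where
  "vcnj X = (\<chi> i. qcnj (X $ i))"

definition adjoint_mat :: "'n::finite qmat \<Rightarrow> 'n qmat" where
  "adjoint_mat A = (\<chi> i j. qcnj (A $ j $ i))"

definition W :: "'n \<Rightarrow> (quat ^ 'n::finite) set" where
  "W l = {X. X $ l = 0}"

text \<open>Block matrix \<open>(a, R; C, D)\<close> with respect to \<open>\<bbbH>e\<^sub>0 + \<bbbH>\<^sup>n\<close>.\<close>

definition block2 :: "quat \<Rightarrow> quat ^ 'n \<Rightarrow> quat ^ 'n \<Rightarrow> 'n qmat \<Rightarrow> 'n::finite qmat1" where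
  "block2 a R C D = (\<chi> i j. case i of
      None \<Rightarrow> (case j of None \<Rightarrow> a | Some j \<Rightarrow> R $ j)
    | Some i \<Rightarrow> (case j of None \<Rightarrow> C $ i | Some j \<Rightarrow> D $ i $ j))"

text \<open>
  Block matrix \<open>(a, b, R; c, d, S; P, Q, A)\<close> with respect to \<open>\<bbbH>e\<^sub>0 + \<bbbH>e\<^sub>1 + W\<close>. The entries of
  \<open>R, S, P, Q, A\<close> with an index equal to \<open>l\<close> are not used.
\<close>

definition block3 :: "'n \<Rightarrow> quat \<Rightarrow> quat \<Rightarrow> quat ^ 'n \<Rightarrow> quat \<Rightarrow> quat \<Rightarrow> quat ^ 'n
    \<Rightarrow> quat ^ 'n \<Rightarrow> quat ^ 'n \<Rightarrow> 'n qmat \<Rightarrow> 'n::finite qmat1" where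
  "block3 l a b R c d S P Q A = block2 a
      (\<chi> j. if j = l then b else R $ j)
      (\<chi> i. if i = l then c else P $ i)
      (\<chi> i j. if i = l then (if j = l then d else S $ j)
              else (if j = l then Q $ i else A $ i $ j))"


section \<open>The groups and their Lie algebras\<close>

definition hform :: "quat ^ 'n \<Rightarrow> quat ^ 'n::finite \<Rightarrow> quat" where
  "hform x y = (\<Sum>i\<in>UNIV. qcnj (x $ i) * y $ i)"

definition hform1 :: "quat ^ ('n option) \<Rightarrow> quat ^ ('n::finite option) \<Rightarrow> quat" where
  "hform1 x y = - (qcnj (x $ None) * y $ None) + (\<Sum>i\<in>UNIV. qcnj (x $ Some i) * y $ Some i)"

definition Sp1n :: "'n::finite qmat1 set" where
  "Sp1n = {A. \<forall>x y. hform1 (A *v x) (A *v y) = hform1 x y}"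

definition Spn :: "'n::finite qmat set" where
  "Spn = {A. \<forall>x y. hform (A *v x) (A *v y) = hform x y}"

text \<open>\<open>Sp\<^sub>n\<^sub>-\<^sub>1\<close> and its Lie algebra, as the group (algebra) of matrices in \<open>Sp\<^sub>n\<close> (\<open>sp\<^sub>n\<close>) that fix
  (annihilate) \<open>e\<^sub>1\<close>, hence act on \<open>W\<close>.\<close>

definition SpW :: "'n \<Rightarrow> 'n::finite qmat set" where
  "SpW l = {A \<in> Spn. A *v axis l 1 = axis l 1}"

definition spW :: "'n \<Rightarrow> 'n::finite qmat set" where
  "spW l = {A. adjoint_mat A = - A \<and> A *v axis l 1 = 0}"

definition K :: "'n::finite qmat1 set" where
  "K = {block2 a 0 0 B | a B. norm a = 1 \<and> B \<in> Spn}"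

definition pp :: "'n::finite qmat1 set" where
  "pp = {block2 0 (vcnj X) X 0 | X. True}"

definition Ad :: "'n::finite qmat1 \<Rightarrow> 'n qmat1 \<Rightarrow> 'n qmat1" where
  "Ad A X = A ** X ** matrix_inv A"

definition invariants :: "'n::finite qmat1 set \<Rightarrow> 'n qmat1 set \<Rightarrow> 'n qmat1 set" where
  "invariants H S = {X \<in> S. \<forall>A\<in>H. Ad A X = X}"

definition vv :: "'n \<Rightarrow> 'n::finite qmat1" where
  "vv l = block3 l 0 1 0 1 0 0 0 0 0"

definition Kv :: "'n \<Rightarrow> 'n::finite qmat1 set" where
  "Kv l = connected_component_set {A \<in> K. Ad A (vv l) = vv l} (mat 1)"

definition hmat :: "'n \<Rightarrow> quat \<Rightarrow> 'n qmat \<Rightarrow> 'n::finite qmat1" where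
  "hmat l a A = block3 l a 0 0 0 a 0 0 0 A"

definition pmat :: "'n \<Rightarrow> quat \<Rightarrow> quat ^ 'n \<Rightarrow> 'n::finite qmat1" where
  "pmat l x X = block3 l 0 (qcnj x) (vcnj X) x 0 0 X 0 0"

definition nmat :: "'n \<Rightarrow> quat \<Rightarrow> quat ^ 'n \<Rightarrow> 'n::finite qmat1" where
  "nmat l y Y = block3 l (- y) 0 0 0 y (- vcnj Y) 0 Y 0"

text \<open>The pairs \<open>(\<alpha>, A)\<close> in \<open>sp\<^sub>1 + sp\<^sub>n\<^sub>-\<^sub>1\<close>, and the corresponding Lie algebra of matrices.\<close>

definition hpairs :: "'n \<Rightarrow> (quat \<times> 'n::finite qmat) set" where
  "hpairs l = ImH \<times> spW l"

definition hh :: "'n \<Rightarrow> 'n::finite qmat1 set" where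
  "hh l = (\<lambda>(\<alpha>, A). hmat l \<alpha> A) ` hpairs l"

definition mm :: "'n \<Rightarrow> 'n::finite qmat1 set" where
  "mm l = {nmat l y Y + pmat l x X | y Y x X. y \<in> ImH \<and> Y \<in> W l \<and> X \<in> W l}"

definition nIm :: "'n \<Rightarrow> 'n::finite qmat1 set" where
  "nIm l = {nmat l y 0 | y. y \<in> ImH}"

definition n' :: "'n \<Rightarrow> 'n::finite qmat1 set" where
  "n' l = {nmat l 0 Y | Y. Y \<in> W l}"

definition Rv :: "'n \<Rightarrow> 'n::finite qmat1 set" where
  "Rv l = {r *\<^sub>R vv l | r. True}"

definition ImHv :: "'n \<Rightarrow> 'n::finite qmat1 set" where
  "ImHv l = {pmat l x 0 | x. x \<in> ImH}"

definition p' :: "'n \<Rightarrow> 'n::finite qmat1 set" where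
  "p' l = {pmat l 0 X | X. X \<in> W l}"

definition v_star :: "'n \<Rightarrow> 'n::finite qmat1 \<Rightarrow> real" where
  "v_star l M = qre (M $ Some l $ None)"

lemma v_star_mm: "v_star l (nmat l y Y + pmat l x X) = qre x"
  by (simp add: v_star_def nmat_def pmat_def block3_def block2_def)

lemma v_star_vv: "v_star l (vv l) = 1"
  by (simp add: v_star_def vv_def block3_def block2_def)

text \<open>Internal direct sum of a list of real subspaces.\<close>

definition direct_sum :: "'a::real_vector set \<Rightarrow> 'a set list \<Rightarrow> bool" where
  "direct_sum V Us \<longleftrightarrow> (\<forall>U\<in>set Us. subspace U) \<and> bij_betw sum_list (listset Us) V"


section \<open>Invariant Lorentzian metrics on homogeneous manifolds\<close>

text \<open>
  Tangent space of a matrix group (or of a coset) at a point, as the set of velocities of curves.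
\<close>

definition tangent_at :: "'a::real_normed_vector set \<Rightarrow> 'a \<Rightarrow> 'a set" where
  "tangent_at S p = {u. \<exists>c. c 0 = p \<and> (\<forall>t. c t \<in> S) \<and> (c has_vector_derivative u) (at 0)}"

definition lie :: "'n::finite qmat1 set \<Rightarrow> 'n qmat1 set" where
  "lie G = tangent_at G (mat 1)"

definition is_subgroup :: "'n::finite qmat1 set \<Rightarrow> 'n qmat1 set \<Rightarrow> bool" where
  "is_subgroup G H \<longleftrightarrow> H \<subseteq> G \<and> mat 1 \<in> H \<and> (\<forall>A\<in>H. \<forall>B\<in>H. A ** B \<in> H) \<and> (\<forall>A\<in>H. matrix_inv A \<in> H)"

definition cc_subgroup :: "'n::finite qmat1 set \<Rightarrow> 'n qmat1 set \<Rightarrow> bool" where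
  "cc_subgroup G H \<longleftrightarrow> is_subgroup G H \<and> compact H \<and> connected H"

text \<open>
  The tangent bundle of \<open>G/H\<close> is \<open>TG/TH\<close>, where the group \<open>TH\<close> acts on \<open>TG\<close> from the right by
  \<open>(g, U) (h, k) = (g h, U h + g k)\<close>. The tangent vector of \<open>G/H\<close> at \<open>g H\<close> represented by
  \<open>U \<in> T\<^sub>g G\<close>, i.e. the image of \<open>U\<close> under the differential of the projection \<open>G \<rightarrow> G/H\<close>, is the
  following class.
\<close>

definition dproj :: "'n::finite qmat1 set \<Rightarrow> 'n qmat1 \<Rightarrow> 'n qmat1 \<Rightarrow> ('n qmat1 \<times> 'n qmat1) set" where
  "dproj H g U = {(g ** h, U ** h + g ** k) | h k. h \<in> H \<and> k \<in> tangent_at H h}"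

definition sym_bilinear_on :: "'a::real_vector set \<Rightarrow> ('a \<Rightarrow> 'a \<Rightarrow> real) \<Rightarrow> bool" where
  "sym_bilinear_on S B \<longleftrightarrow>
     (\<forall>x\<in>S. \<forall>y\<in>S. B x y = B y x) \<and>
     (\<forall>x\<in>S. \<forall>y\<in>S. \<forall>z\<in>S. B (x + y) z = B x z + B y z) \<and>
     (\<forall>c. \<forall>x\<in>S. \<forall>y\<in>S. B (c *\<^sub>R x) y = c * B x y)"

definition euclidean_on :: "'a::real_vector set \<Rightarrow> ('a \<Rightarrow> 'a \<Rightarrow> real) \<Rightarrow> bool" where
  "euclidean_on S B \<longleftrightarrow> sym_bilinear_on S B \<and> (\<forall>x\<in>S. x \<noteq> 0 \<longrightarrow> B x x > 0)"

text \<open>\<open>B\<close> is the pull-back to \<open>T\<close> of a scalar product of signature \<open>(-,+,\<dots>,+)\<close> on \<open>T/N\<close>.\<close>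

definition lorentzian_mod :: "'a::real_vector set \<Rightarrow> 'a set \<Rightarrow> ('a \<Rightarrow> 'a \<Rightarrow> real) \<Rightarrow> bool" where
  "lorentzian_mod T N B \<longleftrightarrow> sym_bilinear_on T B \<and> (\<forall>x\<in>T. \<forall>y\<in>N. B x y = 0) \<and>
     (\<exists>t\<in>T. B t t < 0 \<and> (\<forall>x\<in>T. B t x = 0 \<and> x \<notin> N \<longrightarrow> B x x > 0))"

text \<open>
  \<open>q\<close> is a function of two tangent vectors of \<open>G/H\<close> at a common point; the kernel of the
  projection \<open>T\<^sub>g G \<rightarrow> T\<^sub>g\<^sub>H(G/H)\<close> is the tangent space of the coset \<open>g H\<close>. Smoothness of \<open>q\<close> need
  not be required: by invariance, \<open>g \<mapsto> q (d\<pi>(g X), d\<pi>(g Y))\<close> is constant on \<open>G\<close> for fixed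
  \<open>X, Y\<close> in the Lie algebra.
\<close>

definition invariant_lorentzian_metric ::
  "'n::finite qmat1 set \<Rightarrow> 'n qmat1 set
    \<Rightarrow> (('n qmat1 \<times> 'n qmat1) set \<Rightarrow> ('n qmat1 \<times> 'n qmat1) set \<Rightarrow> real) \<Rightarrow> bool" where
  "invariant_lorentzian_metric G H q \<longleftrightarrow>
     (\<forall>g\<in>G. lorentzian_mod (tangent_at G g) (tangent_at ((**) g ` H) g)
               (\<lambda>U U'. q (dproj H g U) (dproj H g U'))) \<and>
     (\<forall>a\<in>G. \<forall>g\<in>G. \<forall>U\<in>tangent_at G g. \<forall>U'\<in>tangent_at G g.
        q (dproj H (a ** g) (a ** U)) (dproj H (a ** g) (a ** U')) = q (dproj H g U) (dproj H g U'))"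

text \<open>
  \<open>q\<close> is the field obtained from the scalar product \<open>B\<close> on \<open>m \<cong> T\<^sub>o(G/H)\<close> by left translations.
\<close>

definition defined_by ::
  "'n::finite qmat1 set \<Rightarrow> 'n qmat1 set \<Rightarrow> 'n qmat1 set \<Rightarrow> ('n qmat1 \<Rightarrow> 'n qmat1 \<Rightarrow> real)
    \<Rightarrow> (('n qmat1 \<times> 'n qmat1) set \<Rightarrow> ('n qmat1 \<times> 'n qmat1) set \<Rightarrow> real) \<Rightarrow> bool" where
  "defined_by G H m B q \<longleftrightarrow>
     (\<forall>g\<in>G. \<forall>X\<in>m. \<forall>Y\<in>m. q (dproj H g (g ** X)) (dproj H g (g ** Y)) = B X Y)"

definition admissible :: "'n::finite qmat1 set \<Rightarrow> 'n qmat1 set \<Rightarrow> bool" where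
  "admissible G H \<longleftrightarrow> cc_subgroup G H \<and> (\<exists>q. invariant_lorentzian_metric G H q)"

definition minimal_admissible :: "'n::finite qmat1 set \<Rightarrow> 'n qmat1 set \<Rightarrow> bool" where
  "minimal_admissible G H \<longleftrightarrow> admissible G H \<and>
     \<not> (\<exists>H'. cc_subgroup G H' \<and> H \<subset> H' \<and> admissible G H')"

definition class_II :: "'n::finite qmat1 set \<Rightarrow> bool" where
  "class_II H \<longleftrightarrow> H \<subseteq> K \<and> admissible Sp1n H \<and> invariants H pp \<noteq> {0}"


section \<open>Modules over \<open>sp\<^sub>1 + sp\<^sub>n\<^sub>-\<^sub>1\<close>\<close>

definition module_iso :: "'l set \<Rightarrow> 'a::real_vector set \<Rightarrow> ('l \<Rightarrow> 'a \<Rightarrow> 'a)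
    \<Rightarrow> 'b::real_vector set \<Rightarrow> ('l \<Rightarrow> 'b \<Rightarrow> 'b) \<Rightarrow> ('a \<Rightarrow> 'b) \<Rightarrow> bool" where
  "module_iso L S act T act' f \<longleftrightarrow> bij_betw f S T \<and>
     (\<forall>x\<in>S. \<forall>y\<in>S. f (x + y) = f x + f y) \<and> (\<forall>c. \<forall>x\<in>S. f (c *\<^sub>R x) = c *\<^sub>R f x) \<and>
     (\<forall>a\<in>L. \<forall>x\<in>S. act a x \<in> S \<and> f (act a x) = act' a (f x))"

definition act_mat :: "'n \<Rightarrow> quat \<times> 'n::finite qmat \<Rightarrow> 'n qmat1 \<Rightarrow> 'n qmat1" where
  "act_mat l = (\<lambda>(\<alpha>, A) M. hmat l \<alpha> A ** M - M ** hmat l \<alpha> A)"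

definition act_sp1 :: "quat \<times> 'n::finite qmat \<Rightarrow> quat \<Rightarrow> quat" where
  "act_sp1 = (\<lambda>(\<alpha>, A) x. \<alpha> * x - x * \<alpha>)"

definition act_W :: "quat \<times> 'n::finite qmat \<Rightarrow> quat ^ 'n \<Rightarrow> quat ^ 'n" where
  "act_W = (\<lambda>(\<alpha>, A) X. A *v X - (\<chi> i. X $ i * \<alpha>))"

definition invariant_form :: "'l set \<Rightarrow> 'a::real_vector set \<Rightarrow> ('l \<Rightarrow> 'a \<Rightarrow> 'a)
    \<Rightarrow> ('a \<Rightarrow> 'a \<Rightarrow> real) \<Rightarrow> bool" where
  "invariant_form L S act g \<longleftrightarrow> (\<forall>a\<in>L. \<forall>x\<in>S. \<forall>y\<in>S. g (act a x) y + g x (act a y) = 0)"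

text \<open>
  \<open>U \<otimes> \<real>\<^sup>2\<close> is realised as \<open>U \<times> U\<close>, i.e. as \<open>{z :: 'a ^ 2. z $ 1 \<in> U \<and> z $ 2 \<in> U}\<close>, with
  \<open>u \<otimes> a = (a\<^sub>1 u, a\<^sub>2 u)\<close>; an endomorphism of \<open>U\<close> acts on the first factor, i.e. componentwise.
  The lemma below shows that \<open>tensor_form g h\<close> is the product form \<open>g \<otimes> h\<close>.
\<close>

definition tensor :: "'a::real_vector \<Rightarrow> real ^ 2 \<Rightarrow> 'a ^ 2" where
  "tensor u a = (\<chi> i. a $ i *\<^sub>R u)"

definition tensor_R2 :: "'a::real_vector set \<Rightarrow> ('a ^ 2) set" where
  "tensor_R2 U = {z. \<forall>i. z $ i \<in> U}"

definition tensor_act :: "('l \<Rightarrow> 'a \<Rightarrow> 'a) \<Rightarrow> 'l \<Rightarrow> 'a ^ 2 \<Rightarrow> 'a ^ 2" where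
  "tensor_act act a z = (\<chi> i. act a (z $ i))"

definition tensor_form :: "('a::real_vector \<Rightarrow> 'a \<Rightarrow> real) \<Rightarrow> (real ^ 2 \<Rightarrow> real ^ 2 \<Rightarrow> real)
    \<Rightarrow> 'a ^ 2 \<Rightarrow> 'a ^ 2 \<Rightarrow> real" where
  "tensor_form g h z w = (\<Sum>i\<in>UNIV. \<Sum>j\<in>UNIV. g (z $ i) (w $ j) * h (axis i 1) (axis j 1))"

lemma tensor_form_tensor:
  assumes U: "subspace U" and g: "sym_bilinear_on U g" and h: "sym_bilinear_on UNIV h"
    and "u \<in> U" "w \<in> U"
  shows "tensor_form g h (tensor u a) (tensor w b) = g u w * h a b"
proof -
  have gb: "g x y = g y x" "g (c *\<^sub>R x) y = c * g x y" if "x \<in> U" "y \<in> U" for x y c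
    using g that unfolding sym_bilinear_on_def by simp_all
  have gs: "g (c *\<^sub>R u) (d *\<^sub>R w) = c * (d * g u w)" for c d
    using gb(2)[of u "d *\<^sub>R w" c] gb(2)[of w u d] gb(1)[of u w] gb(1)[of u "d *\<^sub>R w"]
      subspace_scale[OF U] assms(4,5) by simp
  have hs: "h x y = h y x" and ha: "h (x + y) z = h x z + h y z"
    and hc: "h (c *\<^sub>R x) y = c * h x y" for x y z c
    using h unfolding sym_bilinear_on_def by blast+
  have ha': "h z (x + y) = h z x + h z y" for x y z
    using hs[of z "x + y"] ha hs[of z x] hs[of z y] by simp
  have hc': "h x (c *\<^sub>R y) = c * h x y" for x y c
    using hs[of x "c *\<^sub>R y"] hc hs[of x y] by simp
  have e: "x = x $ 1 *\<^sub>R axis 1 1 + x $ 2 *\<^sub>R axis 2 1" for x :: "real ^ 2"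
    by (simp add: vec_eq_iff forall_2 axis_def)
  have "h a b = h (a $ 1 *\<^sub>R axis 1 1 + a $ 2 *\<^sub>R axis 2 1) (b $ 1 *\<^sub>R axis 1 1 + b $ 2 *\<^sub>R axis 2 1)"
    by (subst e[of a], subst e[of b]) (rule refl)
  then have hab: "h a b = a $ 1 * (b $ 1 * h (axis 1 1) (axis 1 1)) + a $ 1 * (b $ 2 * h (axis 1 1) (axis 2 1))
      + (a $ 2 * (b $ 1 * h (axis 2 1) (axis 1 1)) + a $ 2 * (b $ 2 * h (axis 2 1) (axis 2 1)))"
    by (simp add: ha ha' hc hc' distrib_left)
  show ?thesis
    unfolding hab tensor_form_def tensor_def sum_2 by (simp add: gs algebra_simps)
qed

text \<open>The module \<open>\<real> + sp\<^sub>1 \<otimes> \<real>\<^sup>2 + \<bbbH>\<^sup>n\<^sup>-\<^sup>1 \<otimes> \<real>\<^sup>2\<close>, and its identification with \<open>m\<close>.\<close>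

type_synonym 'n model = "real \<times> (quat, 2) vec \<times> ((quat, 'n) vec, 2) vec"

definition model :: "'n \<Rightarrow> 'n::finite model set" where
  "model l = UNIV \<times> tensor_R2 ImH \<times> tensor_R2 (W l)"

definition act_model :: "quat \<times> 'n::finite qmat \<Rightarrow> 'n model \<Rightarrow> 'n model" where
  "act_model a = (\<lambda>(r, z, Z). (0, tensor_act act_sp1 a z, tensor_act act_W a Z))"

definition to_mm :: "'n \<Rightarrow> 'n::finite model \<Rightarrow> 'n qmat1" where
  "to_mm l = (\<lambda>(r, z, Z). r *\<^sub>R vv l + nmat l (z $ 1) (Z $ 1) + pmat l (z $ 2) (Z $ 2))"

text \<open>\<open>B\<close> is the form \<open>- c v\<^sup>* \<otimes> v\<^sup>* + g\<^sub>1 \<otimes> h\<^sub>1 + g\<^sub>2 \<otimes> h\<^sub>2\<close> on \<open>m\<close>.\<close>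

definition is_form :: "'n \<Rightarrow> real \<Rightarrow> (quat \<Rightarrow> quat \<Rightarrow> real) \<Rightarrow> (real ^ 2 \<Rightarrow> real ^ 2 \<Rightarrow> real)
    \<Rightarrow> (quat ^ 'n \<Rightarrow> quat ^ 'n \<Rightarrow> real) \<Rightarrow> (real ^ 2 \<Rightarrow> real ^ 2 \<Rightarrow> real)
    \<Rightarrow> ('n::finite qmat1 \<Rightarrow> 'n qmat1 \<Rightarrow> real) \<Rightarrow> bool" where
  "is_form l c g1 h1 g2 h2 B \<longleftrightarrow>
     (\<forall>(r, z, Z)\<in>model l. \<forall>(r', z', Z')\<in>model l.
        B (to_mm l (r, z, Z)) (to_mm l (r', z', Z')) =
          - c * v_star l (to_mm l (r, z, Z)) * v_star l (to_mm l (r', z', Z'))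
          + tensor_form g1 h1 z z' + tensor_form g2 h2 Z Z')"

end

theory Submission
  imports Defs
begin

text \<open>
  Let \<open>G = Sp\<^sub>1\<^sub>,\<^sub>n\<close> and \<open>J = diag(-1, 1, \<dots>, 1)\<close>.

  \<^emph>\<open>Groups and Lie algebras.\<close> \<open>G\<close>, \<open>K\<close> and the stabilizer of \<open>v\<close> in \<open>K\<close> consist of the isometries of \<open>J\<close>
  which commute with given matrices. The Lie algebra of such a group is found by differentiation in one
  direction and by the Cayley transform in the other (\<open>lie_unitary\<close>). The stabilizer of \<open>v\<close> is
  \<open>Sp\<^sub>1 \<times> Sp\<^sub>n\<^sub>-\<^sub>1\<close>, which is connected, as the symplectic group is generated by quaternionic reflections,
  each of which lies on a 3-sphere through the identity (\<open>SpW_connected_component\<close>, \<open>Kv_eq\<close>). The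
  decompositions and module isomorphisms are read off from the matrices. The diagonal matrices in
  \<open>K\<^sub>v\<close> suffice to see that only multiples of \<open>v\<close> are invariant (\<open>fixed_by_Kv\<close>).

  \<^emph>\<open>Invariant metrics\<close> correspond to \<open>Ad(K\<^sub>v)\<close>-invariant scalar products on \<open>m\<close>, by restriction to the
  base point in one direction and by left translation in the other (\<open>metric_Ad\<close>,
  \<open>left_field_invariant\<close>). By Schur's lemma, an invariant symmetric form on \<open>m\<close> is
  \<open>- c v\<^sup>* \<otimes> v\<^sup>* + g\<^sub>1 \<otimes> h\<^sub>1 + g\<^sub>2 \<otimes> h\<^sub>2\<close> with the standard scalar products \<open>g\<^sub>1\<close>, \<open>g\<^sub>2\<close>, as \<open>sp\<^sub>1\<close> and \<open>\<bbbH>\<^sup>n\<^sup>-\<^sup>1\<close> are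
  irreducible of real type and \<open>\<real>\<close>, \<open>sp\<^sub>1\<close>, \<open>\<bbbH>\<^sup>n\<^sup>-\<^sup>1\<close> are inequivalent (\<open>invariant_form_classification\<close>; the
  proof uses explicit group elements). The dimensions of \<open>sp\<^sub>1\<close> and \<open>\<bbbH>\<^sup>n\<^sup>-\<^sup>1\<close> are different
  from one, so the single negative direction of a Lorentzian form must be \<open>\<real>v\<close>, and \<open>c\<close>, \<open>h\<^sub>1\<close>, \<open>h\<^sub>2\<close> are
  positive (\<open>lorentzian_form_signs\<close>). Conversely, all these forms are Lorentzian (\<open>formB_lorentzian\<close>).

  \<^emph>\<open>Minimality\<close> (\<open>Kv_maximal_admissible\<close>). Let \<open>H \<supseteq> K\<^sub>v\<close> be compact and connected with \<open>G/H\<close>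
  admissible. The invariant metric gives an \<open>Ad(H)\<close>-invariant form on the Lie algebra. The orbit of a
  timelike vector stays in one half of the time cone, and its convex hull contains a vector \<open>u \<noteq> 0\<close> fixed
  by \<open>H\<close> (\<open>compact_group_fixed_point\<close>). Since \<open>K\<^sub>v\<close> fixes \<open>u\<close>, it is a multiple of \<open>v\<close>; so the compact group
  \<open>H\<close> is contained in the centralizer of \<open>v\<close>, and therefore in \<open>K\<^sub>v\<close> (\<open>bounded_centralizer_subset_Kv\<close>).

  \<^emph>\<open>Uniqueness\<close> (\<open>class_II_conjugate\<close>). \<open>K\<close> is transitive on the spheres of \<open>p\<close>, so a subgroup \<open>H \<subseteq> K\<close>
  with \<open>p\<^sup>H \<noteq> 0\<close> is conjugate to a subgroup of \<open>K\<^sub>v\<close>. Admissibility is invariant under conjugation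
  (\<open>admissible_conj\<close>), and a minimal \<open>H\<close> is conjugate to \<open>K\<^sub>v\<close> itself.
\<close>

section \<open>Quaternion arithmetic\<close>

lemma quat_mult_sel:
  "qre (x * y) = qre x * qre y - qi x * qi y - qj x * qj y - qk x * qk y"
  "qi (x * y) = qre x * qi y + qi x * qre y + qj x * qk y - qk x * qj y"
  "qj (x * y) = qre x * qj y - qi x * qk y + qj x * qre y + qk x * qi y"
  "qk (x * y) = qre x * qk y + qi x * qj y - qj x * qi y + qk x * qre y"
  by (simp_all add: times_quat_def)

lemma qcnj_sel [simp]:
  "qre (qcnj x) = qre x" "qi (qcnj x) = - qi x" "qj (qcnj x) = - qj x" "qk (qcnj x) = - qk x"
  by (simp_all add: qcnj_def)

lemmas quat_simps = quat_eq_iff quat_mult_sel inner_quat_def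

lemma qcnj_simps [simp]:
  "qcnj 0 = 0" "qcnj 1 = 1" "qcnj (qcnj x) = x" "qcnj (- x) = - qcnj x"
  "qcnj (c *\<^sub>R x) = c *\<^sub>R qcnj x"
  by (simp_all add: quat_eq_iff)

lemma qcnj_add: "qcnj (x + y) = qcnj x + qcnj y"
  and qcnj_diff: "qcnj (x - y) = qcnj x - qcnj y"
  and qcnj_mult: "qcnj (x * y) = qcnj y * qcnj x"
  by (simp_all add: quat_simps algebra_simps)

lemma qcnj_sum: "qcnj (\<Sum>i\<in>S. f i) = (\<Sum>i\<in>S. qcnj (f i))"
  by (induction S rule: infinite_finite_induct) (simp_all add: qcnj_add)

lemma norm_quat_sq: "(norm x)\<^sup>2 = qre x * qre x + qi x * qi x + qj x * qj x + qk x * qk x"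
  by (simp add: power2_norm_eq_inner inner_quat_def)

lemma qcnj_mult_self: "qcnj x * x = (norm x)\<^sup>2 *\<^sub>R 1" "x * qcnj x = (norm x)\<^sup>2 *\<^sub>R 1"
  by (simp_all add: quat_simps norm_quat_sq algebra_simps)

lemma qcnj_unit [simp]: "norm a = 1 \<Longrightarrow> qcnj a * a = 1" "norm a = 1 \<Longrightarrow> a * qcnj a = 1"
  by (simp_all add: qcnj_mult_self)

lemma norm_qcnj [simp]: "norm (qcnj x) = norm x"
  by (simp add: norm_eq_sqrt_inner inner_quat_def)

lemma norm_one_quat [simp]: "norm (1 :: quat) = 1"
  by (simp add: norm_eq_sqrt_inner inner_quat_def)

lemma norm_mult_quat: "norm (x * y) = norm x * norm (y :: quat)"
proof -
  have "(norm (x * y))\<^sup>2 = (norm x * norm y)\<^sup>2"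
    unfolding power_mult_distrib norm_quat_sq quat_mult_sel by algebra
  then show ?thesis by (simp add: power2_eq_iff_nonneg)
qed

lemma inner_quat: "x \<bullet> y = qre (qcnj x * y)"
  by (simp add: quat_simps)

lemma inner_mult_left_quat: "(a * x) \<bullet> y = x \<bullet> (qcnj a * y)"
  and inner_mult_right_quat: "(x * a) \<bullet> y = x \<bullet> (y * qcnj a)"
  by (simp_all add: quat_simps algebra_simps)

lemma unit_quats: "norm (Quat 0 1 0 0) = 1" "norm (Quat 0 0 1 0) = 1" "norm (Quat 0 0 0 1) = 1"
  by (simp_all add: norm_eq_sqrt_inner inner_quat_def)

text \<open>The centre of \<open>\<bbbH>\<close> is \<open>\<real>\<close>: commuting with \<open>i\<close> and \<open>j\<close> kills the imaginary part.\<close>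

lemma commutes_with_units_imp_real:
  assumes "\<And>a. norm a = 1 \<Longrightarrow> a * x = x * a"
  shows "x = qre x *\<^sub>R 1"
  using assms[OF unit_quats(1)] assms[OF unit_quats(2)] by (simp add: quat_simps)

lemma ImH_iff_qcnj: "x \<in> ImH \<longleftrightarrow> qcnj x = - x"
  by (auto simp: ImH_def quat_eq_iff)

lemma subspace_ImH: "subspace ImH"
  by (simp add: subspace_def ImH_def)


section \<open>Quaternionic matrices\<close>

lemma mmul_nth: "(A ** B) $ i $ j = (\<Sum>k\<in>UNIV. A $ i $ k * B $ k $ j)"
  by (simp add: matrix_matrix_mult_def)

lemma mvmul_nth: "(A *v x) $ i = (\<Sum>k\<in>UNIV. A $ i $ k * x $ k)"
  by (simp add: matrix_vector_mult_def)

lemma bounded_bilinear_mmul: "bounded_bilinear ((**) :: 'm::finite qmat \<Rightarrow> 'm qmat \<Rightarrow> 'm qmat)"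
  unfolding bilinear_conv_bounded_bilinear[symmetric] bilinear_def
  by (auto intro!: linearI simp: vec_eq_iff mmul_nth distrib_left distrib_right sum.distrib
      scaleR_right.sum)

lemma bounded_bilinear_mvmul:
  "bounded_bilinear ((*v) :: 'm::finite qmat \<Rightarrow> quat ^ 'm \<Rightarrow> quat ^ 'm)"
  unfolding bilinear_conv_bounded_bilinear[symmetric] bilinear_def
  by (auto intro!: linearI simp: vec_eq_iff mvmul_nth distrib_left distrib_right sum.distrib
      scaleR_right.sum)

lemmas mmul_linear = bounded_bilinear.add_left[OF bounded_bilinear_mmul]
  bounded_bilinear.add_right[OF bounded_bilinear_mmul]
  bounded_bilinear.diff_left[OF bounded_bilinear_mmul]
  bounded_bilinear.diff_right[OF bounded_bilinear_mmul]
  bounded_bilinear.minus_left[OF bounded_bilinear_mmul]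
  bounded_bilinear.minus_right[OF bounded_bilinear_mmul]
  bounded_bilinear.scaleR_left[OF bounded_bilinear_mmul]
  bounded_bilinear.scaleR_right[OF bounded_bilinear_mmul]

lemmas mmul_zero [simp] = bounded_bilinear.zero_left[OF bounded_bilinear_mmul]
  bounded_bilinear.zero_right[OF bounded_bilinear_mmul]

lemmas continuous_on_mmul [continuous_intros] =
  bounded_bilinear.continuous_on[OF bounded_bilinear_mmul]

lemma adjoint_nth [simp]: "adjoint_mat A $ i $ j = qcnj (A $ j $ i)"
  by (simp add: adjoint_mat_def)

lemma adjoint_simps [simp]:
  "adjoint_mat (adjoint_mat A) = A" "adjoint_mat (- A) = - adjoint_mat A"
  "adjoint_mat (A + B) = adjoint_mat A + adjoint_mat B"
  "adjoint_mat (A - B) = adjoint_mat A - adjoint_mat B"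
  "adjoint_mat (c *\<^sub>R A) = c *\<^sub>R adjoint_mat A" "adjoint_mat (mat 1) = mat 1"
  "adjoint_mat 0 = 0"
  by (simp_all add: vec_eq_iff mat_def qcnj_add qcnj_diff)

lemma adjoint_mmul: "adjoint_mat (A ** B) = adjoint_mat B ** adjoint_mat A"
  by (simp add: vec_eq_iff mmul_nth qcnj_sum qcnj_mult)

lemma bounded_linear_adjoint: "bounded_linear (adjoint_mat :: 'm::finite qmat \<Rightarrow> 'm qmat)"
  unfolding linear_conv_bounded_linear[symmetric] by (rule linearI) simp_all

lemma matrix_eqI: "(\<And>x. A *v x = B *v x) \<Longrightarrow> A = (B :: 'm::finite qmat)"
proof -
  assume eq: "\<And>x. A *v x = B *v x"
  have "A $ i $ j = B $ i $ j" for i j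
  proof -
    have "(A *v axis j 1) $ i = A $ i $ j" for A :: "'m qmat"
      by (simp add: mvmul_nth axis_def if_distrib cong: if_cong)
    then show ?thesis using eq by metis
  qed
  then show ?thesis by (simp add: vec_eq_iff)
qed

text \<open>
  Matrices act real linearly on \<open>\<bbbH>\<^sup>n\<close>, a space of finite real dimension, where injective maps are
  surjective. The columns of the inverse are the preimages of the standard basis vectors.
\<close>

lemma injective_matrix_has_inverse:
  fixes A :: "'m::finite qmat"
  assumes inj: "\<And>x. A *v x = 0 \<Longrightarrow> x = 0"
  obtains B where "A ** B = mat 1" "B ** A = mat 1"
proof -
  have lin: "linear ((*v) A)" by simp
  have "inj ((*v) A)"
    using inj linear_injective_0[OF lin] by blast
  then have "surj ((*v) A)"
    using lin by (rule linear_inj_imp_surj[rotated])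
  then have "\<forall>j. \<exists>b. A *v b = axis j 1" by (metis surjD)
  then obtain b where b: "\<And>j. A *v b j = axis j 1" by metis
  define B where "B = (\<chi> i j. b j $ i)"
  have AB: "A ** B = mat 1"
  proof -
    have "(A ** B) $ i $ j = (A *v b j) $ i" for i j
      by (simp add: mmul_nth mvmul_nth B_def)
    then show ?thesis by (simp add: vec_eq_iff b axis_def mat_def)
  qed
  have "A *v (B *v (A *v x) - x) = 0" for x
    by (simp add: matrix_vector_mult_diff_distrib matrix_vector_mul_assoc matrix_mul_assoc AB)
  then have "B *v (A *v x) - x = 0" for x using inj by blast
  then have "B ** A = mat 1"
    by (intro matrix_eqI) (simp add: matrix_vector_mul_assoc[symmetric])
  with AB that show ?thesis by blast
qed

lemma mmul_one_commute:
  fixes A B :: "'m::finite qmat"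
  assumes "A ** B = mat 1" shows "B ** A = mat 1"
proof -
  have "x = 0" if "B *v x = 0" for x
    using assms that by (metis matrix_vector_mul_assoc matrix_vector_mul_lid matrix_vector_mult_0_right)
  then obtain C where "B ** C = mat 1" "C ** B = mat 1"
    using injective_matrix_has_inverse by blast
  then show ?thesis using assms by (metis matrix_mul_assoc matrix_mul_lid matrix_mul_rid)
qed

lemma matrix_inv_eqI:
  fixes A B :: "'m::finite qmat"
  assumes "A ** B = mat 1" shows "matrix_inv A = B"
proof -
  have "A ** matrix_inv A = mat 1 \<and> matrix_inv A ** A = mat 1"
    unfolding matrix_inv_def using assms mmul_one_commute by (metis (mono_tags, lifting) someI_ex)
  then show ?thesis using assms by (metis matrix_mul_assoc matrix_mul_lid matrix_mul_rid)
qed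

section \<open>Groups of isometries and their Lie algebras\<close>

text \<open>
  All groups in question have the form \<open>unitary J C\<close>: the isometries of the Hermitian form with
  matrix \<open>J\<close> which commute with the matrices in \<open>C\<close>. For \<open>J = diag(-1, 1, \<dots>, 1)\<close> the choices
  \<open>C = {}\<close>, \<open>C = {J}\<close> and \<open>C = {J, v}\<close> give \<open>Sp\<^sub>1\<^sub>,\<^sub>n\<close>, \<open>K\<close> and the stabilizer of \<open>v\<close> in \<open>K\<close>, and \<open>J = 1\<close>,
  \<open>C = {}\<close> gives \<open>Sp\<^sub>n\<close>. So properties of these groups and of their Lie algebras \<open>unitary_alg J C\<close>
  need one proof only.
\<close>

definition unitary :: "'m::finite qmat \<Rightarrow> 'm qmat set \<Rightarrow> 'm qmat set" where
  "unitary J C = {A. adjoint_mat A ** J ** A = J \<and> (\<forall>M\<in>C. A ** M = M ** A)}"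

definition unitary_alg :: "'m::finite qmat \<Rightarrow> 'm qmat set \<Rightarrow> 'm qmat set" where
  "unitary_alg J C = {X. adjoint_mat X ** J + J ** X = 0 \<and> (\<forall>M\<in>C. X ** M = M ** X)}"

definition involution :: "'m::finite qmat \<Rightarrow> bool" where
  "involution J \<longleftrightarrow> J ** J = mat 1"

lemma unitary_inverse:
  assumes J: "involution J" and A: "A \<in> unitary J C"
  shows "(J ** adjoint_mat A ** J) ** A = mat 1" "A ** (J ** adjoint_mat A ** J) = mat 1"
    "matrix_inv A = J ** adjoint_mat A ** J"
proof -
  show 1: "(J ** adjoint_mat A ** J) ** A = mat 1"
    using A J by (simp add: unitary_def involution_def matrix_mul_assoc[symmetric])
  then show "A ** (J ** adjoint_mat A ** J) = mat 1" by (rule mmul_one_commute)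
  then show "matrix_inv A = J ** adjoint_mat A ** J" by (rule matrix_inv_eqI)
qed

lemma unitary_matrix_inv:
  assumes "involution J" and "A \<in> unitary J C"
  shows "matrix_inv A ** A = mat 1" "A ** matrix_inv A = mat 1"
  using unitary_inverse[OF assms] by simp_all

lemma unitary_mult: "A \<in> unitary J C \<Longrightarrow> B \<in> unitary J C \<Longrightarrow> A ** B \<in> unitary J C"
  unfolding unitary_def by (simp add: adjoint_mmul) (metis matrix_mul_assoc)

lemma unitary_one: "mat 1 \<in> unitary J C"
  by (simp add: unitary_def)

lemma unitary_inv:
  assumes "involution J" "A \<in> unitary J C" shows "matrix_inv A \<in> unitary J C"
proof -
  let ?B = "matrix_inv A"
  note inv = unitary_matrix_inv[OF assms]
  have "adjoint_mat ?B ** J ** ?B = adjoint_mat ?B ** (adjoint_mat A ** J ** A) ** ?B"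
    using assms by (simp add: unitary_def)
  also have "\<dots> = adjoint_mat (A ** ?B) ** J ** (A ** ?B)"
    by (simp add: adjoint_mmul matrix_mul_assoc)
  also have "\<dots> = J" by (simp add: inv)
  finally have 1: "adjoint_mat ?B ** J ** ?B = J" .
  have "?B ** M = M ** ?B" if "M \<in> C" for M
  proof -
    have "?B ** M = ?B ** (M ** A) ** ?B"
      by (metis inv(2) matrix_mul_assoc matrix_mul_rid)
    also have "\<dots> = ?B ** (A ** M) ** ?B"
      using assms that by (simp add: unitary_def)
    also have "\<dots> = M ** ?B"
      by (simp add: matrix_mul_assoc inv)
    finally show ?thesis .
  qed
  with 1 show ?thesis by (simp add: unitary_def)
qed

lemma unitary_is_subgroup: "involution J \<Longrightarrow> is_subgroup (unitary J {}) (unitary J C)"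
  by (auto simp: is_subgroup_def unitary_one unitary_mult unitary_inv) (simp add: unitary_def)

lemma closed_unitary: "closed (unitary J C)"
proof -
  have "unitary J C = {A. adjoint_mat A ** J ** A = J} \<inter> (\<Inter>M\<in>C. {A. A ** M = M ** A})"
    by (auto simp: unitary_def)
  moreover have "closed {A. adjoint_mat A ** J ** A = J}"
    by (intro closed_Collect_eq continuous_intros linear_continuous_on bounded_linear_adjoint)
  moreover have "closed {A. A ** M = M ** A}" for M :: "'a qmat"
    by (intro closed_Collect_eq continuous_intros)
  ultimately show ?thesis by (simp add: closed_Int closed_INT)
qed

text \<open>
  The Cayley transform. If \<open>Y\<close> is infinitesimally unitary then \<open>P = 1 + Y\<close> and \<open>Q = 1 - Y\<close> satisfy
  \<open>P\<^sup>* J = J Q\<close>, \<open>Q\<^sup>* J = J P\<close> and \<open>P Q = Q P\<close>; so \<open>P\<close> and \<open>Q\<close> change the Hermitian form in the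
  same way, and \<open>P Q\<^sup>-\<^sup>1\<close> is unitary.
\<close>

lemma cayley_unitary:
  assumes Y: "Y \<in> unitary_alg J C"
    and inv: "(mat 1 - Y) ** M = mat 1"
  shows "(mat 1 + Y) ** M \<in> unitary J C"
proof -
  let ?P = "mat 1 + Y" and ?Q = "mat 1 - Y"
  let ?g = "?P ** M"
  have MQ: "M ** ?Q = mat 1" using inv by (rule mmul_one_commute)
  have Y': "adjoint_mat Y ** J = - (J ** Y)"
    using Y by (simp add: unitary_alg_def eq_neg_iff_add_eq_0)
  have P: "adjoint_mat ?P ** J = J ** ?Q" and Q: "adjoint_mat ?Q ** J = J ** ?P"
    by (simp_all add: mmul_linear Y')
  have PQ: "?P ** ?Q = ?Q ** ?P"
    by (simp add: mmul_linear)
  have "adjoint_mat ?g ** J ** ?g = adjoint_mat M ** (adjoint_mat ?P ** J) ** ?P ** M"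
    by (simp add: adjoint_mmul matrix_mul_assoc)
  also have "\<dots> = adjoint_mat M ** J ** (?Q ** ?P) ** M"
    unfolding P by (simp add: matrix_mul_assoc)
  also have "\<dots> = adjoint_mat M ** (J ** ?P) ** ?Q ** M"
    unfolding PQ[symmetric] by (simp add: matrix_mul_assoc)
  also have "\<dots> = adjoint_mat (?Q ** M) ** J ** (?Q ** M)"
    unfolding Q[symmetric] by (simp add: adjoint_mmul matrix_mul_assoc)
  also have "\<dots> = J" by (simp add: inv)
  finally have 1: "adjoint_mat ?g ** J ** ?g = J" .
  have "?g ** N = N ** ?g" if "N \<in> C" for N
  proof -
    have YN: "Y ** N = N ** Y" using Y that by (simp add: unitary_alg_def)
    then have "?P ** N = N ** ?P" "?Q ** N = N ** ?Q"
      by (simp_all add: mmul_linear)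
    moreover from this(2) have "M ** N = N ** M"
      by (metis MQ inv matrix_mul_assoc matrix_mul_lid matrix_mul_rid)
    ultimately show ?thesis by (metis matrix_mul_assoc)
  qed
  with 1 show ?thesis by (simp add: unitary_def)
qed

lemma subspace_unitary_alg: "subspace (unitary_alg J C)"
proof (rule subspaceI)
  show "0 \<in> unitary_alg J C"
    by (simp add: unitary_alg_def)
next
  fix x y assume "x \<in> unitary_alg J C" "y \<in> unitary_alg J C"
  moreover have "adjoint_mat (x + y) ** J + J ** (x + y)
      = (adjoint_mat x ** J + J ** x) + (adjoint_mat y ** J + J ** y)"
    by (simp add: mmul_linear)
  ultimately show "x + y \<in> unitary_alg J C"
    unfolding unitary_alg_def by (simp del: adjoint_simps add: mmul_linear)
next
  fix c x assume "x \<in> unitary_alg J C"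
  then show "c *\<^sub>R x \<in> unitary_alg J C"
    by (simp add: unitary_alg_def mmul_linear flip: scaleR_add_right)
qed

section \<open>Tangent spaces\<close>

lemma tangent_at_bounded_linear:
  assumes L: "bounded_linear L" and u: "u \<in> tangent_at S p"
  shows "L u \<in> tangent_at (L ` S) (L p)"
proof -
  obtain c where "c 0 = p" "\<And>t. c t \<in> S" "(c has_vector_derivative u) (at 0)"
    using u by (auto simp: tangent_at_def)
  then show ?thesis
    unfolding tangent_at_def using bounded_linear.has_vector_derivative[OF L]
    by (intro CollectI exI[of _ "\<lambda>t. L (c t)"]) auto
qed

lemma tangent_at_linear_image:
  assumes L: "bounded_linear L" "bounded_linear L'" and inv: "\<And>x. L' (L x) = x" "\<And>x. L (L' x) = x"
  shows "tangent_at (L ` S) (L p) = L ` tangent_at S p"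
proof (intro equalityI subsetI)
  fix u assume "u \<in> tangent_at (L ` S) (L p)"
  then have "L' u \<in> tangent_at (L' ` L ` S) (L' (L p))"
    by (rule tangent_at_bounded_linear[OF L(2)])
  then have "L' u \<in> tangent_at S p" by (simp add: inv image_image)
  then show "u \<in> L ` tangent_at S p" using inv(2)[of u] by (metis imageI)
qed (auto intro: tangent_at_bounded_linear[OF L(1)])

lemma bounded_linear_mmul_left: "bounded_linear ((**) (A :: 'm::finite qmat) :: 'm qmat \<Rightarrow> 'm qmat)"
  by (rule bounded_bilinear.bounded_linear_right[OF bounded_bilinear_mmul])

lemma bounded_linear_mmul_right: "bounded_linear (\<lambda>X :: 'm::finite qmat. X ** (A :: 'm qmat))"
  by (rule bounded_bilinear.bounded_linear_left[OF bounded_bilinear_mmul])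

lemma tangent_at_left_translate:
  fixes g g' p :: "'m::finite qmat"
  assumes "g ** g' = mat 1"
  shows "tangent_at ((**) g ` S) (g ** p) = (**) g ` tangent_at S p"
  using tangent_at_linear_image[OF bounded_linear_mmul_left bounded_linear_mmul_left, of g' g S p]
    assms mmul_one_commute[OF assms]
  by (simp add: matrix_mul_assoc)

lemma tangent_at_right_translate:
  fixes g g' p :: "'m::finite qmat"
  assumes "g ** g' = mat 1"
  shows "tangent_at ((\<lambda>X. X ** g) ` S) (p ** g) = (\<lambda>X. X ** g) ` tangent_at S p"
  using tangent_at_linear_image[OF bounded_linear_mmul_right bounded_linear_mmul_right, of g g' S p]
    assms mmul_one_commute[OF assms]
  by (simp flip: matrix_mul_assoc)

text \<open>
  The equations that define the group, differentiated along a curve through \<open>1\<close>, become the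
  equations that define the Lie algebra.
\<close>

lemma tangent_unitary_subset: "tangent_at (unitary J C) (mat 1) \<subseteq> unitary_alg J C"
proof
  fix u assume "u \<in> tangent_at (unitary J C) (mat 1)"
  then obtain c where c: "c 0 = mat 1" "\<And>t. c t \<in> unitary J C"
    and d: "(c has_vector_derivative u) (at 0)"
    by (auto simp: tangent_at_def)
  note mul = bounded_bilinear.has_vector_derivative[OF bounded_bilinear_mmul]
  note L = bounded_linear.has_vector_derivative[OF bounded_linear_mmul_left]
  note R = bounded_linear.has_vector_derivative[OF bounded_linear_mmul_right]
  have "((\<lambda>t. adjoint_mat (c t) ** (J ** c t)) has_vector_derivative
      adjoint_mat (c 0) ** (J ** u) + adjoint_mat u ** (J ** c 0)) (at 0)"
    by (rule mul[OF bounded_linear.has_vector_derivative[OF bounded_linear_adjoint d] L[OF d]])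
  moreover have "(\<lambda>t. adjoint_mat (c t) ** (J ** c t)) = (\<lambda>t. J)"
    using c(2) by (simp add: unitary_def matrix_mul_assoc)
  ultimately have "J ** u + adjoint_mat u ** J = 0"
    using vector_derivative_unique_at[OF _ has_vector_derivative_const] by (simp add: c(1))
  moreover have "u ** M = M ** u" if "M \<in> C" for M
  proof -
    have "(\<lambda>t. c t ** M) = (\<lambda>t. M ** c t)" using c(2) that by (simp add: unitary_def)
    then have "((\<lambda>t. M ** c t) has_vector_derivative u ** M) (at 0)"
      using R[OF d, of M] by simp
    then show ?thesis using L[OF d, of M] by (rule vector_derivative_unique_at)
  qed
  ultimately show "u \<in> unitary_alg J C"
    by (simp add: unitary_alg_def add.commute)
qed

text \<open>
  \<open>1 - t Y\<close> is injective, hence invertible, as long as the norm of \<open>t Y\<close> is small; the inverse \<open>M t\<close>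
  satisfies \<open>M t - 1 = t Y (M t)\<close> and is therefore bounded and tends to \<open>1\<close>.
\<close>

lemma inverse_near_identity:
  fixes Y :: "'a::finite qmat"
  obtains d M where "d > 0" "\<And>t. \<bar>t\<bar> < d \<Longrightarrow> (mat 1 - t *\<^sub>R Y) ** M t = mat 1" "(M \<longlongrightarrow> mat 1) (at 0)"
proof -
  have "\<exists>k>0. \<forall>(a :: 'a qmat) (b :: 'a qmat). norm (a ** b) \<le> norm a * norm b * k"
    by (rule bounded_bilinear.pos_bounded[OF bounded_bilinear_mmul])
  then obtain k where k: "k > 0" "\<And>(a :: 'a qmat) (b :: 'a qmat). norm (a ** b) \<le> norm a * norm b * k"
      by blast
  have "\<exists>k>0. \<forall>(a :: 'a qmat) b. norm (a *v b) \<le> norm a * norm b * k"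
    by (rule bounded_bilinear.pos_bounded[OF bounded_bilinear_mvmul])
  then obtain k' where k': "k' > 0" "\<And>(a :: 'a qmat) b. norm (a *v b) \<le> norm a * norm b * k'"
    by blast
  \<comment> \<open>For \<open>|t| < d\<close>, multiplication by \<open>t Y\<close> at least halves the norm, of vectors and of matrices.\<close>
  define d where "d = 1 / (2 * (norm Y + 1) * (k + k'))"
  have d: "d > 0" using k k' by (simp add: d_def add_nonneg_pos)
  have small: "\<bar>t\<bar> * norm Y * k \<le> 1/2" "\<bar>t\<bar> * norm Y * k' \<le> 1/2" if t: "\<bar>t\<bar> < d" for t
  proof -
    have pos: "0 < (norm Y + 1) * (k + k')"
      using k k' by (simp add: add_nonneg_pos)
    have "\<bar>t\<bar> * ((norm Y + 1) * (k + k')) \<le> d * ((norm Y + 1) * (k + k'))"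
      using t pos by (intro mult_right_mono) auto
    also have "\<dots> = 1/2" unfolding d_def using pos by (simp add: field_simps)
    finally have *: "\<bar>t\<bar> * ((norm Y + 1) * (k + k')) \<le> 1/2" .
    have "norm Y * k \<le> (norm Y + 1) * (k + k')" "norm Y * k' \<le> (norm Y + 1) * (k + k')"
      using k k' by (intro mult_mono; simp)+
    then have "\<bar>t\<bar> * (norm Y * k) \<le> \<bar>t\<bar> * ((norm Y + 1) * (k + k'))"
        "\<bar>t\<bar> * (norm Y * k') \<le> \<bar>t\<bar> * ((norm Y + 1) * (k + k'))"
      by (intro mult_left_mono; simp)+
    with * show "\<bar>t\<bar> * norm Y * k \<le> 1/2" "\<bar>t\<bar> * norm Y * k' \<le> 1/2"
      unfolding mult.assoc by linarith+
  qed
  have "\<exists>M. (mat 1 - t *\<^sub>R Y) ** M = mat 1" if t: "\<bar>t\<bar> < d" for t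
  proof -
    have "x = 0" if x: "(mat 1 - t *\<^sub>R Y) *v x = 0" for x
    proof -
      have "x = t *\<^sub>R (Y *v x)"
        using x by (simp add: bounded_bilinear.diff_left[OF bounded_bilinear_mvmul]
            bounded_bilinear.scaleR_left[OF bounded_bilinear_mvmul])
      then have "norm x = \<bar>t\<bar> * norm (Y *v x)" by (metis norm_scaleR)
      also have "\<dots> \<le> \<bar>t\<bar> * (norm Y * norm x * k')"
        using k'(2) by (intro mult_left_mono) auto
      also have "\<dots> = (\<bar>t\<bar> * norm Y * k') * norm x" by simp
      also have "\<dots> \<le> 1/2 * norm x" by (intro mult_right_mono small t) simp
      finally show ?thesis by simp
    qed
    then show ?thesis using injective_matrix_has_inverse by metis
  qed
  then obtain M where M: "\<And>t. \<bar>t\<bar> < d \<Longrightarrow> (mat 1 - t *\<^sub>R Y) ** M t = mat 1" by metis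
  have Meq: "M t = mat 1 + t *\<^sub>R (Y ** M t)" if "\<bar>t\<bar> < d" for t
    using M[OF that] by (simp add: mmul_linear algebra_simps)
  have Mbound: "norm (M t - mat 1) \<le> \<bar>t\<bar> * (norm Y * k * (2 * norm (mat 1 :: 'a qmat)))" if t: "\<bar>t\<bar> < d"
      for t
  proof -
    have 1: "norm (M t - mat 1) \<le> \<bar>t\<bar> * (norm Y * norm (M t) * k)"
    proof -
      have "M t - mat 1 = t *\<^sub>R (Y ** M t)" using Meq[OF t] by (simp add: algebra_simps)
      then have "norm (M t - mat 1) = \<bar>t\<bar> * norm (Y ** M t)" by simp
      also have "\<dots> \<le> \<bar>t\<bar> * (norm Y * norm (M t) * k)"
        using k(2) by (intro mult_left_mono) auto
      finally show ?thesis .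
    qed
    have "norm (M t) \<le> norm (mat 1 :: 'a qmat) + norm (M t - mat 1)"
      by (metis add.commute diff_add_cancel norm_triangle_ineq)
    also have "\<dots> \<le> norm (mat 1 :: 'a qmat) + (\<bar>t\<bar> * norm Y * k) * norm (M t)"
      using 1 by (simp add: mult_ac)
    also have "\<dots> \<le> norm (mat 1 :: 'a qmat) + 1/2 * norm (M t)"
      by (intro add_left_mono mult_right_mono small t) simp
    finally have 2: "norm (M t) \<le> 2 * norm (mat 1 :: 'a qmat)" by simp
    have "\<bar>t\<bar> * (norm Y * norm (M t) * k) \<le> \<bar>t\<bar> * (norm Y * (2 * norm (mat 1 :: 'a qmat)) * k)"
      using 2 k(1) by (intro mult_left_mono mult_right_mono) auto
    with 1 show ?thesis by (simp add: mult_ac)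
  qed
  have ev: "\<forall>\<^sub>F t in at 0. \<bar>t :: real\<bar> < d"
    using d by (auto simp: eventually_at dist_real_def intro!: exI[of _ d])
  have "((\<lambda>t. M t - mat 1) \<longlongrightarrow> 0) (at 0)"
  proof (rule Lim_null_comparison)
    show "\<forall>\<^sub>F t in at 0. norm (M t - mat 1) \<le> \<bar>t\<bar> * (norm Y * k * (2 * norm (mat 1 :: 'a qmat)))"
      using ev by eventually_elim (rule Mbound)
    have "((\<lambda>t::real. \<bar>t\<bar> * (norm Y * k * (2 * norm (mat 1 :: 'a qmat)))) \<longlongrightarrow>
        \<bar>0\<bar> * (norm Y * k * (2 * norm (mat 1 :: 'a qmat)))) (at 0)"
      by (intro tendsto_intros)
    then show "((\<lambda>t::real. \<bar>t\<bar> * (norm Y * k * (2 * norm (mat 1 :: 'a qmat)))) \<longlongrightarrow> 0) (at 0)"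
      by simp
  qed
  then have Mlim: "(M \<longlongrightarrow> mat 1) (at 0)" by (simp add: LIM_zero_iff)
  show ?thesis by (rule that[OF d M Mlim])
qed

text \<open>
  Every infinitesimally unitary \<open>X\<close> is the velocity of the curve
  \<open>t \<mapsto> (1 + t X / 2) (1 - t X / 2)\<^sup>-\<^sup>1\<close>, which is defined for small \<open>t\<close>.
\<close>

lemma unitary_alg_subset_tangent: "unitary_alg J C \<subseteq> tangent_at (unitary J C) (mat 1)"
proof
  fix X :: "'a qmat" assume X: "X \<in> unitary_alg J C"
  define Y where "Y = (1/2) *\<^sub>R X"
  have XY: "X = 2 *\<^sub>R Y" by (simp add: Y_def)
  obtain d M where d: "d > 0" and M: "\<And>t. \<bar>t\<bar> < d \<Longrightarrow> (mat 1 - t *\<^sub>R Y) ** M t = mat 1"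
    and Mlim: "(M \<longlongrightarrow> mat 1) (at 0)"
    by (rule inverse_near_identity[where Y = Y]) (rule that; blast)
  have Meq: "M t = mat 1 + t *\<^sub>R (Y ** M t)" if "\<bar>t\<bar> < d" for t
    using M[OF that] by (simp add: mmul_linear algebra_simps)
  have ev: "\<forall>\<^sub>F t in at 0. \<bar>t :: real\<bar> < d"
    using d by (auto simp: eventually_at dist_real_def intro!: exI[of _ d])
  define c where "c t = (if \<bar>t\<bar> < d then (mat 1 + t *\<^sub>R Y) ** M t else mat 1)" for t
  have ceq: "c t = mat 1 + t *\<^sub>R (X ** M t)" if t: "\<bar>t\<bar> < d" for t
  proof -
    have "c t = M t + t *\<^sub>R (Y ** M t)" using t by (simp add: c_def mmul_linear)
    also have "\<dots> = (mat 1 + t *\<^sub>R (Y ** M t)) + t *\<^sub>R (Y ** M t)"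
      by (rule arg_cong[OF Meq[OF t], of "\<lambda>Z. Z + t *\<^sub>R (Y ** M t)"])
    also have "\<dots> = mat 1 + t *\<^sub>R (X ** M t)"
      by (simp only: XY mmul_linear scaleR_2 scaleR_add_right add.assoc)
    finally show ?thesis .
  qed
  have c0: "c 0 = mat 1" using ceq[of 0] d by simp
  moreover have "c t \<in> unitary J C" for t
  proof (cases "\<bar>t\<bar> < d")
    case True
    have "t *\<^sub>R Y \<in> unitary_alg J C"
      using X by (auto simp: Y_def intro!: subspace_scale[OF subspace_unitary_alg])
    from cayley_unitary[OF this M[OF True]] True show ?thesis by (simp add: c_def)
  qed (simp add: c_def unitary_one)
  moreover have "(c has_vector_derivative X) (at 0)"
  proof -
    have "((\<lambda>t. norm (X ** (M t - mat 1))) \<longlongrightarrow> 0) (at 0)"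
      using bounded_linear.tendsto_zero[OF bounded_linear_mmul_left LIM_zero[OF Mlim]]
      by (rule tendsto_norm_zero)
    moreover have "\<forall>\<^sub>F t in at 0. norm (X ** (M t - mat 1)) = norm (c (0 + t) - c 0 - t *\<^sub>R X) / norm t"
      using ev eventually_neq_at_within[of 0 0 UNIV]
    proof eventually_elim
      case (elim t)
      have "c (0 + t) - c 0 - t *\<^sub>R X = t *\<^sub>R (X ** (M t - mat 1))"
        using elim by (simp add: ceq c0 mmul_linear algebra_simps)
      with elim show ?case by simp
    qed
    ultimately have "((\<lambda>t. norm (c (0 + t) - c 0 - t *\<^sub>R X) / norm t) \<longlongrightarrow> 0) (at 0)"
      by (rule Lim_transform_eventually)
    then show ?thesis
      by (simp add: has_vector_derivative_def has_derivative_at bounded_linear_scaleR_left)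
  qed
  ultimately show "X \<in> tangent_at (unitary J C) (mat 1)"
    unfolding tangent_at_def by blast
qed

lemma lie_unitary: "lie (unitary J C) = unitary_alg J C"
  unfolding lie_def using tangent_unitary_subset unitary_alg_subset_tangent by blast

section \<open>The groups in coordinates\<close>

lemma sum_UNIV_option:
  "(\<Sum>i\<in>UNIV. f i) = f None + (\<Sum>i\<in>UNIV. f (Some i))" for f :: "'n::finite option \<Rightarrow> 'b::comm_monoid_add"
  by (simp add: UNIV_option_conv sum.reindex)

lemma sum_delta_quat [simp]:
  fixes f :: "'m::finite \<Rightarrow> quat"
  shows "(\<Sum>k\<in>UNIV. (if k = i then a else 0) * f k) = a * f i"
    "(\<Sum>k\<in>UNIV. (if i = k then a else 0) * f k) = a * f i"
    "(\<Sum>k\<in>UNIV. f k * (if k = i then a else 0)) = f i * a"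
    "(\<Sum>k\<in>UNIV. f k * (if i = k then a else 0)) = f i * a"
  by (simp_all add: if_distrib[of "\<lambda>x. x * _"] if_distrib[of "\<lambda>x. _ * x"] cong: if_cong)

definition diagm :: "('m \<Rightarrow> quat) \<Rightarrow> 'm::finite qmat" where
  "diagm d = (\<chi> i j. if i = j then d i else 0)"

lemma diagm_nth [simp]: "diagm d $ i $ j = (if i = j then d i else 0)"
  by (simp add: diagm_def)

lemma diagm_mul_nth [simp]: "(diagm d ** M) $ i $ j = d i * M $ i $ j"
  and mul_diagm_nth [simp]: "(M ** diagm d) $ i $ j = M $ i $ j * d j"
  by (simp_all add: mmul_nth cong: if_cong)
    (simp_all add: if_distrib[of "\<lambda>x. x * _"] if_distrib[of "\<lambda>x. _ * x"] cong: if_cong)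

lemma diagm_mvmul_nth [simp]: "(diagm d *v x) $ i = d i * x $ i"
  by (simp add: mvmul_nth if_distrib[of "\<lambda>x. x * _"] cong: if_cong)

text \<open>
  The diagonal of the Gram matrix \<open>J\<close> of the Hermitian form of signature \<open>(1, n)\<close>.
\<close>

definition sgn0 :: "'n option \<Rightarrow> quat" where
  "sgn0 i = (case i of None \<Rightarrow> -1 | Some _ \<Rightarrow> 1)"

lemma sgn0_simps [simp]: "sgn0 None = -1" "sgn0 (Some i) = 1"
  by (simp_all add: sgn0_def)

abbreviation JJ :: "'n::finite qmat1" where
  "JJ \<equiv> diagm sgn0"

lemma involution_JJ [simp]: "involution (JJ :: 'n::finite qmat1)"
proof -
  have "sgn0 i * sgn0 i = 1" for i :: "'n option" by (cases i) simp_all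
  then show ?thesis by (simp add: involution_def vec_eq_iff mat_def)
qed

lemma hform_mvmul: "hform (A *v x) y = hform x (adjoint_mat A *v y)"
proof -
  have "hform (A *v x) y = (\<Sum>i\<in>UNIV. \<Sum>k\<in>UNIV. qcnj (x $ k) * (qcnj (A $ i $ k) * y $ i))"
    by (simp add: hform_def mvmul_nth qcnj_sum qcnj_mult sum_distrib_right mult.assoc)
  also have "\<dots> = (\<Sum>k\<in>UNIV. \<Sum>i\<in>UNIV. qcnj (x $ k) * (qcnj (A $ i $ k) * y $ i))"
    by (rule sum.swap)
  also have "\<dots> = hform x (adjoint_mat A *v y)"
    by (simp add: hform_def mvmul_nth sum_distrib_left)
  finally show ?thesis .
qed

lemma hform_axis: "hform (axis i 1) y = y $ i"
  by (simp add: hform_def axis_def if_distrib[of qcnj] cong: if_cong)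

lemma hform_eqI: "(\<And>x. hform x y = hform x z) \<Longrightarrow> y = z"
  by (metis hform_axis vec_eq_iff)

lemma isometry_iff_unitary:
  fixes A J :: "'m::finite qmat"
  shows "(\<forall>x y. hform (A *v x) (J *v (A *v y)) = hform x (J *v y)) \<longleftrightarrow> A \<in> unitary J {}"
proof -
  have "(\<forall>x y. hform (A *v x) (J *v (A *v y)) = hform x (J *v y))
      \<longleftrightarrow> (\<forall>x y. hform x ((adjoint_mat A ** J ** A) *v y) = hform x (J *v y))"
    by (simp add: hform_mvmul matrix_vector_mul_assoc matrix_mul_assoc)
  also have "\<dots> \<longleftrightarrow> adjoint_mat A ** J ** A = J"
    using hform_eqI matrix_eqI by metis
  finally show ?thesis by (simp add: unitary_def)
qed

lemma hform1_eq: "hform1 x y = hform x (JJ *v y)"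
  by (simp add: hform1_def hform_def sum_UNIV_option)

lemma Sp1n_eq: "Sp1n = unitary JJ {}"
  unfolding Sp1n_def hform1_eq by (simp add: isometry_iff_unitary)

lemma Spn_eq: "Spn = unitary (mat 1) {}"
  unfolding Spn_def by (auto simp flip: isometry_iff_unitary)

lemma unitary_JJ_iff:
  "A \<in> unitary JJ C \<longleftrightarrow> (\<forall>i j. - (qcnj (A $ None $ i) * A $ None $ j)
      + (\<Sum>k\<in>UNIV. qcnj (A $ Some k $ i) * A $ Some k $ j) = (if i = j then sgn0 i else 0))
    \<and> (\<forall>M\<in>C. A ** M = M ** A)"
proof -
  have "(adjoint_mat A ** JJ ** A) $ i $ j = - (qcnj (A $ None $ i) * A $ None $ j)
      + (\<Sum>k\<in>UNIV. qcnj (A $ Some k $ i) * A $ Some k $ j)" for i j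
    unfolding mmul_nth[of "adjoint_mat A ** JJ"] mul_diagm_nth by (simp add: sum_UNIV_option)
  then show ?thesis by (simp add: unitary_def vec_eq_iff)
qed

lemma unitary_one_iff:
  "A \<in> unitary (mat 1) C \<longleftrightarrow> (\<forall>i j. (\<Sum>k\<in>UNIV. qcnj (A $ k $ i) * A $ k $ j) = (if i = j then 1 else 0))
    \<and> (\<forall>M\<in>C. A ** M = M ** A)"
  by (simp add: unitary_def vec_eq_iff mmul_nth mat_def)

lemma block2_nth [simp]:
  "block2 a R C D $ None $ None = a" "block2 a R C D $ None $ Some j = R $ j"
  "block2 a R C D $ Some i $ None = C $ i" "block2 a R C D $ Some i $ Some j = D $ i $ j"
  by (simp_all add: block2_def)

lemma mat_option_eq_iff:
  fixes A B :: "'a ^ ('n::finite option) ^ ('n option)"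
  shows "A = B \<longleftrightarrow> A $ None $ None = B $ None $ None \<and> (\<forall>j. A $ None $ Some j = B $ None $ Some j)
    \<and> (\<forall>i. A $ Some i $ None = B $ Some i $ None) \<and> (\<forall>i j. A $ Some i $ Some j = B $ Some i $ Some j)"
  by (simp add: vec_eq_iff split_option_all) blast

lemma hmat_nth [simp]:
  "hmat l a A $ None $ None = a" "hmat l a A $ None $ Some j = 0" "hmat l a A $ Some i $ None = 0"
  "hmat l a A $ Some i $ Some j = (if i = l then (if j = l then a else 0) else if j = l then 0 else A $ i $ j)"
  by (simp_all add: hmat_def block3_def)

lemma nmat_nth [simp]:
  "nmat l y Y $ None $ None = - y" "nmat l y Y $ None $ Some j = 0" "nmat l y Y $ Some i $ None = 0"
  "nmat l y Y $ Some i $ Some j = (if i = l then (if j = l then y else - qcnj (Y $ j))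
      else if j = l then Y $ i else 0)"
  by (simp_all add: nmat_def block3_def vcnj_def)

lemma pmat_nth [simp]:
  "pmat l x X $ None $ None = 0" "pmat l x X $ None $ Some j = (if j = l then qcnj x else qcnj (X $ j))"
  "pmat l x X $ Some i $ None = (if i = l then x else X $ i)" "pmat l x X $ Some i $ Some j = 0"
  by (simp_all add: pmat_def block3_def vcnj_def)

lemma vv_eq_pmat: "vv l = pmat l 1 0"
  by (simp add: mat_option_eq_iff vv_def block3_def)

lemma commutes_JJ_iff:
  "M ** JJ = JJ ** M \<longleftrightarrow> (\<forall>i. M $ None $ Some i = 0 \<and> M $ Some i $ None = 0)"
  by (auto simp: mat_option_eq_iff quat_eq_iff)

lemma commutes_vv_iff:
  fixes M :: "'n::finite qmat1"
  shows "M ** vv l = vv l ** M \<longleftrightarrow> M $ None $ None = M $ Some l $ Some l \<and>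
    M $ None $ Some l = M $ Some l $ None \<and>
    (\<forall>i. i \<noteq> l \<longrightarrow> M $ None $ Some i = 0 \<and> M $ Some l $ Some i = 0 \<and> M $ Some i $ None = 0
        \<and> M $ Some i $ Some l = 0)"
proof -
  have "(M ** vv l) $ i $ None = M $ i $ Some l"
    "(M ** vv l) $ i $ Some j = (if j = l then M $ i $ None else 0)" for i j
    unfolding mmul_nth sum_UNIV_option vv_eq_pmat
    by (auto cong: if_cong)
  moreover have "(vv l ** M) $ None $ j = M $ Some l $ j"
    "(vv l ** M) $ Some i $ j = (if i = l then M $ None $ j else 0)" for i j
    unfolding mmul_nth sum_UNIV_option vv_eq_pmat
    by (auto cong: if_cong)
  ultimately show ?thesis unfolding mat_option_eq_iff by (auto; metis)
qed

lemma K_eq: "K = (unitary JJ {JJ} :: 'n::finite qmat1 set)"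
proof (intro equalityI subsetI)
  fix A :: "'n qmat1" assume "A \<in> K"
  then show "A \<in> unitary JJ {JJ}"
    by (auto simp: K_def Spn_eq unitary_one_iff unitary_JJ_iff split_option_all commutes_JJ_iff)
next
  fix A :: "'n qmat1" assume A: "A \<in> unitary JJ {JJ}"
  define B where "B = (\<chi> i j. A $ Some i $ Some j)"
  have 0: "A $ None $ Some i = 0" "A $ Some i $ None = 0" for i
    using A by (auto simp: unitary_JJ_iff commutes_JJ_iff)
  have eq: "A = block2 (A $ None $ None) 0 0 B"
    by (simp add: mat_option_eq_iff B_def 0)
  have "qcnj (A $ None $ None) * A $ None $ None = 1"
    using A unfolding unitary_JJ_iff by (auto simp: 0 split_option_all)
  then have "norm (A $ None $ None) = 1"
    by (simp add: qcnj_mult_self quat_eq_iff power2_eq_1_iff) (metis norm_ge_zero not_one_le_zero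
        le_minus_one_simps(1) neg_0_le_iff_le)
  moreover have "B \<in> Spn"
    using A unfolding unitary_JJ_iff Spn_eq unitary_one_iff by (auto simp: 0 B_def split_option_all)
  ultimately show "A \<in> K" unfolding K_def using eq by blast
qed

lemma Ad_eq_iff:
  assumes "involution J" "A \<in> unitary J C"
  shows "Ad A X = Y \<longleftrightarrow> A ** X = Y ** A"
  using unitary_matrix_inv[OF assms] unfolding Ad_def
  by (metis matrix_mul_assoc matrix_mul_rid)

lemma stabilizer_eq: "{A \<in> K. Ad A (vv l) = vv l} = unitary JJ {JJ, vv l}"
proof -
  have "A \<in> unitary JJ {JJ} \<Longrightarrow> Ad A (vv l) = vv l \<longleftrightarrow> A ** vv l = vv l ** A" for A
    by (rule Ad_eq_iff[OF involution_JJ])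
  then show ?thesis unfolding K_eq by (auto simp: unitary_def)
qed

lemma mvmul_axis [simp]: "(A *v axis l 1) $ i = A $ i $ l" for A :: "'m::finite qmat"
  by (simp add: mvmul_nth axis_def)

lemma SpW_nth:
  assumes "A \<in> SpW l"
  shows "A $ i $ l = (if i = l then 1 else 0)" "A $ l $ i = (if i = l then 1 else 0)"
proof -
  have 1: "A *v axis l 1 = axis l 1" and A: "adjoint_mat A ** A = mat 1"
    using assms by (auto simp: SpW_def Spn_eq unitary_def)
  from 1 have "(A *v axis l 1) $ i = axis l 1 $ i" by simp
  then show "A $ i $ l = (if i = l then 1 else 0)" unfolding mvmul_axis by (simp add: axis_def)
  have "adjoint_mat A *v (A *v axis l 1) = axis l 1"
    by (simp add: matrix_vector_mul_assoc A)
  then have "(adjoint_mat A *v axis l 1) $ i = axis l 1 $ i" by (simp add: 1)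
  then have "qcnj (A $ l $ i) = (if i = l then 1 else 0)"
    unfolding mvmul_axis by (simp add: axis_def)
  then show "A $ l $ i = (if i = l then 1 else 0)"
    by (metis qcnj_simps(1,2,3))
qed

lemma spW_nth:
  assumes "A \<in> spW l"
  shows "A $ i $ l = 0" "A $ l $ i = 0" "qcnj (A $ i $ j) = - A $ j $ i"
proof -
  have "(A *v axis l 1) $ i = 0" for i using assms by (auto simp: spW_def)
  then show 1: "A $ i $ l = 0" for i by simp
  have "adjoint_mat A $ j $ i = (- A) $ j $ i" for i j
    using assms by (simp add: spW_def)
  then show 2: "qcnj (A $ i $ j) = - A $ j $ i" for i j by simp
  show "A $ l $ i = 0" using 2[of l i] 1[of i] by (metis add.inverse_neutral qcnj_simps(1,3))
qed

text \<open>
  The lower right block of \<open>hmat l a A\<close> is obtained from \<open>A\<close>, which has the entry \<open>1\<close> at \<open>(l, l)\<close> if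
  it is in \<open>SpW l\<close>, by putting \<open>a\<close> there. The following lemma allows to pass from one to the other.
\<close>

lemma change_corner_Spn:
  fixes A B :: "'n::finite qmat"
  assumes B: "B \<in> Spn" and a: "norm a = 1"
    and l: "\<And>k. A $ k $ l = (if k = l then a else 0)" "\<And>k. A $ l $ k = (if k = l then a else 0)"
    and eq: "\<And>i j. i \<noteq> l \<Longrightarrow> j \<noteq> l \<Longrightarrow> A $ i $ j = B $ i $ j"
    and B0: "\<And>k. k \<noteq> l \<Longrightarrow> B $ l $ k = 0"
  shows "A \<in> Spn"
proof -
  have "(\<Sum>k\<in>UNIV. qcnj (A $ k $ i) * A $ k $ j) = (if i = j then 1 else 0)" for i j
  proof (cases "i = l \<or> j = l")
    case True
    then show ?thesis using l a by (auto simp: if_distrib[of qcnj] cong: if_cong)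
  next
    case False
    then have "qcnj (A $ k $ i) * A $ k $ j = qcnj (B $ k $ i) * B $ k $ j" for k
      by (cases "k = l") (simp_all add: l eq B0)
    then show ?thesis using B by (simp add: Spn_eq unitary_one_iff)
  qed
  then show ?thesis by (simp add: Spn_eq unitary_one_iff)
qed

lemma stabilizer_coordinates:
  fixes l :: "'n::finite"
  shows "unitary JJ {JJ, vv l} = {hmat l a A | a A. norm a = 1 \<and> A \<in> SpW l}"
proof (intro equalityI subsetI)
  fix M :: "'n qmat1" assume M: "M \<in> unitary JJ {JJ, vv l}"
  then have "M \<in> K" by (simp add: K_eq unitary_def)
  then obtain a B where M': "M = block2 a 0 0 B" and a: "norm a = 1" and B: "B \<in> Spn"
    by (auto simp: K_def)
  have "M ** vv l = vv l ** M" using M by (simp add: unitary_def)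
  then have Bl: "B $ l $ l = a" "\<And>i. i \<noteq> l \<Longrightarrow> B $ i $ l = 0" "\<And>i. i \<noteq> l \<Longrightarrow> B $ l $ i = 0"
    unfolding commutes_vv_iff M' by auto
  define A where "A = (\<chi> i j. if i = l \<and> j = l then 1 else B $ i $ j)"
  have "M = hmat l a A"
    using Bl by (auto simp: M' mat_option_eq_iff A_def)
  moreover have "A \<in> Spn"
    by (rule change_corner_Spn[OF B norm_one_quat, of _ l]) (simp_all add: A_def Bl)
  moreover have "A *v axis l 1 = axis l 1"
    unfolding vec_eq_iff mvmul_axis using Bl by (simp add: A_def axis_def)
  ultimately show "M \<in> {hmat l a A | a A. norm a = 1 \<and> A \<in> SpW l}" using a unfolding SpW_def by blast
next
  fix M assume "M \<in> {hmat l a A | a A. norm a = 1 \<and> A \<in> SpW l}"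
  then obtain a A where M: "M = hmat l a A" and a: "norm a = 1" and A: "A \<in> SpW l" by blast
  note Al = SpW_nth[OF A]
  define B where "B = (\<chi> i j. if i = l \<and> j = l then a else A $ i $ j)"
  have "M = block2 a 0 0 B"
    using Al by (simp add: M mat_option_eq_iff B_def)
  moreover have "A \<in> Spn" using A by (simp add: SpW_def)
  then have "B \<in> Spn"
    by (rule change_corner_Spn[OF _ a, of _ _ l]) (simp_all add: B_def Al)
  ultimately have "M \<in> unitary JJ {JJ}" using a unfolding K_eq[symmetric] K_def by blast
  moreover have "M ** vv l = vv l ** M" by (simp add: commutes_vv_iff M)
  ultimately show "M \<in> unitary JJ {JJ, vv l}" by (simp add: unitary_def)
qed

lemma unitary_alg_JJ_iff:
  "X \<in> unitary_alg JJ C \<longleftrightarrow> (\<forall>i j. qcnj (X $ j $ i) * sgn0 j + sgn0 i * X $ i $ j = 0)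
     \<and> (\<forall>M\<in>C. X ** M = M ** X)"
  by (simp add: unitary_alg_def vec_eq_iff)

lemma lie_Sp1n_iff:
  "X \<in> lie Sp1n \<longleftrightarrow> qcnj (X $ None $ None) = - X $ None $ None \<and>
     (\<forall>i. X $ None $ Some i = qcnj (X $ Some i $ None)) \<and>
     (\<forall>i j. qcnj (X $ Some j $ Some i) = - X $ Some i $ Some j)"
  unfolding Sp1n_eq lie_unitary unitary_alg_JJ_iff
  by (auto simp: split_option_all eq_neg_iff_add_eq_0) (simp_all add: quat_eq_iff)

lemma hh_eq: "unitary_alg JJ {JJ, vv l} = hh l"
proof (intro equalityI subsetI)
  fix X assume X: "X \<in> unitary_alg JJ {JJ, vv l}"
  then have "X \<in> lie Sp1n" by (simp add: Sp1n_eq lie_unitary unitary_alg_def)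
  then have L: "qcnj (X $ None $ None) = - X $ None $ None"
     "\<And>i j. qcnj (X $ Some j $ Some i) = - X $ Some i $ Some j"
    by (simp_all add: lie_Sp1n_iff)
  have C: "X ** JJ = JJ ** X" "X ** vv l = vv l ** X" using X by (auto simp: unitary_alg_def)
  define A where "A = (\<chi> i j. if i = l \<or> j = l then 0 else X $ Some i $ Some j)"
  have "X = hmat l (X $ None $ None) A"
    using C unfolding commutes_JJ_iff commutes_vv_iff by (auto simp: mat_option_eq_iff A_def)
  moreover have "A \<in> spW l"
    using L by (auto simp: spW_def A_def vec_eq_iff)
  moreover have "X $ None $ None \<in> ImH" using L by (simp add: ImH_iff_qcnj)
  ultimately show "X \<in> hh l" unfolding hh_def hpairs_def by force
next
  fix X assume "X \<in> hh l"
  then obtain \<alpha> A where X: "X = hmat l \<alpha> A" and \<alpha>: "qcnj \<alpha> = - \<alpha>" and A: "A \<in> spW l"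
    by (auto simp: hh_def hpairs_def ImH_iff_qcnj)
  have "X \<in> lie Sp1n"
    using spW_nth[OF A] by (auto simp: lie_Sp1n_iff X \<alpha>)
  moreover have "X ** JJ = JJ ** X" "X ** vv l = vv l ** X"
    unfolding commutes_JJ_iff commutes_vv_iff by (auto simp: X)
  ultimately show "X \<in> unitary_alg JJ {JJ, vv l}"
    by (simp add: Sp1n_eq lie_unitary unitary_alg_def)
qed

section \<open>Reflections and connectedness of the symplectic groups\<close>

definition rmul :: "quat ^ 'm \<Rightarrow> quat \<Rightarrow> quat ^ 'm::finite" where
  "rmul x c = (\<chi> i. x $ i * c)"

lemma rmul_nth [simp]: "rmul x c $ i = x $ i * c"
  by (simp add: rmul_def)

lemma hform_add_left: "hform (x + y) z = hform x z + hform y z"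
  and hform_add_right: "hform x (y + z) = hform x y + hform x z"
  and hform_diff_left: "hform (x - y) z = hform x z - hform y z"
  and hform_diff_right: "hform x (y - z) = hform x y - hform x z"
  by (simp_all add: hform_def qcnj_add qcnj_diff algebra_simps sum.distrib sum_subtractf)

lemma hform_rmul_left: "hform (rmul x c) y = qcnj c * hform x y"
  and hform_rmul_right: "hform x (rmul y c) = hform x y * c"
  by (simp_all add: hform_def qcnj_mult sum_distrib_left sum_distrib_right mult.assoc)

lemma hform_commute: "hform y x = qcnj (hform x y)"
  by (simp add: hform_def qcnj_sum qcnj_mult)

lemma hform_self: "hform x x = (norm x)\<^sup>2 *\<^sub>R 1"
proof -
  have "(norm x)\<^sup>2 = (\<Sum>i\<in>UNIV. (norm (x $ i))\<^sup>2)"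
    by (simp add: power2_norm_eq_inner inner_vec_def)
  then show ?thesis by (simp add: hform_def qcnj_mult_self scaleR_sum_left)
qed

lemma Spn_iff_hform: "A \<in> Spn \<longleftrightarrow> (\<forall>x y. hform (A *v x) (A *v y) = hform x y)"
  by (simp add: Spn_def)

text \<open>
  For a unit quaternion \<open>q\<close>, the quaternionic reflection \<open>x \<mapsto> x + w |w|\<^sup>-\<^sup>2 (q - 1) \<langle>w, x\<rangle>\<close> takes \<open>w\<close> to
  \<open>w q\<close> and fixes the orthogonal complement of \<open>w\<close>. Letting \<open>q\<close> run through the sphere of unit
  quaternions connects it with the identity, which is the case \<open>q = 1\<close>.
\<close>

definition qrefl :: "quat ^ 'm \<Rightarrow> quat \<Rightarrow> 'm::finite qmat" where
  "qrefl w q = (\<chi> i j. (if i = j then 1 else 0) + w $ i * ((q - 1) /\<^sub>R (norm w)\<^sup>2) * qcnj (w $ j))"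

lemma qrefl_mvmul: "qrefl w q *v x = x + rmul w (((q - 1) /\<^sub>R (norm w)\<^sup>2) * hform w x)"
  by (simp add: vec_eq_iff mvmul_nth qrefl_def hform_def distrib_right sum.distrib sum_distrib_left
      mult.assoc
      scaleR_sum_right)

lemma qrefl_one: "qrefl w 1 = mat 1"
  by (simp add: vec_eq_iff qrefl_def mat_def)

lemma qrefl_Spn:
  assumes "norm q = 1" and "w \<noteq> 0" shows "qrefl w q \<in> Spn"
  unfolding Spn_iff_hform
proof (intro allI)
  fix x y
  define N where "N = (norm w)\<^sup>2"
  have N: "N \<noteq> 0" using assms by (simp add: N_def)
  define c where "c = (q - 1) /\<^sub>R N"
  have c: "c + qcnj c + N *\<^sub>R (qcnj c * c) = 0"
  proof -
    have "qcnj (q - 1) * (q - 1) = 1 - qcnj q - q + 1"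
      using assms by (simp add: qcnj_diff algebra_simps)
    then have "qcnj c * c = (inverse N * inverse N) *\<^sub>R (1 - qcnj q - q + 1)"
      by (simp add: c_def)
    then have 1: "N *\<^sub>R (qcnj c * c) = inverse N *\<^sub>R (1 - qcnj q - q + 1)"
      using N by simp
    have 2: "c + qcnj c = inverse N *\<^sub>R (q - 1 + (qcnj q - 1))"
      by (simp add: c_def qcnj_diff scaleR_add_right)
    show ?thesis unfolding 1 2 scaleR_add_right[symmetric] by simp
  qed
  have "hform (qrefl w q *v x) (qrefl w q *v y) = hform x y +
      (qcnj (hform w x) * c * hform w y + qcnj (hform w x) * qcnj c * hform w y
        + qcnj (hform w x) * (qcnj c * (N *\<^sub>R 1) * c) * hform w y)"
    by (simp add: qrefl_mvmul hform_add_left hform_add_right hform_rmul_left hform_rmul_right hform_self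
        qcnj_mult N_def[symmetric] c_def[symmetric] hform_commute[of x w] mult.assoc distrib_left
            distrib_right add_ac)
  also have "\<dots> = hform x y + qcnj (hform w x) * (c + qcnj c + N *\<^sub>R (qcnj c * c)) * hform w y"
    by (simp add: distrib_left distrib_right)
  finally show "hform (qrefl w q *v x) (qrefl w q *v y) = hform x y" by (simp add: c)
qed

text \<open>
  With \<open>p = \<langle>y - x, x\<rangle>\<close> one has \<open>|y - x|\<^sup>2 = - (p + p\<^sup>*)\<close> as \<open>x\<close> and \<open>y\<close> have the same length; so the
  reflection in the direction of \<open>y - x\<close> takes \<open>x\<close> to \<open>y\<close> if \<open>(q - 1) p = - (p + p\<^sup>*)\<close>, that is,
  if \<open>q = - p\<^sup>* p\<^sup>-\<^sup>1\<close>.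
\<close>

lemma qrefl_transitive:
  assumes "norm x = norm y" "x \<noteq> y"
  obtains q where "norm q = 1" "qrefl (y - x) q *v x = y"
proof -
  define w where "w = y - x"
  define p where "p = hform w x"
  define N where "N = (norm w)\<^sup>2"
  have w: "w \<noteq> 0" using assms by (simp add: w_def)
  have "N *\<^sub>R (1::quat) = hform w w" by (simp add: N_def hform_self)
  also have "\<dots> = - (p + qcnj p)"
    using hform_self[of x] hform_self[of y] assms
    by (simp add: p_def w_def hform_diff_left hform_diff_right hform_commute[of y x] qcnj_diff)
  finally have N: "N *\<^sub>R (1::quat) = - (p + qcnj p)" .
  have N0: "N \<noteq> 0" using w by (simp add: N_def)
  have p0: "p \<noteq> 0" using N N0 by (auto simp: quat_eq_iff)
  define q where "q = - ((qcnj p * qcnj p) /\<^sub>R (norm p)\<^sup>2)"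
  have "norm q = 1"
    using p0 by (simp add: q_def norm_mult_quat power2_eq_square field_simps)
  moreover have "q * p = - qcnj p"
    using p0 by (simp add: q_def mult.assoc qcnj_mult_self)
  then have qp: "(q - 1) * p = N *\<^sub>R 1" by (simp add: N algebra_simps)
  have "qrefl w q *v x = x + w"
    using N0 by (simp add: qrefl_mvmul p_def[symmetric] N_def[symmetric] qp vec_eq_iff)
  then have "qrefl w q *v x = y" by (simp add: w_def)
  ultimately show ?thesis using that by (simp add: w_def)
qed

lemma Spn_transitive:
  assumes "norm x = norm y"
  obtains B where "B \<in> Spn" "B *v x = y"
proof (cases "x = y")
  case True
  then show ?thesis using that[of "mat 1"] by (simp add: Spn_def)
next
  case False
  then show ?thesis using qrefl_transitive[OF assms False] qrefl_Spn that
    by (metis right_minus_eq)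
qed

lemma connected_unit_quats: "connected (sphere (0::quat) 1)"
proof -
  have "card {Quat 1 0 0 0, Quat 0 1 0 0, Quat 0 0 1 0, Quat 0 0 0 1} = 4"
    by simp
  then have "DIM(quat) = 4" by (simp add: Basis_quat_def)
  then show ?thesis by (intro connected_sphere) simp
qed

lemma connected_qrefls:
  fixes A :: "'m::finite qmat"
  shows "connected ((\<lambda>q. qrefl w q ** A) ` {q. norm q = 1})"
proof -
  have "sphere (0::quat) 1 = {q. norm q = 1}" by (auto simp: sphere_def)
  moreover have cont: "continuous_on UNIV (qrefl w)"
  proof -
    have "linear (\<lambda>q. qrefl w q - qrefl w 0)"
      by (rule linearI) (simp_all add: vec_eq_iff qrefl_def algebra_simps)
    then have "continuous_on UNIV (\<lambda>q. (qrefl w q - qrefl w 0) + qrefl w 0)"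
      by (intro continuous_intros linear_continuous_on) (simp add: linear_conv_bounded_linear)
    then show ?thesis by simp
  qed
  have "continuous_on {q. norm q = 1} (\<lambda>q. qrefl w q ** A)"
    by (intro continuous_on_mmul continuous_on_const continuous_on_subset[OF cont] subset_UNIV)
  ultimately show ?thesis using connected_continuous_image connected_unit_quats by metis
qed

lemma Spn_mult: "A \<in> Spn \<Longrightarrow> B \<in> Spn \<Longrightarrow> A ** B \<in> Spn"
  by (simp add: Spn_eq unitary_mult)

text \<open>
  A matrix in \<open>SpW l\<close> is moved to the identity through \<open>SpW l\<close> by successive reflections, each of
  which takes the image of one more standard basis vector \<open>e\<^sub>j\<close> back to \<open>e\<^sub>j\<close>. The finite set \<open>T\<close> contains
  the indices of the basis vectors which are not yet fixed.
\<close>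

lemma SpW_connected_component:
  fixes A :: "'n::finite qmat"
  assumes "finite T" "A \<in> Spn" "\<And>i. i \<notin> T \<Longrightarrow> A *v axis i 1 = axis i 1" "l \<notin> T"
  shows "connected_component (SpW l) (mat 1) A"
  using assms
proof (induction T arbitrary: A rule: finite_induct)
  case empty
  have "A = mat 1"
  proof -
    have "A $ i $ j = mat 1 $ i $ j" for i j
    proof -
      have "(A *v axis j 1) $ i = axis j 1 $ i" using empty by simp
      then show ?thesis unfolding mvmul_axis by (simp add: axis_def mat_def)
    qed
    then show ?thesis by (simp add: vec_eq_iff)
  qed
  then show ?case by (simp add: SpW_def Spn_def connected_component_refl)
next
  case (insert j T)
  let ?x = "A *v axis j 1" and ?y = "axis j 1 :: quat ^ 'n"
  have fixed: "A *v axis i 1 = axis i 1" if "i \<noteq> j" "i \<notin> T" for i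
    using insert.prems that by blast
  have A_SpW: "A \<in> SpW l"
    using insert.prems by (simp add: SpW_def)
  show ?case
  proof (cases "?x = ?y")
    case True
    then show ?thesis using insert fixed by (metis insertI1 insertI2)
  next
    case False
    have "(norm ?x)\<^sup>2 *\<^sub>R (1::quat) = (norm ?y)\<^sup>2 *\<^sub>R 1"
      using insert.prems(1) by (simp add: Spn_def flip: hform_self)
    then have "norm ?x = norm ?y" by (simp add: quat_eq_iff)
    then obtain q where q: "norm q = 1" "qrefl (?y - ?x) q *v ?x = ?y"
      using False qrefl_transitive by metis
    define w where "w = ?y - ?x"
    have w0: "w \<noteq> 0" using False by (simp add: w_def)
    have w: "hform w (axis i 1) = 0" if "i \<noteq> j" "i \<notin> T" for i
    proof -
      have "hform ?x (axis i 1) = hform (A *v axis j 1) (A *v axis i 1)"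
        using fixed[OF that] by simp
      also have "\<dots> = hform (axis j 1) (axis i 1)" using insert.prems(1) by (simp add: Spn_def)
      finally show ?thesis by (simp add: w_def hform_diff_left)
    qed
    have R_fix: "qrefl w r *v axis i 1 = axis i 1" if "i \<noteq> j" "i \<notin> T" for i r
      using w[OF that] by (simp add: qrefl_mvmul vec_eq_iff)
    have R_SpW: "qrefl w r ** A \<in> SpW l" if "norm r = 1" for r
      using that insert.prems A_SpW R_fix[of l]
      by (simp add: SpW_def Spn_mult qrefl_Spn w0 matrix_vector_mul_assoc[symmetric])
    have "connected_component (SpW l) (mat 1) (qrefl w q ** A)"
    proof (rule insert.IH)
      show "qrefl w q ** A \<in> Spn" using R_SpW[OF q(1)] by (simp add: SpW_def)
      show "(qrefl w q ** A) *v axis i 1 = axis i 1" if "i \<notin> T" for i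
        using that q(2) fixed[of i] R_fix[of i]
        by (cases "i = j") (simp_all add: w_def matrix_vector_mul_assoc[symmetric])
      show "l \<notin> T" using insert.prems by blast
    qed
    moreover have "connected_component (SpW l) (qrefl w q ** A) (qrefl w 1 ** A)"
      unfolding connected_component_def
      using connected_qrefls[of w A] R_SpW q(1) by (intro exI conjI) (auto simp: norm_one_quat)
    ultimately show ?thesis
      using connected_component_trans by (metis matrix_mul_lid qrefl_one)
  qed
qed

lemma connected_SpW: "connected (SpW l)"
proof -
  have "connected_component (SpW l) (mat 1) A" if "A \<in> SpW l" for A
    using that by (intro SpW_connected_component[of "- {l}"]) (auto simp: SpW_def)
  then have "connected_component_set (SpW l) (mat 1) = SpW l"
    using connected_component_subset by blast
  then show ?thesis using connected_connected_component by metis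
qed

text \<open>
  The stabilizer of \<open>v\<close> in \<open>K\<close> is connected, being a continuous image of \<open>S\<^sup>3 \<times> Sp\<^sub>n\<^sub>-\<^sub>1\<close>, so nothing is
  lost in the passage to the component of the identity.
\<close>

lemma Kv_eq: "Kv l = unitary JJ {JJ, vv l}"
proof -
  have lin: "linear (\<lambda>(a, A). hmat l a A)"
    by (rule linearI) (auto simp: mat_option_eq_iff split: prod.splits)
  have "connected ((\<lambda>(a, A). hmat l a A) ` (sphere 0 1 \<times> SpW l))"
    using lin connected_SpW connected_unit_quats
    by (intro connected_continuous_image linear_continuous_on connected_Times)
      (auto simp: linear_conv_bounded_linear)
  moreover have "(\<lambda>(a, A). hmat l a A) ` (sphere 0 1 \<times> SpW l) = unitary JJ {JJ, vv l}"
    unfolding stabilizer_coordinates by (force simp: image_iff)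
  ultimately have "connected (unitary JJ {JJ, vv l})" by simp
  then show ?thesis
    unfolding Kv_def stabilizer_eq using unitary_one by (rule connected_component_eq_self)
qed

section \<open>The reductive decomposition\<close>

text \<open>
  Coordinates on \<open>m\<close>, which make sense for all matrices. The first two diagonal entries of an element
  of \<open>h + m\<close> are \<open>\<alpha> - y\<close> and \<open>\<alpha> + y\<close>, where \<open>\<alpha>\<close> belongs to the component in \<open>h\<close>; half of their
  difference is \<open>y\<close>.
\<close>

definition ny :: "'n \<Rightarrow> 'n::finite qmat1 \<Rightarrow> quat" where
  "ny l M = (1/2) *\<^sub>R (M $ Some l $ Some l - M $ None $ None)"

definition nY :: "'n \<Rightarrow> 'n::finite qmat1 \<Rightarrow> quat ^ 'n" where
  "nY l M = (\<chi> i. if i = l then 0 else M $ Some i $ Some l)"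

definition px :: "'n \<Rightarrow> 'n::finite qmat1 \<Rightarrow> quat" where
  "px l M = M $ Some l $ None"

definition pX :: "'n \<Rightarrow> 'n::finite qmat1 \<Rightarrow> quat ^ 'n" where
  "pX l M = (\<chi> i. if i = l then 0 else M $ Some i $ None)"

definition mvec :: "'n \<Rightarrow> quat \<Rightarrow> quat ^ 'n \<Rightarrow> quat \<Rightarrow> quat ^ 'n \<Rightarrow> 'n::finite qmat1" where
  "mvec l y Y x X = nmat l y Y + pmat l x X"

definition mpart :: "'n \<Rightarrow> 'n::finite qmat1 \<Rightarrow> 'n qmat1" where
  "mpart l M = mvec l (ny l M) (nY l M) (px l M) (pX l M)"

lemma mm_eq: "mm l = {mvec l y Y x X | y Y x X. y \<in> ImH \<and> Y \<in> W l \<and> X \<in> W l}"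
  by (simp add: mm_def mvec_def)

lemma W_iff: "X \<in> W l \<longleftrightarrow> X $ l = 0"
  by (simp add: W_def)

lemma subspace_W: "subspace (W l)"
  by (simp add: subspace_def W_def)

lemma mvec_nth [simp]:
  "mvec l y Y x X $ None $ None = - y"
  "mvec l y Y x X $ None $ Some j = (if j = l then qcnj x else qcnj (X $ j))"
  "mvec l y Y x X $ Some i $ None = (if i = l then x else X $ i)"
  "mvec l y Y x X $ Some i $ Some j = (if i = l then (if j = l then y else - qcnj (Y $ j))
      else if j = l then Y $ i else 0)"
  by (simp_all add: mvec_def)

lemma mvec_coordinates [simp]:
  "ny l (mvec l y Y x X) = y" "px l (mvec l y Y x X) = x"
  "Y \<in> W l \<Longrightarrow> nY l (mvec l y Y x X) = Y" "X \<in> W l \<Longrightarrow> pX l (mvec l y Y x X) = X"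
  by (auto simp: ny_def px_def nY_def pX_def W_iff vec_eq_iff quat_eq_iff)

lemma mvec_linear:
  "mvec l y Y x X + mvec l y' Y' x' X' = mvec l (y + y') (Y + Y') (x + x') (X + X')"
  "c *\<^sub>R mvec l y Y x X = mvec l (c *\<^sub>R y) (c *\<^sub>R Y) (c *\<^sub>R x) (c *\<^sub>R X)"
  by (auto simp: mat_option_eq_iff qcnj_add)

lemma coordinates_linear:
  "ny l (M + N) = ny l M + ny l N" "ny l (c *\<^sub>R M) = c *\<^sub>R ny l M"
  "nY l (M + N) = nY l M + nY l N" "nY l (c *\<^sub>R M) = c *\<^sub>R nY l M"
  "px l (M + N) = px l M + px l N" "px l (c *\<^sub>R M) = c *\<^sub>R px l M"
  "pX l (M + N) = pX l M + pX l N" "pX l (c *\<^sub>R M) = c *\<^sub>R pX l M"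
  by (auto simp: ny_def px_def nY_def pX_def vec_eq_iff algebra_simps)

lemma coordinates_W [simp]: "nY l M \<in> W l" "pX l M \<in> W l"
  by (simp_all add: nY_def pX_def W_iff)

lemma mpart_linear: "mpart l (M + N) = mpart l M + mpart l N" "mpart l (c *\<^sub>R M) = c *\<^sub>R mpart l M"
  by (simp_all add: mpart_def coordinates_linear mvec_linear)

lemma ny_lie: "M \<in> lie Sp1n \<Longrightarrow> ny l M \<in> ImH"
  by (simp add: ImH_iff_qcnj lie_Sp1n_iff ny_def qcnj_diff algebra_simps)

lemma mpart_mm: "M \<in> lie Sp1n \<Longrightarrow> mpart l M \<in> mm l"
  unfolding mm_eq mpart_def using ny_lie coordinates_W by blast

lemma mpart_id: "M \<in> mm l \<Longrightarrow> mpart l M = M"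
  by (auto simp: mm_eq mpart_def)

lemma mm_subset_lie: "mm l \<subseteq> lie Sp1n"
  by (auto simp: mm_eq lie_Sp1n_iff ImH_iff_qcnj)

lemma hh_subset_lie: "hh l \<subseteq> lie Sp1n"
  unfolding hh_eq[symmetric] by (auto simp: Sp1n_eq lie_unitary unitary_alg_def)

lemma lie_Kv: "lie (Kv l) = hh l"
  by (simp add: Kv_eq lie_unitary hh_eq)

lemma mpart_hh: "M \<in> hh l \<Longrightarrow> mpart l M = 0"
proof -
  assume "M \<in> hh l"
  then have "ny l M = 0" "nY l M = 0" "px l M = 0" "pX l M = 0"
    by (auto simp: hh_def ny_def nY_def px_def pX_def vec_eq_iff)
  then show ?thesis by (simp add: mpart_def mat_option_eq_iff)
qed

lemma hpart_hh:
  assumes M: "M \<in> lie Sp1n"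
  shows "M - mpart l M \<in> hh l"
proof -
  have L: "qcnj (M $ None $ None) = - M $ None $ None"
     "\<And>i. M $ None $ Some i = qcnj (M $ Some i $ None)"
     "\<And>i j. qcnj (M $ Some j $ Some i) = - M $ Some i $ Some j"
    using M by (simp_all add: lie_Sp1n_iff)
  define \<alpha> where "\<alpha> = (1/2) *\<^sub>R (M $ None $ None + M $ Some l $ Some l)"
  define A where "A = (\<chi> i j. if i = l \<or> j = l then 0 else M $ Some i $ Some j)"
  have "M - mpart l M = hmat l \<alpha> A"
    unfolding mat_option_eq_iff
  proof (intro conjI allI)
    show "(M - mpart l M) $ None $ None = hmat l \<alpha> A $ None $ None"
      by (simp add: mpart_def ny_def \<alpha>_def quat_eq_iff field_simps)
    show "(M - mpart l M) $ None $ Some j = hmat l \<alpha> A $ None $ Some j" for j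
      by (simp add: mpart_def px_def pX_def L(2))
    show "(M - mpart l M) $ Some i $ None = hmat l \<alpha> A $ Some i $ None" for i
      by (simp add: mpart_def px_def pX_def)
    have "M $ Some l $ Some l - ny l M = \<alpha>"
      by (simp add: ny_def \<alpha>_def quat_eq_iff field_simps)
    then show "(M - mpart l M) $ Some i $ Some j = hmat l \<alpha> A $ Some i $ Some j" for i j
      by (simp add: mpart_def nY_def A_def L(3))
  qed
  moreover have "\<alpha> \<in> ImH"
    using L(1) L(3)[of l l] by (simp add: \<alpha>_def ImH_def quat_eq_iff)
  moreover have "A \<in> spW l"
    using L(3) by (auto simp: spW_def A_def vec_eq_iff)
  ultimately show ?thesis unfolding hh_def hpairs_def by force
qed

lemma mpart_eq_0_iff: "M \<in> lie Sp1n \<Longrightarrow> mpart l M = 0 \<longleftrightarrow> M \<in> hh l"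
  using hpart_hh[of M l] mpart_hh[of M l] by auto

lemma subspace_lie_Sp1n: "subspace (lie Sp1n)"
  by (simp add: Sp1n_eq lie_unitary subspace_unitary_alg)

lemma subspace_hh: "subspace (hh l)"
  by (simp add: hh_eq[symmetric] subspace_unitary_alg)

lemma subspace_mm: "subspace (mm l)"
proof (rule subspaceI)
  have "0 = mvec l 0 0 0 0" by (simp add: mat_option_eq_iff)
  then show "0 \<in> mm l" unfolding mm_eq using subspace_0[OF subspace_ImH] subspace_0[OF subspace_W]
      by blast
next
  fix M N assume "M \<in> mm l" "N \<in> mm l"
  then obtain y Y x X y' Y' x' X' where "M = mvec l y Y x X" "N = mvec l y' Y' x' X'"
    "y \<in> ImH" "Y \<in> W l" "X \<in> W l" "y' \<in> ImH" "Y' \<in> W l" "X' \<in> W l"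
    unfolding mm_eq by blast
  then have "M + N = mvec l (y + y') (Y + Y') (x + x') (X + X')"
    "y + y' \<in> ImH" "Y + Y' \<in> W l" "X + X' \<in> W l"
    by (simp_all add: mvec_linear subspace_add[OF subspace_ImH] subspace_add[OF subspace_W])
  then show "M + N \<in> mm l" unfolding mm_eq by blast
next
  fix c M assume "M \<in> mm l"
  then obtain y Y x X where "M = mvec l y Y x X" "y \<in> ImH" "Y \<in> W l" "X \<in> W l"
    unfolding mm_eq by blast
  then have "c *\<^sub>R M = mvec l (c *\<^sub>R y) (c *\<^sub>R Y) (c *\<^sub>R x) (c *\<^sub>R X)"
    "c *\<^sub>R y \<in> ImH" "c *\<^sub>R Y \<in> W l" "c *\<^sub>R X \<in> W l"
    by (simp_all add: mvec_linear subspace_scale[OF subspace_ImH] subspace_scale[OF subspace_W])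
  then show "c *\<^sub>R M \<in> mm l" unfolding mm_eq by blast
qed

lemma direct_sum_lie: "direct_sum (lie Sp1n) [hh l, mm l]"
proof -
  have inj: "inj_on sum_list (listset [hh l, mm l])"
  proof (rule inj_onI)
    fix xs ys assume "xs \<in> listset [hh l, mm l]" "ys \<in> listset [hh l, mm l]"
        and eq: "sum_list xs = sum_list ys"
    then obtain a b c d where *: "xs = [a, b]" "ys = [c, d]" "a \<in> hh l" "c \<in> hh l" "b \<in> mm l" "d \<in> mm l"
      by (auto simp: set_Cons_def)
    then have "a + b = c + d" using eq by simp
    then have "mpart l (a + b) = mpart l (c + d)" by simp
    then have "b = d" using * by (simp add: mpart_linear mpart_hh mpart_id)
    with \<open>a + b = c + d\<close> show "xs = ys" by (simp add: *)
  qed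
  have "sum_list ` listset [hh l, mm l] = lie Sp1n"
  proof (intro equalityI subsetI)
    fix x assume "x \<in> sum_list ` listset [hh l, mm l]"
    then show "x \<in> lie Sp1n"
      using subspace_add[OF subspace_lie_Sp1n] hh_subset_lie mm_subset_lie
      by (fastforce simp: set_Cons_def)
  next
    fix x :: "'a qmat1" assume x: "x \<in> lie Sp1n"
    have "[x - mpart l x, mpart l x] \<in> listset [hh l, mm l]"
      using hpart_hh[OF x] mpart_mm[OF x] by (simp add: set_Cons_def)
    then show "x \<in> sum_list ` listset [hh l, mm l]"
      by (rule rev_image_eqI) simp
  qed
  with inj show ?thesis
    by (simp add: direct_sum_def bij_betw_def subspace_hh subspace_mm)
qed

lemma summand_eqs:
  "nIm l = (\<lambda>y. mvec l y 0 0 0) ` ImH" "n' l = (\<lambda>Y. mvec l 0 Y 0 0) ` W l"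
  "Rv l = range (\<lambda>r. mvec l 0 0 (r *\<^sub>R 1) 0)" "ImHv l = (\<lambda>x. mvec l 0 0 x 0) ` ImH"
  "p' l = (\<lambda>X. mvec l 0 0 0 X) ` W l"
proof -
  have 0: "nmat l 0 0 = 0" "pmat l 0 0 = 0" by (simp_all add: mat_option_eq_iff)
  have "r *\<^sub>R vv l = mvec l 0 0 (r *\<^sub>R 1) 0" for r by (auto simp: vv_eq_pmat mat_option_eq_iff)
  then show "nIm l = (\<lambda>y. mvec l y 0 0 0) ` ImH" "n' l = (\<lambda>Y. mvec l 0 Y 0 0) ` W l"
  "Rv l = range (\<lambda>r. mvec l 0 0 (r *\<^sub>R 1) 0)" "ImHv l = (\<lambda>x. mvec l 0 0 x 0) ` ImH"
  "p' l = (\<lambda>X. mvec l 0 0 0 X) ` W l"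
    by (simp_all add: nIm_def n'_def Rv_def ImHv_def p'_def mvec_def 0 Setcompr_eq_image
        full_SetCompr_eq)
qed

lemma subspace_linear_image:
  "subspace S \<Longrightarrow> (\<And>x y. f (x + y) = f x + f y) \<Longrightarrow> (\<And>c x. f (c *\<^sub>R x) = c *\<^sub>R f x) \<Longrightarrow> subspace (f ` S)"
  by (rule linear_subspace_image) (auto intro: linearI)

lemma direct_sum_mm: "direct_sum (mm l) [nIm l, n' l, Rv l, ImHv l, p' l]"
proof -
  let ?L = "[nIm l, n' l, Rv l, ImHv l, p' l]"
  have sum: "sum_list [mvec l y 0 0 0, mvec l 0 Y 0 0, mvec l 0 0 (r *\<^sub>R 1) 0, mvec l 0 0 x 0, mvec l 0 0 0 X]
    = mvec l y Y (r *\<^sub>R 1 + x) X" for y Y r x X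
    by (simp add: mvec_linear)
  have "\<exists>y Y r x X. xs = [mvec l y 0 0 0, mvec l 0 Y 0 0, mvec l 0 0 (r *\<^sub>R 1) 0, mvec l 0 0 x 0, mvec l 0 0 0 X]
      \<and> y \<in> ImH \<and> Y \<in> W l \<and> x \<in> ImH \<and> X \<in> W l" if "xs \<in> listset ?L" for xs
    using that unfolding summand_eqs by (simp add: set_Cons_def) blast
  note elim = this
  have inj: "inj_on sum_list (listset ?L)"
  proof (rule inj_onI)
    fix xs ys assume "xs \<in> listset ?L" "ys \<in> listset ?L" and eq: "sum_list xs = sum_list ys"
    obtain y Y r x X where xs: "xs = [mvec l y 0 0 0, mvec l 0 Y 0 0, mvec l 0 0 (r *\<^sub>R 1) 0, mvec l 0 0 x 0, mvec l 0 0 0 X]"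
      "Y \<in> W l" "x \<in> ImH" "X \<in> W l" using elim[OF \<open>xs \<in> listset ?L\<close>] by blast
    obtain y' Y' r' x' X' where ys: "ys = [mvec l y' 0 0 0, mvec l 0 Y' 0 0, mvec l 0 0 (r' *\<^sub>R 1) 0, mvec l 0 0 x' 0, mvec l 0 0 0 X']"
      "Y' \<in> W l" "x' \<in> ImH" "X' \<in> W l" using elim[OF \<open>ys \<in> listset ?L\<close>] by blast
    have e: "mvec l y Y (r *\<^sub>R 1 + x) X = mvec l y' Y' (r' *\<^sub>R 1 + x') X'"
      using eq unfolding xs(1) ys(1) sum .
    have "y = y'" "Y = Y'" "r *\<^sub>R 1 + x = r' *\<^sub>R 1 + x'" "X = X'"
      using arg_cong[OF e, of "ny l"] arg_cong[OF e, of "nY l"] arg_cong[OF e, of "px l"]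
          arg_cong[OF e, of "pX l"]
        xs ys by auto
    moreover from this(3) have "r = r'" "x = x'" using xs(3) ys(3) by (auto simp: ImH_def quat_eq_iff)
    ultimately show "xs = ys" by (simp add: xs(1) ys(1))
  qed
  have "sum_list ` listset ?L = mm l"
  proof (intro equalityI subsetI)
    fix M assume "M \<in> sum_list ` listset ?L"
    then obtain xs where "xs \<in> listset ?L" "M = sum_list xs" by blast
    then show "M \<in> mm l" using elim[of xs] sum unfolding mm_eq by blast
  next
    fix M assume "M \<in> mm l"
    then obtain y Y x X where M: "M = mvec l y Y x X" and "y \<in> ImH" "Y \<in> W l" "X \<in> W l"
      unfolding mm_eq by blast
    moreover have "x - qre x *\<^sub>R 1 \<in> ImH" by (simp add: ImH_def)
    ultimately have "[mvec l y 0 0 0, mvec l 0 Y 0 0, mvec l 0 0 (qre x *\<^sub>R 1) 0, mvec l 0 0 (x - qre x *\<^sub>R 1) 0, mvec l 0 0 0 X]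
        \<in> listset ?L"
      unfolding summand_eqs by (simp add: set_Cons_def)
    moreover have "M = sum_list [mvec l y 0 0 0, mvec l 0 Y 0 0, mvec l 0 0 (qre x *\<^sub>R 1) 0,
        mvec l 0 0 (x - qre x *\<^sub>R 1) 0, mvec l 0 0 0 X]"
      unfolding sum M by simp
    ultimately show "M \<in> sum_list ` listset ?L" by (rule rev_image_eqI)
  qed
  moreover have "subspace U" if "U \<in> set ?L" for U
    using that unfolding summand_eqs
    by (auto intro!: subspace_linear_image[OF subspace_ImH] subspace_linear_image[OF subspace_W]
        subspace_linear_image[OF subspace_UNIV] simp: mvec_linear scaleR_add_left)
  ultimately show ?thesis using inj by (simp add: direct_sum_def bij_betw_def)
qed

section \<open>The isotropy representation\<close>

lemma hmat_mul_nth: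
  assumes "\<And>i. i \<noteq> l \<Longrightarrow> A $ i $ l = 0"
  shows "(hmat l a A ** M) $ None $ j = a * M $ None $ j"
    "(hmat l a A ** M) $ Some l $ j = a * M $ Some l $ j"
    "i \<noteq> l \<Longrightarrow> (hmat l a A ** M) $ Some i $ j = (\<Sum>k\<in>UNIV. A $ i $ k * M $ Some k $ j)"
proof -
  show "(hmat l a A ** M) $ None $ j = a * M $ None $ j"
    by (simp add: mmul_nth sum_UNIV_option)
  show "(hmat l a A ** M) $ Some l $ j = a * M $ Some l $ j"
    by (simp add: mmul_nth sum_UNIV_option)
  show "(hmat l a A ** M) $ Some i $ j = (\<Sum>k\<in>UNIV. A $ i $ k * M $ Some k $ j)" if "i \<noteq> l"
    using that assms by (auto simp: mmul_nth sum_UNIV_option intro!: sum.cong)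
qed

lemma mul_hmat_nth:
  assumes "\<And>i. i \<noteq> l \<Longrightarrow> A $ l $ i = 0"
  shows "(M ** hmat l a A) $ i $ None = M $ i $ None * a"
    "(M ** hmat l a A) $ i $ Some l = M $ i $ Some l * a"
    "j \<noteq> l \<Longrightarrow> (M ** hmat l a A) $ i $ Some j = (\<Sum>k\<in>UNIV. M $ i $ Some k * A $ k $ j)"
proof -
  show "(M ** hmat l a A) $ i $ None = M $ i $ None * a"
    by (simp add: mmul_nth sum_UNIV_option)
  show "(M ** hmat l a A) $ i $ Some l = M $ i $ Some l * a"
    by (simp add: mmul_nth sum_UNIV_option if_distrib[of "\<lambda>x. _ * x"] cong: if_cong)
  show "(M ** hmat l a A) $ i $ Some j = (\<Sum>k\<in>UNIV. M $ i $ Some k * A $ k $ j)" if "j \<noteq> l"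
    using that assms by (auto simp: mmul_nth sum_UNIV_option intro!: sum.cong)
qed

lemma Ad_unitary_alg:
  assumes J: "involution J" and A: "A \<in> unitary J C" and X: "X \<in> unitary_alg J C"
  shows "Ad A X \<in> unitary_alg J C"
proof -
  let ?B = "matrix_inv A"
  note inv = unitary_matrix_inv[OF J A]
  have AJA: "adjoint_mat A ** J ** A = J" using A by (simp add: unitary_def)
  have 1: "adjoint_mat A ** J = J ** ?B"
    using AJA inv by (metis matrix_mul_assoc matrix_mul_rid)
  have "adjoint_mat ?B ** adjoint_mat A = mat 1"
    using inv by (metis adjoint_mmul adjoint_simps(6))
  then have 2: "J ** A = adjoint_mat ?B ** J"
    using AJA by (metis matrix_mul_assoc matrix_mul_lid)
  have "adjoint_mat (Ad A X) ** J + J ** Ad A X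
      = adjoint_mat ?B ** adjoint_mat X ** (adjoint_mat A ** J) + (J ** A) ** X ** ?B"
    by (simp add: Ad_def adjoint_mmul matrix_mul_assoc)
  also have "\<dots> = adjoint_mat ?B ** (adjoint_mat X ** J + J ** X) ** ?B"
    unfolding 1 2 by (simp add: mmul_linear matrix_mul_assoc)
  also have "\<dots> = 0" using X by (simp add: unitary_alg_def)
  finally have "adjoint_mat (Ad A X) ** J + J ** Ad A X = 0" .
  moreover have "Ad A X ** M = M ** Ad A X" if "M \<in> C" for M
  proof -
    have "A ** M = M ** A" "?B ** M = M ** ?B" "X ** M = M ** X"
      using A X that unitary_inv[OF J A] by (simp_all add: unitary_def unitary_alg_def)
    then show ?thesis unfolding Ad_def by (metis matrix_mul_assoc)
  qed
  ultimately show ?thesis by (simp add: unitary_alg_def)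
qed

lemma Ad_lie_Sp1n: "A \<in> Sp1n \<Longrightarrow> X \<in> lie Sp1n \<Longrightarrow> Ad A X \<in> lie Sp1n"
  by (simp add: Sp1n_eq lie_unitary Ad_unitary_alg)

lemma Ad_linear: "Ad A (X + Y) = Ad A X + Ad A Y" "Ad A (c *\<^sub>R X) = c *\<^sub>R Ad A X"
    "Ad A (X - Y) = Ad A X - Ad A Y"
  by (simp_all add: Ad_def mmul_linear)

text \<open>
  The adjoint action of \<open>h = diag(a, a, A)\<close> on \<open>m\<close>, written as \<open>h M = M' h\<close> to avoid the inverse
  of \<open>h\<close>. Entries to the right of the diagonal contain \<open>(A Y)\<^sup>* A\<close>, which is \<open>Y\<^sup>*\<close> as \<open>A\<close> is unitary.
\<close>

lemma hmat_mvec: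
  fixes A :: "'n::finite qmat"
  assumes a: "norm a = 1" and A: "A \<in> SpW l" and W: "Y \<in> W l" "X \<in> W l"
  shows "hmat l a A ** mvec l y Y x X =
    mvec l (a * y * qcnj a) (rmul (A *v Y) (qcnj a)) (a * x * qcnj a) (rmul (A *v X) (qcnj a))
      ** hmat l a A"
proof -
  note Al = SpW_nth[OF A]
  have Wl: "Y $ l = 0" "X $ l = 0" using W by (simp_all add: W_iff)
  have aa: "qcnj a * a = 1" using a by simp
  have "(\<Sum>k\<in>UNIV. qcnj ((A *v Z) $ k) * A $ k $ j) = qcnj (Z $ j)" for Z :: "quat ^ 'n" and j
  proof -
    have "(\<Sum>k\<in>UNIV. qcnj ((A *v Z) $ k) * A $ k $ j) = hform (A *v Z) (A *v axis j 1)"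
      by (simp add: hform_def)
    also have "\<dots> = hform Z (axis j 1)" using A by (simp add: SpW_def Spn_def)
    also have "\<dots> = qcnj (hform (axis j 1) Z)" by (rule hform_commute)
    finally show ?thesis by (simp add: hform_axis)
  qed
  note row = this
  have sumL: "(\<Sum>k\<in>UNIV. A $ i $ k * (if k = l then c else Z $ k)) = (A *v Z) $ i" if "i \<noteq> l" for i c Z
    using that Al by (auto simp: mvmul_nth intro!: sum.cong)
  have sumR: "(\<Sum>k\<in>UNIV. (if k = l then c else f k) * A $ k $ j) = (\<Sum>k\<in>UNIV. f k * A $ k $ j)" if "j \<noteq> l"
      for j c f
    using that Al by (auto intro!: sum.cong)
  have row': "(\<Sum>k\<in>UNIV. a * qcnj ((A *v Z) $ k) * A $ k $ j) = a * qcnj (Z $ j)" for Z j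
    unfolding mult.assoc sum_distrib_left[symmetric] row ..
  have 0: "(\<Sum>k\<in>UNIV. A $ i $ k * (if k = l then c else 0)) = 0"
      "(\<Sum>k\<in>UNIV. (if k = l then c else 0) * A $ k $ i) = 0"
    if "i \<noteq> l" for i c
    using that Al by simp_all
  note mul = hmat_mul_nth[where l = l and A = A and a = a] mul_hmat_nth[where l = l and A = A and a = a]
  show ?thesis
    unfolding mat_option_eq_iff
  proof (intro conjI allI)
    fix i j
    let ?M = "mvec l y Y x X"
      and ?M' = "mvec l (a * y * qcnj a) (rmul (A *v Y) (qcnj a)) (a * x * qcnj a) (rmul (A *v X) (qcnj a))"
    show "(hmat l a A ** ?M) $ None $ None = (?M' ** hmat l a A) $ None $ None"
      using Al aa by (simp add: mul mult.assoc)
    show "(hmat l a A ** ?M) $ None $ Some j = (?M' ** hmat l a A) $ None $ Some j"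
      using Al aa by (cases "j = l") (simp_all add: mul mult.assoc qcnj_mult sumR
          row'[unfolded mult.assoc])
    show "(hmat l a A ** ?M) $ Some i $ None = (?M' ** hmat l a A) $ Some i $ None"
      using Al aa by (cases "i = l") (simp_all add: mul mult.assoc sumL)
    show "(hmat l a A ** ?M) $ Some i $ Some j = (?M' ** hmat l a A) $ Some i $ Some j"
      using Al aa
      by (cases "i = l"; cases "j = l")
        (simp_all add: mul mult.assoc qcnj_mult sumL sumR 0 sum_negf row'[unfolded mult.assoc]
            cong: if_cong)
  qed
qed

lemma Ad_mvec:
  assumes "norm a = 1" "A \<in> SpW l" "Y \<in> W l" "X \<in> W l"
  shows "Ad (hmat l a A) (mvec l y Y x X) =
    mvec l (a * y * qcnj a) (rmul (A *v Y) (qcnj a)) (a * x * qcnj a) (rmul (A *v X) (qcnj a))"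
proof -
  have "hmat l a A \<in> unitary JJ {JJ, vv l}" using assms unfolding stabilizer_coordinates by blast
  then show ?thesis using hmat_mvec[OF assms] Ad_eq_iff[OF involution_JJ] by blast
qed

lemma Kv_coordinates: "Kv l = {hmat l a A | a A. norm a = 1 \<and> A \<in> SpW l}"
  by (simp add: Kv_eq stabilizer_coordinates)

lemma SpW_W:
  assumes "A \<in> SpW l" "X \<in> W l" shows "A *v X \<in> W l"
  using assms(2) by (simp add: W_iff mvmul_nth SpW_nth[OF assms(1)])

lemma rmul_W: "X \<in> W l \<Longrightarrow> rmul X c \<in> W l"
  by (simp add: W_iff)

lemma conj_ImH: "y \<in> ImH \<Longrightarrow> a * y * qcnj a \<in> ImH"
  by (simp add: ImH_iff_qcnj qcnj_mult mult.assoc)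

lemma Ad_mm:
  assumes "A \<in> Kv l" "M \<in> mm l" shows "Ad A M \<in> mm l"
proof -
  obtain a B where A: "A = hmat l a B" "norm a = 1" "B \<in> SpW l"
    using assms by (auto simp: Kv_coordinates)
  obtain y Y x X where M: "M = mvec l y Y x X" "y \<in> ImH" "Y \<in> W l" "X \<in> W l"
    using assms by (auto simp: mm_eq)
  show ?thesis
    unfolding A(1) M(1) Ad_mvec[OF A(2,3) M(3,4)] mm_eq
    using conj_ImH[OF M(2)] SpW_W[OF A(3)] rmul_W M(3,4) by blast
qed

lemma Ad_hh: "A \<in> Kv l \<Longrightarrow> M \<in> hh l \<Longrightarrow> Ad A M \<in> hh l"
  by (simp add: Kv_eq hh_eq[symmetric] Ad_unitary_alg)

lemma mpart_Ad:
  assumes "A \<in> Kv l" "M \<in> lie Sp1n" shows "mpart l (Ad A M) = Ad A (mpart l M)"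
proof -
  have "Ad A M = Ad A (M - mpart l M) + Ad A (mpart l M)" by (simp flip: Ad_linear)
  then have "mpart l (Ad A M) = mpart l (Ad A (M - mpart l M)) + mpart l (Ad A (mpart l M))"
    by (simp only: mpart_linear)
  also have "\<dots> = Ad A (mpart l M)"
    using assms by (simp add: mpart_hh Ad_hh hpart_hh mpart_id Ad_mm mpart_mm)
  finally show ?thesis .
qed

lemma act_mat_mvec:
  fixes A :: "'n::finite qmat"
  assumes a: "(\<alpha>, A) \<in> hpairs l" and W: "Y \<in> W l" "X \<in> W l"
  shows "act_mat l (\<alpha>, A) (mvec l y Y x X) =
    mvec l (\<alpha> * y - y * \<alpha>) (act_W (\<alpha>, A) Y) (\<alpha> * x - x * \<alpha>) (act_W (\<alpha>, A) X)"
proof -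
  have \<alpha>: "qcnj \<alpha> = - \<alpha>" and A: "A \<in> spW l" using a by (simp_all add: hpairs_def ImH_iff_qcnj)
  note Al = spW_nth[OF A]
  have Wl: "Y $ l = 0" "X $ l = 0" using W by (simp_all add: W_iff)
  have sumL: "(\<Sum>k\<in>UNIV. A $ i $ k * (if k = l then c else Z $ k)) = (A *v Z) $ i" for i c Z
    using Al by (auto simp: mvmul_nth intro!: sum.cong)
  have sumR: "(\<Sum>k\<in>UNIV. (if k = l then c else f k) * A $ k $ j) = (\<Sum>k\<in>UNIV. f k * A $ k $ j)" for j c f
    using Al by (auto intro!: sum.cong)
  have row: "(\<Sum>k\<in>UNIV. qcnj (Z $ k) * A $ k $ j) = - qcnj ((A *v Z) $ j)" for Z j
    by (simp add: mvmul_nth qcnj_sum qcnj_mult Al(3) sum_negf)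
  have act: "act_W (\<alpha>, A) Z $ i = (A *v Z) $ i - Z $ i * \<alpha>" for Z i
    by (simp add: act_W_def)
  note mul = hmat_mul_nth[where l = l and A = A and a = \<alpha>] mul_hmat_nth[where l = l and A = A and a = \<alpha>]
  show ?thesis
    unfolding mat_option_eq_iff act_mat_def prod.case
  proof (intro conjI allI)
    fix i j
    let ?M = "mvec l y Y x X"
      and ?M' = "mvec l (\<alpha> * y - y * \<alpha>) (act_W (\<alpha>, A) Y) (\<alpha> * x - x * \<alpha>) (act_W (\<alpha>, A) X)"
    show "(hmat l \<alpha> A ** ?M - ?M ** hmat l \<alpha> A) $ None $ None = ?M' $ None $ None"
      using Al by (simp add: mul)
    show "(hmat l \<alpha> A ** ?M - ?M ** hmat l \<alpha> A) $ None $ Some j = ?M' $ None $ Some j"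
      using Al by (cases "j = l") (simp_all add: mul qcnj_mult qcnj_diff \<alpha> sumR row act)
    show "(hmat l \<alpha> A ** ?M - ?M ** hmat l \<alpha> A) $ Some i $ None = ?M' $ Some i $ None"
      using Al by (cases "i = l") (simp_all add: mul sumL act)
    show "(hmat l \<alpha> A ** ?M - ?M ** hmat l \<alpha> A) $ Some i $ Some j = ?M' $ Some i $ Some j"
      using Al
      by (cases "i = l"; cases "j = l")
        (simp_all add: mul qcnj_mult qcnj_diff \<alpha> sumL sumR row act sum_negf cong: if_cong)
  qed
qed

lemma act_sp1_ImH: "\<alpha> \<in> ImH \<Longrightarrow> y \<in> ImH \<Longrightarrow> \<alpha> * y - y * \<alpha> \<in> ImH"
  by (simp add: ImH_iff_qcnj qcnj_diff qcnj_mult)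

lemma act_W_W: "(\<alpha>, A) \<in> hpairs l \<Longrightarrow> X \<in> W l \<Longrightarrow> act_W (\<alpha>, A) X \<in> W l"
  by (auto simp: W_iff act_W_def mvmul_nth hpairs_def spW_nth)

lemma act_W_zero [simp]: "act_W a 0 = 0"
  by (cases a) (simp add: act_W_def vec_eq_iff mvmul_nth)

lemma module_iso_n': "module_iso (hpairs l) (W l) act_W (n' l) (act_mat l) (nmat l 0)"
proof -
  have "pmat l 0 0 = 0" by (simp add: mat_option_eq_iff)
  then have eq: "nmat l 0 = (\<lambda>Y. mvec l 0 Y 0 0)" by (simp add: fun_eq_iff mvec_def)
  have "inj_on (\<lambda>Y. mvec l 0 Y 0 0) (W l)"
    by (rule inj_on_inverseI[where g = "nY l"]) simp
  then show ?thesis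
    unfolding module_iso_def eq summand_eqs bij_betw_def
    by (auto simp: mvec_linear act_mat_mvec act_W_W W_iff[of 0])
qed

lemma module_iso_p': "module_iso (hpairs l) (W l) act_W (p' l) (act_mat l) (pmat l 0)"
proof -
  have "nmat l 0 0 = 0" by (simp add: mat_option_eq_iff)
  then have eq: "pmat l 0 = (\<lambda>X. mvec l 0 0 0 X)" by (simp add: fun_eq_iff mvec_def)
  have "inj_on (\<lambda>X. mvec l 0 0 0 X) (W l)"
    by (rule inj_on_inverseI[where g = "pX l"]) simp
  then show ?thesis
    unfolding module_iso_def eq summand_eqs bij_betw_def
    by (auto simp: mvec_linear act_mat_mvec act_W_W W_iff[of 0])
qed

lemma to_mm_eq: "to_mm l (r, z, Z) = mvec l (z $ 1) (Z $ 1) (r *\<^sub>R 1 + z $ 2) (Z $ 2)"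
  by (auto simp: to_mm_def vv_eq_pmat mat_option_eq_iff qcnj_add)

lemma v_star_to_mm: "(r, z, Z) \<in> model l \<Longrightarrow> v_star l (to_mm l (r, z, Z)) = r"
  by (simp add: to_mm_eq v_star_def model_def tensor_R2_def ImH_def)

definition of_mm :: "'n \<Rightarrow> 'n::finite qmat1 \<Rightarrow> 'n model" where
  "of_mm l M = (qre (px l M), (\<chi> i. if i = 1 then ny l M else px l M - qre (px l M) *\<^sub>R 1),
     (\<chi> i. if i = 1 then nY l M else pX l M))"

lemma of_mm_model: "M \<in> mm l \<Longrightarrow> of_mm l M \<in> model l"
  by (auto simp: of_mm_def model_def tensor_R2_def mm_eq ImH_def)

lemma to_mm_of_mm: "M \<in> mm l \<Longrightarrow> to_mm l (of_mm l M) = M"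
  by (auto simp: of_mm_def to_mm_eq mm_eq)

lemma of_mm_to_mm:
  assumes "m \<in> model l" shows "of_mm l (to_mm l m) = m"
proof -
  obtain r z Z where m: "m = (r, z, Z)" by (metis prod_cases3)
  show ?thesis
    using assms
    by (auto simp: m of_mm_def to_mm_eq model_def tensor_R2_def ImH_def vec_eq_iff forall_2)
qed

lemma to_mm_mm: "m \<in> model l \<Longrightarrow> to_mm l m \<in> mm l"
  by (cases m) (simp add: model_def tensor_R2_def to_mm_eq mm_eq, blast)

lemma module_iso_mm: "module_iso (hpairs l) (model l) act_model (mm l) (act_mat l) (to_mm l)"
  unfolding module_iso_def
proof (intro conjI ballI allI)
  show "bij_betw (to_mm l) (model l) (mm l)"
    by (rule bij_betw_byWitness[where f' = "of_mm l"])
      (auto simp: of_mm_to_mm to_mm_of_mm to_mm_mm of_mm_model)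
next
  fix m m' assume "m \<in> model l" "m' \<in> model l"
  show "to_mm l (m + m') = to_mm l m + to_mm l m'"
    by (cases m; cases m') (simp add: to_mm_eq mvec_linear algebra_simps)
next
  fix c m assume "m \<in> model l"
  show "to_mm l (c *\<^sub>R m) = c *\<^sub>R to_mm l m"
    by (cases m) (simp add: to_mm_eq mvec_linear algebra_simps)
next
  fix a m assume a: "a \<in> hpairs l" and m: "m \<in> model l"
  obtain \<alpha> A where a': "a = (\<alpha>, A)" by force
  obtain r z Z where m': "m = (r, z, Z)" by (metis prod_cases3)
  have 1: "\<alpha> \<in> ImH" "z $ i \<in> ImH" "Z $ i \<in> W l" for i
    using a m by (simp_all add: a' m' hpairs_def model_def tensor_R2_def)
  then show "act_model a m \<in> model l"
    using a by (auto simp: a' m' act_model_def model_def tensor_R2_def tensor_act_def act_sp1_def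
        act_sp1_ImH act_W_W)
  show "to_mm l (act_model a m) = act_mat l a (to_mm l m)"
    using 1 a by (simp add: a' m' act_model_def to_mm_eq tensor_act_def act_sp1_def act_mat_mvec
        algebra_simps)
qed

section \<open>Vectors fixed by the isotropy group\<close>

lemma diagm_Kv:
  assumes d: "\<And>i. norm (d i) = 1" "d None = d (Some l)"
  shows "diagm d \<in> Kv l"
proof -
  have "adjoint_mat (diagm d) = diagm (\<lambda>i. qcnj (d i))"
    by (simp add: vec_eq_iff)
  moreover have "qcnj (d i) * (sgn0 i * d i) = sgn0 i" for i using d by (cases i) simp_all
  ultimately have "adjoint_mat (diagm d) ** JJ ** diagm d = JJ"
    by (simp add: vec_eq_iff mult.assoc)
  moreover have "diagm d ** JJ = JJ ** diagm d" "diagm d ** vv l = vv l ** diagm d"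
    unfolding commutes_JJ_iff commutes_vv_iff by (simp_all add: d)
  ultimately show ?thesis by (simp add: Kv_eq unitary_def)
qed

text \<open>
  The diagonal matrices \<open>d\<close> with unit entries and \<open>d\<^sub>0 = d\<^sub>1\<close> lie in the isotropy group. A matrix \<open>u\<close>
  commutes with all of them only if its entries outside the block of \<open>e\<^sub>0, e\<^sub>1\<close> and the diagonal
  vanish (take \<open>d\<^sub>i = -1\<close> for one \<open>i\<close>) and the remaining ones are real (take \<open>d\<close> constant). In
  \<open>sp\<^sub>1\<^sub>,\<^sub>n\<close> the diagonal entries are imaginary, and only multiples of \<open>v\<close> remain.
\<close>

lemma fixed_by_Kv:
  assumes u: "u \<in> lie Sp1n" and fixed: "\<And>A. A \<in> Kv l \<Longrightarrow> A ** u = u ** A"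
  shows "u \<in> Rv l"
proof -
  have comm: "d i * u $ i $ j = u $ i $ j * d j" if "\<And>i. norm (d i) = 1" "d None = d (Some l)" for d i j
    using arg_cong[OF fixed[OF diagm_Kv[of d l]], of "\<lambda>M. M $ i $ j"] that by simp
  have L: "qcnj (u $ None $ None) = - u $ None $ None"
     "u $ None $ Some i = qcnj (u $ Some i $ None)"
     "qcnj (u $ Some j $ Some i) = - u $ Some i $ Some j" for i j
    using u by (simp_all add: lie_Sp1n_iff)
  have real: "u $ i $ j = qre (u $ i $ j) *\<^sub>R 1" for i j
    using comm[of "\<lambda>_. _" i j] by (intro commutes_with_units_imp_real) blast
  have off: "u $ Some i $ j = 0" "u $ j $ Some i = 0" if "i \<noteq> l" "j \<noteq> Some i" for i j
    using comm[of "\<lambda>k. if k = Some i then -1 else 1" "Some i" j]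
      comm[of "\<lambda>k. if k = Some i then -1 else 1" j "Some i"] that
    by (simp_all add: quat_eq_iff)
  have diag: "u $ i $ i = 0" for i
  proof -
    have "qcnj (u $ i $ i) = - u $ i $ i" using L by (cases i) simp_all
    with real[of i i] show ?thesis by (simp add: quat_eq_iff)
  qed
  have "u = qre (u $ Some l $ None) *\<^sub>R vv l"
    unfolding mat_option_eq_iff vv_eq_pmat
  proof (intro conjI allI)
    fix i j
    show "u $ None $ None = (qre (u $ Some l $ None) *\<^sub>R pmat l 1 0) $ None $ None"
      by (simp add: diag)
    show 1: "u $ Some i $ None = (qre (u $ Some l $ None) *\<^sub>R pmat l 1 0) $ Some i $ None" for i
      using off[of i None] real[of "Some l" None] by simp
    show "u $ None $ Some i = (qre (u $ Some l $ None) *\<^sub>R pmat l 1 0) $ None $ Some i"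
      unfolding L(2) 1[of i] by simp
    show "u $ Some i $ Some j = (qre (u $ Some l $ None) *\<^sub>R pmat l 1 0) $ Some i $ Some j"
      using off[of i "Some j"] off[of j "Some i"] diag[of "Some i"]
          by (cases "i = j"; cases "i = l") auto
  qed
  then show ?thesis unfolding Rv_def by blast
qed

lemma Kv_commutes_vv: "A \<in> Kv l \<Longrightarrow> A ** vv l = vv l ** A"
  by (simp add: Kv_eq unitary_def)

lemma Rv_subset_mm: "Rv l \<subseteq> mm l"
  using subspace_0[OF subspace_ImH] subspace_0[OF subspace_W] unfolding summand_eqs mm_eq by blast

lemma invariants_Kv: "invariants (Kv l) (mm l) = Rv l"
proof -
  have Ad: "Ad A X = X \<longleftrightarrow> A ** X = X ** A" if "A \<in> Kv l" for A X
    using that unfolding Kv_eq by (rule Ad_eq_iff[OF involution_JJ])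
  show ?thesis
  proof (intro equalityI subsetI)
    fix u assume "u \<in> invariants (Kv l) (mm l)"
    then show "u \<in> Rv l" using fixed_by_Kv mm_subset_lie Ad unfolding invariants_def by blast
  next
    fix u assume u: "u \<in> Rv l"
    then obtain r where r: "u = r *\<^sub>R vv l" by (auto simp: Rv_def)
    have "A ** u = u ** A" if "A \<in> Kv l" for A
      using Kv_commutes_vv[OF that] by (simp add: r mmul_linear)
    then show "u \<in> invariants (Kv l) (mm l)" using u Rv_subset_mm Ad unfolding invariants_def by blast
  qed
qed

lemma vv_nonzero: "vv l \<noteq> 0"
  by (auto simp: vv_eq_pmat mat_option_eq_iff)

lemma dim_Rv: "dim (Rv l) = 1"
proof -
  have "Rv l = span {vv l}" by (auto simp: Rv_def span_singleton)
  then have "dim (Rv l) = dim {vv l}" by simp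
  also have "\<dots> = 1" using vv_nonzero[of l] by (simp add: dim_singleton)
  finally show ?thesis .
qed

section \<open>Invariant bilinear forms\<close>

definition bilinear_on :: "'a::real_vector set \<Rightarrow> ('a \<Rightarrow> 'a \<Rightarrow> real) \<Rightarrow> bool" where
  "bilinear_on S f \<longleftrightarrow>
    (\<forall>x\<in>S. \<forall>y\<in>S. \<forall>z\<in>S. f (x + y) z = f x z + f y z \<and> f z (x + y) = f z x + f z y) \<and>
    (\<forall>c. \<forall>x\<in>S. \<forall>y\<in>S. f (c *\<^sub>R x) y = c * f x y \<and> f x (c *\<^sub>R y) = c * f x y)"

lemma bilinear_onD:
  assumes "bilinear_on S f" "x \<in> S" "y \<in> S" "z \<in> S"
  shows "f (x + y) z = f x z + f y z" "f z (x + y) = f z x + f z y"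
  using assms by (auto simp: bilinear_on_def)

lemma bilinear_on_scaleR:
  assumes "bilinear_on S f" "x \<in> S" "y \<in> S"
  shows "f (c *\<^sub>R x) y = c * f x y" "f x (c *\<^sub>R y) = c * f x y"
  using assms by (auto simp: bilinear_on_def)

lemma bilinear_on_minus:
  assumes "bilinear_on S f" "x \<in> S" "y \<in> S"
  shows "f (- x) y = - f x y" "f x (- y) = - f x y"
  using bilinear_on_scaleR[OF assms, of "-1"] by simp_all

lemma sym_bilinear_on_imp_bilinear_on:
  assumes "subspace S" "sym_bilinear_on S f" shows "bilinear_on S f"
  using assms unfolding sym_bilinear_on_def bilinear_on_def
  by (metis subspace_add subspace_scale)

lemma bilinear_on_sum:
  assumes f: "bilinear_on S f" and S: "subspace S" and I: "\<And>i. i \<in> I \<Longrightarrow> x i \<in> S" and y: "y \<in> S"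
  shows "f (\<Sum>i\<in>I. x i) y = (\<Sum>i\<in>I. f (x i) y)" "f y (\<Sum>i\<in>I. x i) = (\<Sum>i\<in>I. f y (x i))"
proof -
  have 0: "f 0 y = 0" "f y 0 = 0" using bilinear_on_scaleR[OF f y y, of 0] by simp_all
  have "(\<Sum>i\<in>I. x i) \<in> S \<and> f (\<Sum>i\<in>I. x i) y = (\<Sum>i\<in>I. f (x i) y) \<and> f y (\<Sum>i\<in>I. x i) = (\<Sum>i\<in>I. f y (x i))"
    using I
    by (induction I rule: infinite_finite_induct)
      (auto simp: 0 subspace_0[OF S] subspace_add[OF S] bilinear_onD(1,2)[OF f _ _ y])
  then show "f (\<Sum>i\<in>I. x i) y = (\<Sum>i\<in>I. f (x i) y)" "f y (\<Sum>i\<in>I. x i) = (\<Sum>i\<in>I. f y (x i))"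
    by simp_all
qed

abbreviation "qI \<equiv> Quat 0 1 0 0"
abbreviation "qJ \<equiv> Quat 0 0 1 0"
abbreviation "qK \<equiv> Quat 0 0 0 1"

lemma qcnj_units [simp]: "qcnj qI = - qI" "qcnj qJ = - qJ" "qcnj qK = - qK"
  by (simp_all add: quat_eq_iff)

lemma units_mult [simp]:
  "qI * qI = -1" "qJ * qJ = -1" "qK * qK = -1" "qI * qJ = qK" "qJ * qI = - qK"
  "qJ * qK = qI" "qK * qJ = - qI" "qK * qI = qJ" "qI * qK = - qJ"
  by (simp_all add: quat_simps)

lemma units_ImH [simp]: "qI \<in> ImH" "qJ \<in> ImH" "qK \<in> ImH"
  by (simp_all add: ImH_def)

subsection \<open>Forms on the imaginary quaternions\<close>

lemma form_ImH_scalar: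
  assumes f: "bilinear_on ImH f"
    and off: "f qI qJ = 0" "f qI qK = 0" "f qJ qI = 0" "f qJ qK = 0" "f qK qI = 0" "f qK qJ = 0"
    and diag: "f qJ qJ = f qI qI" "f qK qK = f qI qI"
    and x: "x \<in> ImH" and y: "y \<in> ImH"
  shows "f x y = f qI qI * (x \<bullet> y)"
proof -
  have expand: "x = qi x *\<^sub>R qI + (qj x *\<^sub>R qJ + qk x *\<^sub>R qK)" if "x \<in> ImH" for x
    using that by (simp add: quat_eq_iff ImH_def)
  note cl = subspace_add[OF subspace_ImH] subspace_scale[OF subspace_ImH]
  have "f x y = f (qi x *\<^sub>R qI + (qj x *\<^sub>R qJ + qk x *\<^sub>R qK)) (qi y *\<^sub>R qI + (qj y *\<^sub>R qJ + qk y *\<^sub>R qK))"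
    using expand[OF x] expand[OF y] by simp
  also have "\<dots> = f qI qI * (x \<bullet> y)"
    using x y by (simp add: bilinear_onD[OF f] bilinear_on_scaleR[OF f] cl off diag inner_quat_def
        ImH_def algebra_simps)
  finally show ?thesis .
qed

text \<open>
  Conjugation with \<open>i\<close> fixes \<open>i\<close> and changes the sign of \<open>j\<close> and \<open>k\<close>, and so on; conjugation with
  \<open>(1 + i + j + k) / 2\<close> permutes \<open>i, j, k\<close> cyclically.
\<close>

lemma Ad_invariant_form_ImH:
  assumes f: "bilinear_on ImH f"
    and inv: "\<And>a x y. norm a = 1 \<Longrightarrow> x \<in> ImH \<Longrightarrow> y \<in> ImH \<Longrightarrow> f (a * x * qcnj a) (a * y * qcnj a) = f x y"
    and x: "x \<in> ImH" and y: "y \<in> ImH"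
  shows "f x y = f qI qI * (x \<bullet> y)"
proof -
  note neg = bilinear_on_minus[OF f]
  note c = inv[OF unit_quats(1)] inv[OF unit_quats(2)] inv[OF unit_quats(3)]
  have off: "f qI qJ = 0" "f qI qK = 0" "f qJ qI = 0" "f qJ qK = 0" "f qK qI = 0" "f qK qJ = 0"
    using c(1)[of qI qJ] c(1)[of qI qK] c(2)[of qJ qI] c(2)[of qJ qK] c(3)[of qK qI] c(3)[of qK qJ]
    by (simp_all add: neg)
  define a where "a = Quat (1/2) (1/2) (1/2) (1/2)"
  have a: "norm a = 1" by (simp add: a_def norm_eq_sqrt_inner inner_quat_def)
  have "a * qI * qcnj a = qJ" "a * qJ * qcnj a = qK"
    by (simp_all add: a_def quat_simps)
  then have "f qJ qJ = f qI qI" "f qK qK = f qI qI"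
    using inv[OF a, of qI qI] inv[OF a, of qJ qJ] by simp_all
  with off show ?thesis by (intro form_ImH_scalar f x y)
qed

text \<open>
  For the Lie algebra, the same conclusion follows from the brackets \<open>[i, j] = 2 k\<close>, \<open>[j, k] = 2 i\<close>,
  \<open>[k, i] = 2 j\<close>.
\<close>

lemma ad_invariant_form_ImH:
  assumes f: "sym_bilinear_on ImH f" and inv: "invariant_form (hpairs l) ImH act_sp1 f"
    and x: "x \<in> ImH" and y: "y \<in> ImH"
  shows "f x y = f qI qI * (x \<bullet> y)"
proof -
  have bl: "bilinear_on ImH f" by (rule sym_bilinear_on_imp_bilinear_on[OF subspace_ImH f])
  have sym: "f x y = f y x" if "x \<in> ImH" "y \<in> ImH" for x y
    using f that by (simp add: sym_bilinear_on_def)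
  have "(\<alpha>, 0) \<in> hpairs l" if "\<alpha> \<in> ImH" for \<alpha>
    using that by (simp add: hpairs_def spW_def)
  then have inv': "f (\<alpha> * x - x * \<alpha>) y + f x (\<alpha> * y - y * \<alpha>) = 0"
    if "\<alpha> \<in> ImH" "x \<in> ImH" "y \<in> ImH" for \<alpha> x y
    using inv that unfolding invariant_form_def by (fastforce simp: act_sp1_def)
  have c: "qI * qJ - qJ * qI = 2 *\<^sub>R qK" "qI * qK - qK * qI = (-2) *\<^sub>R qJ"
    "qJ * qK - qK * qJ = 2 *\<^sub>R qI" "qJ * qI - qI * qJ = (-2) *\<^sub>R qK"
    "qK * qI - qI * qK = 2 *\<^sub>R qJ"
    by (simp_all add: quat_simps)
  note i = inv'[of qI qJ qJ, unfolded c] inv'[of qI qJ qK, unfolded c] inv'[of qJ qK qK, unfolded c]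
    inv'[of qJ qK qI, unfolded c] inv'[of qK qI qI, unfolded c]
  have "f qK qJ = 0" "f qI qK = 0" "f qJ qI = 0" "f qK qK = f qJ qJ" "f qI qI = f qK qK"
    using i sym[of qJ qK] sym[of qK qI] sym[of qI qJ]
        by (simp_all add: bilinear_on_scaleR[OF bl] bilinear_on_minus[OF bl]
        subspace_scale[OF subspace_ImH])
  then show ?thesis
    using sym[of qJ qK] sym[of qK qI] sym[of qI qJ] by (intro form_ImH_scalar bl x y) simp_all
qed

subsection \<open>Forms on quaternionic vectors\<close>

text \<open>
  With \<open>\<phi> q = f 1 q\<close>, the invariance on the left gives \<open>f p q = \<phi> (p\<^sup>* q)\<close>, and on the right it gives
  \<open>\<phi> (x q) = \<phi> (q x)\<close>. So \<open>\<phi>\<close> vanishes on commutators, that is, on the imaginary quaternions, and is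
  a multiple of the real part.
\<close>

lemma form_quat_scalar:
  assumes f: "bilinear_on UNIV f"
    and left: "\<And>x p q. x \<in> {qI, qJ, qK} \<Longrightarrow> f (x * p) q = - f p (x * q)"
    and right: "\<And>x p q. x \<in> {qI, qJ, qK} \<Longrightarrow> f (p * x) q = - f p (q * x)"
  shows "f p q = f 1 1 * (p \<bullet> q)"
proof -
  note bl = bilinear_onD[OF f UNIV_I UNIV_I UNIV_I] bilinear_on_scaleR[OF f UNIV_I UNIV_I]
  note neg = bilinear_on_minus[OF f UNIV_I UNIV_I]
  have comm: "f 1 (x * q) = f 1 (q * x)" if "x \<in> {qI, qJ, qK}" for x q
    using left[OF that, of 1 q] right[OF that, of 1 q] by simp
  have 0: "f 1 qI = 0" "f 1 qJ = 0" "f 1 qK = 0"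
    using comm[of qJ qK] comm[of qK qI] comm[of qI qJ] by (simp_all add: neg)
  have expand: "p = qre p *\<^sub>R 1 + (qi p *\<^sub>R qI + (qj p *\<^sub>R qJ + qk p *\<^sub>R qK))" for p
    by (simp add: quat_eq_iff)
  have one: "f 1 q = f 1 1 * qre q" for q
    by (subst expand[of q]) (simp add: bl 0)
  have "f p q = f (qre p *\<^sub>R 1 + (qi p *\<^sub>R qI + (qj p *\<^sub>R qJ + qk p *\<^sub>R qK))) q"
    using expand[of p] by simp
  also have "\<dots> = qre p * f 1 q - (qi p * f 1 (qI * q) + (qj p * f 1 (qJ * q) + qk p * f 1 (qK * q)))"
    using left[of _ 1 q] by (simp add: bl)
  also have "\<dots> = f 1 1 * (p \<bullet> q)"
    by (simp add: one[of q] one[of "_ * q"] quat_mult_sel inner_quat_def algebra_simps)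
  finally show ?thesis .
qed

lemma axis_W: "i \<noteq> l \<Longrightarrow> axis i p \<in> W l"
  by (simp add: W_iff axis_def)

lemma axis_linear: "axis i (p + q) = axis i p + axis i q" "axis i (c *\<^sub>R p) = c *\<^sub>R axis i (p :: quat)"
  "axis i (- p) = - axis i p"
  by (simp_all add: vec_eq_iff axis_def)

text \<open>
  The hypotheses are consequences of invariance under the group as well as of invariance under the Lie
  algebra; the next lemmas derive them in either case.
\<close>

lemma form_W_scalar:
  assumes F: "bilinear_on (W l) F"
    and off: "\<And>i j p q. i \<noteq> l \<Longrightarrow> j \<noteq> l \<Longrightarrow> i \<noteq> j \<Longrightarrow> F (axis i p) (axis j q) = 0"
    and left: "\<And>i x p q. i \<noteq> l \<Longrightarrow> x \<in> {qI, qJ, qK}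
        \<Longrightarrow> F (axis i (x * p)) (axis i q) = - F (axis i p) (axis i (x * q))"
    and right: "\<And>i x p q. i \<noteq> l \<Longrightarrow> x \<in> {qI, qJ, qK}
        \<Longrightarrow> F (axis i (p * x)) (axis i q) = - F (axis i p) (axis i (q * x))"
    and diag: "\<And>i j. i \<noteq> l \<Longrightarrow> j \<noteq> l \<Longrightarrow> i \<noteq> j \<Longrightarrow> F (axis i 1) (axis i 1) = F (axis j 1) (axis j 1)"
    and m: "m \<noteq> l" and X: "X \<in> W l" and Y: "Y \<in> W l"
  shows "F X Y = F (axis m 1) (axis m 1) * (X \<bullet> Y)"
proof -
  let ?c = "F (axis m 1) (axis m 1)"
  have expand: "X = (\<Sum>i\<in>-{l}. axis i (X $ i))" if "X \<in> W l" for X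
    using that by (auto simp: vec_eq_iff axis_def W_iff)
  have entry: "F (axis i p) (axis j q) = (if i = j then ?c * (p \<bullet> q) else 0)" if ij: "i \<noteq> l" "j \<noteq> l"
      for i j p q
  proof (cases "i = j")
    case True
    have "bilinear_on UNIV (\<lambda>p q. F (axis i p) (axis i q))"
      unfolding bilinear_on_def by (simp add: axis_linear bilinear_onD[OF F] bilinear_on_scaleR[OF F]
          axis_W ij)
    then have "F (axis i p) (axis i q) = F (axis i 1) (axis i 1) * (p \<bullet> q)"
      by (rule form_quat_scalar) (use left right ij in auto)
    also have "F (axis i 1) (axis i 1) = ?c" using diag[OF ij(1) m] by (cases "i = m") auto
    finally show ?thesis using True by simp
  qed (use off ij in simp)
  have "F X Y = F (\<Sum>i\<in>-{l}. axis i (X $ i)) (\<Sum>j\<in>-{l}. axis j (Y $ j))"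
    using expand[OF X] expand[OF Y] by simp
  also have "\<dots> = (\<Sum>i\<in>-{l}. F (axis i (X $ i)) (\<Sum>j\<in>-{l}. axis j (Y $ j)))"
    by (rule bilinear_on_sum(1)[OF F subspace_W]) (auto intro!: axis_W subspace_sum[OF subspace_W])
  also have "\<dots> = (\<Sum>i\<in>-{l}. \<Sum>j\<in>-{l}. F (axis i (X $ i)) (axis j (Y $ j)))"
    by (intro sum.cong refl bilinear_on_sum(2)[OF F subspace_W]) (auto intro!: axis_W)
  also have "\<dots> = (\<Sum>i\<in>-{l}. \<Sum>j\<in>-{l}. (if i = j then ?c * (X $ i \<bullet> Y $ j) else 0))"
    by (intro sum.cong refl) (use entry in auto)
  also have "\<dots> = (\<Sum>i\<in>-{l}. ?c * (X $ i \<bullet> Y $ i))"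
    by simp
  also have "\<dots> = (\<Sum>i\<in>UNIV. ?c * (X $ i \<bullet> Y $ i))"
    using X by (intro sum.mono_neutral_left) (auto simp: W_iff)
  finally show ?thesis by (simp add: inner_vec_def sum_distrib_left)
qed

lemma diagm_mvmul_axis: "diagm d *v axis i p = axis i (d i * p)"
  by (simp add: vec_eq_iff axis_def)

lemma rmul_minus: "rmul (- X) c = - rmul X c"
  by (simp add: vec_eq_iff)

lemma rmul_axis: "rmul (axis i p) c = axis i (p * c)"
  by (simp add: vec_eq_iff axis_def)

lemma diagm_SpW:
  assumes "\<And>i. norm (d i) = 1" "d l = 1" shows "diagm d \<in> SpW l"
proof -
  have "adjoint_mat (diagm d) = diagm (\<lambda>i. qcnj (d i))"
    by (simp add: vec_eq_iff)
  then have "adjoint_mat (diagm d) ** diagm d = mat 1"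
    by (simp add: vec_eq_iff mat_def assms)
  then show ?thesis by (simp add: SpW_def Spn_eq unitary_def diagm_mvmul_axis assms)
qed

lemma diagm_spW:
  assumes "\<And>i. d i \<in> ImH" "d l = 0" shows "diagm d \<in> spW l"
  using assms by (auto simp: spW_def vec_eq_iff ImH_iff_qcnj)

lemma swap_SpW:
  fixes l :: "'n::finite"
  assumes "i \<noteq> l" "j \<noteq> l"
  obtains A where "A \<in> SpW l" "\<And>p. A *v axis i p = axis j p"
proof -
  let ?s = "Transposition.transpose i j"
  define A :: "'n qmat" where "A = (\<chi> r s. if s = ?s r then 1 else 0)"
  have A: "A *v X = (\<chi> r. X $ ?s r)" for X
    by (simp add: vec_eq_iff mvmul_nth A_def)
  have "hform (A *v X) (A *v Y) = hform X Y" for X Y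
    unfolding hform_def A
    by (simp add: sum.reindex_bij_betw[OF bij_transpose, of "\<lambda>r. qcnj (X $ r) * Y $ r"])
  moreover have "A *v axis l 1 = axis l 1"
    using assms by (auto simp: A vec_eq_iff axis_def Transposition.transpose_def)
  moreover have "A *v axis i p = axis j p" for p
    by (auto simp: A vec_eq_iff axis_def Transposition.transpose_def)
  ultimately show ?thesis using that by (auto simp: SpW_def Spn_def)
qed

lemma norm_units: "x \<in> {qI, qJ, qK} \<Longrightarrow> norm x = 1" "x \<in> {qI, qJ, qK} \<Longrightarrow> qcnj x = - x"
  "x \<in> {qI, qJ, qK} \<Longrightarrow> x * x = -1" "x \<in> {qI, qJ, qK} \<Longrightarrow> x \<in> ImH"
  using unit_quats by auto

text \<open>
  It suffices to consider diagonal matrices with unit entries, right multiplication by unit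
  quaternions, and transpositions of two basis vectors.
\<close>

lemma Ad_invariant_form_W:
  assumes F: "bilinear_on (W l) F"
    and inv: "\<And>a A X Y. norm a = 1 \<Longrightarrow> A \<in> SpW l \<Longrightarrow> X \<in> W l \<Longrightarrow> Y \<in> W l
      \<Longrightarrow> F (rmul (A *v X) (qcnj a)) (rmul (A *v Y) (qcnj a)) = F X Y"
    and m: "m \<noteq> l" and X: "X \<in> W l" and Y: "Y \<in> W l"
  shows "F X Y = F (axis m 1) (axis m 1) * (X \<bullet> Y)"
proof (rule form_W_scalar[OF F _ _ _ _ m X Y])
  note neg = bilinear_on_minus[OF F axis_W axis_W]
  have one: "mat 1 \<in> SpW l" by (simp add: SpW_def Spn_def)
  have diagonal: "F (axis i (d i * p)) (axis j (d j * q)) = F (axis i p) (axis j q)"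
    if "i \<noteq> l" "j \<noteq> l" "\<And>i. norm (d i) = 1" "d l = 1" for d i j p q
    using inv[OF norm_one_quat diagm_SpW[of d l] axis_W axis_W, of i j p q] that
    by (simp add: diagm_mvmul_axis rmul_axis)
  show "F (axis i p) (axis j q) = 0" if "i \<noteq> l" "j \<noteq> l" "i \<noteq> j" for i j p q
    using diagonal[of i j "\<lambda>k. if k = i then -1 else 1" p q] that
    by (simp add: axis_linear neg)
  show "F (axis i (x * p)) (axis i q) = - F (axis i p) (axis i (x * q))"
    if "i \<noteq> l" "x \<in> {qI, qJ, qK}" for i x p q
    using diagonal[of i i "\<lambda>k. if k = i then x else 1" p "- (x * q)"] that norm_units[OF that(2)]
    by (simp add: axis_linear neg mult.assoc[symmetric])
  show "F (axis i (p * x)) (axis i q) = - F (axis i p) (axis i (q * x))"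
    if "i \<noteq> l" "x \<in> {qI, qJ, qK}" for i x p q
    using inv[OF _ one axis_W axis_W, of "- x" i i p "- (q * x)"] that norm_units[OF that(2)]
    by (simp add: rmul_axis rmul_minus axis_linear neg mult.assoc)
  show "F (axis i 1) (axis i 1) = F (axis j 1) (axis j 1)" if ij: "i \<noteq> l" "j \<noteq> l" for i j
  proof -
    obtain A where "A \<in> SpW l" "\<And>p. A *v axis i p = axis j p" using swap_SpW[OF ij] by blast
    then show ?thesis using inv[OF norm_one_quat _ axis_W axis_W, of A i i 1 1] ij
      by (simp add: rmul_axis)
  qed
qed

text \<open>
  The infinitesimal version uses diagonal matrices with imaginary entries, and infinitesimal
  rotations instead of transpositions.
\<close>

lemma ad_invariant_form_W:
  fixes l :: "'n::finite"
  assumes F: "bilinear_on (W l) F" and inv: "invariant_form (hpairs l) (W l) act_W F"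
    and m: "m \<noteq> l" and X: "X \<in> W l" and Y: "Y \<in> W l"
  shows "F X Y = F (axis m 1) (axis m 1) * (X \<bullet> Y)"
proof (rule form_W_scalar[OF F _ _ _ _ m X Y])
  note neg = bilinear_on_minus[OF F axis_W axis_W]
  have zero: "F 0 Y = 0" "F Y 0 = 0" if "Y \<in> W l" for Y
    using bilinear_on_scaleR[OF F that that, of 0] by simp_all
  have inv': "F (act_W (\<alpha>, A) X) Y + F X (act_W (\<alpha>, A) Y) = 0"
    if "\<alpha> \<in> ImH" "A \<in> spW l" "X \<in> W l" "Y \<in> W l" for \<alpha> A X Y
    using inv that unfolding invariant_form_def hpairs_def by blast
  have 0: "0 \<in> ImH" "0 \<in> spW l" by (simp_all add: ImH_def spW_def)
  have act0: "act_W (0, A) X = A *v X" for A :: "'n qmat" and X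
    by (simp add: act_W_def vec_eq_iff)
  have actr: "act_W (\<alpha>, 0) (axis i p) = - axis i (p * \<alpha>)" for i :: 'n and p \<alpha>
    by (simp add: act_W_def vec_eq_iff axis_def)
  have diagonal: "F (axis i (d i * p)) (axis j q) + F (axis i p) (axis j (d j * q)) = 0"
    if "i \<noteq> l" "j \<noteq> l" "\<And>i. d i \<in> ImH" "d l = 0" for d i j p q
    using inv'[OF 0(1) diagm_spW[of d l] axis_W axis_W, of i j p q] that
    by (simp add: act0 diagm_mvmul_axis)
  have d: "(if k = i then x else 0) \<in> ImH" if "x \<in> ImH" for k i :: 'n and x
    using that by (simp add: 0)
  have ax0: "axis j 0 = (0 :: quat ^ 'n)" for j by (simp add: vec_eq_iff axis_def)
  have "x * (- (x * p)) = p" if "x \<in> {qI, qJ, qK}" for x p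
    using norm_units[OF that] by (simp add: mult.assoc[symmetric])
  then show "F (axis i p) (axis j q) = 0" if "i \<noteq> l" "j \<noteq> l" "i \<noteq> j" for i j p q
    using diagonal[of i j "\<lambda>k. if k = i then qI else 0" "- (qI * p)" q] that d
    by (simp add: zero axis_W ax0)
  show "F (axis i (x * p)) (axis i q) = - F (axis i p) (axis i (x * q))"
    if "i \<noteq> l" "x \<in> {qI, qJ, qK}" for i x p q
    using diagonal[of i i "\<lambda>k. if k = i then x else 0" p q] that d norm_units[OF that(2)]
    by simp
  show "F (axis i (p * x)) (axis i q) = - F (axis i p) (axis i (q * x))"
    if "i \<noteq> l" "x \<in> {qI, qJ, qK}" for i x p q
    using inv'[OF norm_units(4)[OF that(2)] 0(2) axis_W axis_W, of i i p q] that
    by (simp add: actr neg)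
  show "F (axis i 1) (axis i 1) = F (axis j 1) (axis j 1)" if ij: "i \<noteq> l" "j \<noteq> l" "i \<noteq> j" for i j
  proof -
    define A :: "'n qmat" where "A = (\<chi> r s. if r = j \<and> s = i then 1
        else if r = i \<and> s = j then - 1 else 0)"
    have "A \<in> spW l"
      unfolding spW_def mem_Collect_eq vec_eq_iff mvmul_axis using ij by (auto simp: A_def)
    moreover have "A *v axis i 1 = axis j 1" "A *v axis j 1 = - axis i 1"
      unfolding vec_eq_iff mvmul_axis using ij by (auto simp: A_def axis_def)
    ultimately show ?thesis
      using inv'[OF 0(1) _ axis_W axis_W, of A i j 1 1] ij by (simp add: act0 neg)
  qed
qed

subsection \<open>The standard scalar products are invariant\<close>

lemma inner_hform: "X \<bullet> Y = qre (hform X Y)"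
proof -
  have "qre (\<Sum>i\<in>S. f i) = (\<Sum>i\<in>S. qre (f i))" for S and f :: "'a \<Rightarrow> quat"
    by (induction S rule: infinite_finite_induct) simp_all
  then show ?thesis by (simp add: inner_vec_def hform_def inner_quat)
qed

lemma inner_Ad_ImH: "norm a = 1 \<Longrightarrow> (a * x * qcnj a) \<bullet> (a * y * qcnj a) = x \<bullet> y"
  by (simp add: inner_mult_right_quat[of _ "qcnj a"] mult.assoc inner_mult_left_quat[of a])
    (simp add: mult.assoc[symmetric])

lemma inner_Ad_W:
  fixes A :: "'n::finite qmat"
  assumes "norm a = 1" "A \<in> SpW l"
  shows "rmul (A *v X) (qcnj a) \<bullet> rmul (A *v Y) (qcnj a) = X \<bullet> Y"
proof -
  have "rmul Z (qcnj a) \<bullet> rmul Z' (qcnj a) = Z \<bullet> Z'" for Z Z' :: "quat ^ 'n"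
    using assms by (simp add: inner_vec_def inner_mult_right_quat mult.assoc)
  moreover have "(A *v X) \<bullet> (A *v Y) = X \<bullet> Y"
    using assms(2) by (simp add: inner_hform SpW_def Spn_def)
  ultimately show ?thesis by simp
qed

lemma sym_bilinear_inner: "sym_bilinear_on S (\<bullet>)"
  by (auto simp: sym_bilinear_on_def inner_add_left intro: inner_commute)

lemma euclidean_inner: "euclidean_on S (\<bullet>)"
  by (simp add: euclidean_on_def sym_bilinear_inner)

lemma inner_invariant_ImH: "invariant_form (hpairs l) ImH act_sp1 (\<bullet>)"
  unfolding invariant_form_def
proof (intro ballI)
  fix a x y assume "a \<in> hpairs l"
  then obtain \<alpha> A where a: "a = (\<alpha>, A)" "qcnj \<alpha> = - \<alpha>" by (auto simp: hpairs_def ImH_iff_qcnj)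
  have "(\<alpha> * x) \<bullet> y = - (x \<bullet> (\<alpha> * y))" "(x * \<alpha>) \<bullet> y = - (x \<bullet> (y * \<alpha>))"
    by (simp_all add: inner_mult_left_quat[of \<alpha> x] inner_mult_right_quat[of x \<alpha>] a(2))
  then show "act_sp1 a x \<bullet> y + x \<bullet> act_sp1 a y = 0"
    by (simp add: act_sp1_def a(1) inner_diff_left inner_diff_right)
qed

lemma inner_invariant_W: "invariant_form (hpairs l) (W l) act_W (\<bullet>)"
  unfolding invariant_form_def
proof (intro ballI)
  fix a X Y assume "a \<in> hpairs l" "X \<in> W l" "Y \<in> W l"
  obtain \<alpha> A where a: "a = (\<alpha>, A)" "qcnj \<alpha> = - \<alpha>" "adjoint_mat A = - A"
    using \<open>a \<in> hpairs l\<close> by (auto simp: hpairs_def ImH_iff_qcnj spW_def)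
  have act: "act_W a Z = A *v Z - rmul Z \<alpha>" for Z by (simp add: a(1) act_W_def rmul_def)
  have "(A *v X) \<bullet> Y = - (X \<bullet> (A *v Y))"
    using a(3) by (simp add: inner_hform hform_mvmul
        bounded_bilinear.minus_left[OF bounded_bilinear_mvmul])
      (simp add: hform_def sum_negf)
  moreover have "rmul X \<alpha> \<bullet> Y = - (X \<bullet> rmul Y \<alpha>)"
    using a(2) by (simp add: inner_vec_def inner_mult_right_quat sum_negf)
  ultimately show "act_W a X \<bullet> Y + X \<bullet> act_W a Y = 0"
    by (simp add: act inner_diff_left inner_diff_right)
qed

section \<open>Invariant scalar products on the tangent space\<close>

text \<open>
  The scalar product \<open>- c v\<^sup>* \<otimes> v\<^sup>* + g\<^sub>1 \<otimes> h\<^sub>1 + g\<^sub>2 \<otimes> h\<^sub>2\<close> as a function of matrices. As the coordinates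
  are defined for all matrices, it is at the same time the pull-back of the scalar product to the Lie
  algebra under the projection along \<open>h\<close>.
\<close>

definition formB :: "'n \<Rightarrow> real \<Rightarrow> (quat \<Rightarrow> quat \<Rightarrow> real) \<Rightarrow> (real ^ 2 \<Rightarrow> real ^ 2 \<Rightarrow> real)
    \<Rightarrow> (quat ^ 'n \<Rightarrow> quat ^ 'n \<Rightarrow> real) \<Rightarrow> (real ^ 2 \<Rightarrow> real ^ 2 \<Rightarrow> real)
    \<Rightarrow> 'n::finite qmat1 \<Rightarrow> 'n qmat1 \<Rightarrow> real" where
  "formB l c g1 h1 g2 h2 M N = - c * fst (of_mm l M) * fst (of_mm l N)
     + tensor_form g1 h1 (fst (snd (of_mm l M))) (fst (snd (of_mm l N)))
     + tensor_form g2 h2 (snd (snd (of_mm l M))) (snd (snd (of_mm l N)))"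

lemma is_form_iff:
  "is_form l c g1 h1 g2 h2 B \<longleftrightarrow> (\<forall>M\<in>mm l. \<forall>N\<in>mm l. B M N = formB l c g1 h1 g2 h2 M N)"
proof -
  have "formB l c g1 h1 g2 h2 (to_mm l (r, z, Z)) (to_mm l (r', z', Z'))
      = - c * v_star l (to_mm l (r, z, Z)) * v_star l (to_mm l (r', z', Z'))
          + tensor_form g1 h1 z z' + tensor_form g2 h2 Z Z'"
    if "(r, z, Z) \<in> model l" "(r', z', Z') \<in> model l" for r z Z r' z' Z'
    using that by (simp add: formB_def of_mm_to_mm v_star_to_mm)
  then have "is_form l c g1 h1 g2 h2 B \<longleftrightarrow> (\<forall>m\<in>model l. \<forall>m'\<in>model l.
      B (to_mm l m) (to_mm l m') = formB l c g1 h1 g2 h2 (to_mm l m) (to_mm l m'))"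
    unfolding is_form_def by (auto split: prod.split)
  moreover have "mm l = to_mm l ` model l"
    using to_mm_of_mm of_mm_model to_mm_mm
        by (metis (no_types) bij_betw_def module_iso_def module_iso_mm)
  ultimately show ?thesis by simp
qed

abbreviation "ax1 \<equiv> axis 1 1 :: real ^ 2"
abbreviation "ax2 \<equiv> axis 2 1 :: real ^ 2"

lemma tensor_form_2:
  "tensor_form g h z w = g (z $ 1) (w $ 1) * h ax1 ax1 + g (z $ 1) (w $ 2) * h ax1 ax2
    + (g (z $ 2) (w $ 1) * h ax2 ax1 + g (z $ 2) (w $ 2) * h ax2 ax2)"
  by (simp add: tensor_form_def sum_2)

lemma R2_expand: "x = x $ 1 *\<^sub>R ax1 + x $ 2 *\<^sub>R ax2" for x :: "real ^ 2"
  by (simp add: vec_eq_iff forall_2 axis_def)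

lemma sym_bilinear_R2_expand:
  assumes "sym_bilinear_on UNIV h"
  shows "h x y = x $ 1 * y $ 1 * h ax1 ax1 + (x $ 1 * y $ 2 + x $ 2 * y $ 1) * h ax1 ax2 + x $ 2 * y $ 2 * h ax2 ax2"
proof -
  have bl: "bilinear_on UNIV h"
    by (rule sym_bilinear_on_imp_bilinear_on[OF subspace_UNIV assms])
  note b = bilinear_onD[OF bl UNIV_I UNIV_I UNIV_I] bilinear_on_scaleR[OF bl UNIV_I UNIV_I]
  have s: "h ax2 ax1 = h ax1 ax2" using assms by (simp add: sym_bilinear_on_def)
  have "h x y = h (x $ 1 *\<^sub>R ax1 + x $ 2 *\<^sub>R ax2) (y $ 1 *\<^sub>R ax1 + y $ 2 *\<^sub>R ax2)"
    using R2_expand[of x] R2_expand[of y] by simp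
  then show ?thesis by (simp add: b s algebra_simps)
qed

text \<open>Completing the square: \<open>h\<^sub>1\<^sub>1 (g \<otimes> h)(z, z) = |h\<^sub>1\<^sub>1 z\<^sub>1 + h\<^sub>1\<^sub>2 z\<^sub>2|\<^sup>2 + (h\<^sub>1\<^sub>1 h\<^sub>2\<^sub>2 - h\<^sub>1\<^sub>2\<^sup>2) |z\<^sub>2|\<^sup>2\<close>.\<close>

lemma tensor_form_inner_pos:
  fixes z :: "'a::real_inner ^ 2"
  assumes h: "euclidean_on UNIV h" and z: "z \<noteq> 0"
  shows "tensor_form (\<bullet>) h z z > 0"
proof -
  have hs: "sym_bilinear_on UNIV h" using h by (simp add: euclidean_on_def)
  note ex = sym_bilinear_R2_expand[OF hs]
  define p q r where pqr: "p = h ax1 ax1" "q = h ax1 ax2" "r = h ax2 ax2"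
  have s: "h ax2 ax1 = q" using hs by (simp add: sym_bilinear_on_def pqr)
  have "ax1 \<noteq> 0" by (simp add: axis_eq_0_iff)
  then have p: "p > 0" using h by (simp add: euclidean_on_def pqr)
  have D: "p * r - q * q > 0"
  proof -
    let ?x = "(- q) *\<^sub>R ax1 + p *\<^sub>R ax2"
    have x: "?x $ 1 = - q" "?x $ 2 = p" by (simp_all add: axis_def)
    then have "?x \<noteq> 0" using p by (metis less_irrefl zero_index)
    then have "h ?x ?x > 0" using h by (simp add: euclidean_on_def)
    then have "p * (p * r - q * q) > 0"
      unfolding ex[of ?x ?x] x pqr[symmetric] by (simp add: algebra_simps)
    then show ?thesis using p by (simp add: zero_less_mult_iff)
  qed
  let ?u = "p *\<^sub>R z $ 1 + q *\<^sub>R z $ 2"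
  have eq: "p * tensor_form (\<bullet>) h z z = ?u \<bullet> ?u + (p * r - q * q) * (z $ 2 \<bullet> z $ 2)"
    by (simp add: tensor_form_2 pqr[symmetric] s inner_add_left inner_add_right
        inner_commute[of "z $ 2" "z $ 1"] algebra_simps)
  have "?u \<bullet> ?u + (p * r - q * q) * (z $ 2 \<bullet> z $ 2) > 0"
  proof (cases "z $ 2 = 0")
    case True
    then have "z $ 1 \<noteq> 0" using z by (metis (mono_tags) exhaust_2 vec_eq_iff zero_index)
    then show ?thesis using True p by simp
  next
    case False
    then show ?thesis using D by (intro add_nonneg_pos mult_pos_pos) auto
  qed
  then show ?thesis using eq p by (metis zero_less_mult_pos)
qed

lemma tensor_form_inner_nonneg:
  assumes "euclidean_on UNIV h" shows "tensor_form (\<bullet>) h z z \<ge> 0"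
  using tensor_form_inner_pos[OF assms, of z] by (cases "z = 0") (auto simp: tensor_form_2)

lemma euclidean_scale: "k > 0 \<Longrightarrow> euclidean_on S h \<Longrightarrow> euclidean_on S (\<lambda>x y. k * h x y)"
  by (simp add: euclidean_on_def sym_bilinear_on_def algebra_simps)

lemma tensor_form_scale:
  assumes "\<And>x y. x \<in> U \<Longrightarrow> y \<in> U \<Longrightarrow> g x y = k * (x \<bullet> y)" and "z \<in> tensor_R2 U" "w \<in> tensor_R2 U"
  shows "tensor_form g h z w = tensor_form (\<bullet>) (\<lambda>x y. k * h x y) z w"
  using assms by (simp add: tensor_form_2 tensor_R2_def)

text \<open>
  The invariant scalar products \<open>g\<^sub>1\<close> and \<open>g\<^sub>2\<close> are multiples of the standard ones; the factors may
  be absorbed in \<open>h\<^sub>1\<close> and \<open>h\<^sub>2\<close>. For \<open>n = 1\<close> the space \<open>W\<close> is zero, and so is the second tensor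
  form.
\<close>

lemma is_form_standard:
  fixes l :: "'n::finite"
  assumes g1: "euclidean_on ImH g1" "invariant_form (hpairs l) ImH act_sp1 g1"
    and g2: "euclidean_on (W l) g2" "invariant_form (hpairs l) (W l) act_W g2"
    and h1: "euclidean_on UNIV h1" and h2: "euclidean_on UNIV h2"
    and B: "is_form l c g1 h1 g2 h2 B"
  obtains k1 k2 where "euclidean_on UNIV k1" "euclidean_on UNIV k2"
    "is_form l c (\<bullet>) k1 (\<bullet>) k2 B"
proof -
  have sb: "sym_bilinear_on ImH g1" "sym_bilinear_on (W l) g2"
    using g1 g2 by (simp_all add: euclidean_on_def)
  have g1': "g1 x y = g1 qI qI * (x \<bullet> y)" if "x \<in> ImH" "y \<in> ImH" for x y
    using ad_invariant_form_ImH[OF sb(1) g1(2) that] .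
  have "qI \<noteq> 0" by (simp add: quat_eq_iff)
  then have p1: "g1 qI qI > 0" using g1 by (simp add: euclidean_on_def)
  have "\<exists>k. k > 0 \<and> (\<forall>X\<in>W l. \<forall>Y\<in>W l. g2 X Y = k * (X \<bullet> Y))"
  proof (cases "\<exists>m. m \<noteq> l")
    case True
    then obtain m where m: "m \<noteq> l" by blast
    have bl: "bilinear_on (W l) g2"
      by (rule sym_bilinear_on_imp_bilinear_on[OF subspace_W sb(2)])
    have "axis m (1::quat) \<noteq> 0" by (simp add: axis_eq_0_iff)
    then have "g2 (axis m 1) (axis m 1) > 0" using g2 axis_W[OF m] by (simp add: euclidean_on_def)
    then show ?thesis using ad_invariant_form_W[OF bl g2(2) m] by blast
  next
    case False
    have "g2 X Y = 1 * (X \<bullet> Y)" if "X \<in> W l" "Y \<in> W l" for X Y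
    proof -
      have "X = 0" "Y = 0" using False that by (auto simp: W_iff vec_eq_iff)
      moreover have "g2 0 0 = 0"
        using bilinear_on_scaleR(1)[OF sym_bilinear_on_imp_bilinear_on[OF subspace_W sb(2)], of 0 0 0]
        by (simp add: W_iff)
      ultimately show ?thesis by simp
    qed
    then show ?thesis using zero_less_one by blast
  qed
  then obtain k where k: "k > 0" "\<And>X Y. X \<in> W l \<Longrightarrow> Y \<in> W l \<Longrightarrow> g2 X Y = k * (X \<bullet> Y)" by blast
  have "formB l c g1 h1 g2 h2 M N
      = formB l c (\<bullet>) (\<lambda>x y. g1 qI qI * h1 x y) (\<bullet>) (\<lambda>x y. k * h2 x y) M N"
    if "M \<in> mm l" "N \<in> mm l" for M N
  proof -
    have "fst (snd (of_mm l M)) \<in> tensor_R2 ImH" "fst (snd (of_mm l N)) \<in> tensor_R2 ImH"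
      "snd (snd (of_mm l M)) \<in> tensor_R2 (W l)" "snd (snd (of_mm l N)) \<in> tensor_R2 (W l)"
      using of_mm_model[OF that(1)] of_mm_model[OF that(2)] by (auto simp: model_def)
    then show ?thesis
      unfolding formB_def by (simp add: tensor_form_scale[OF g1'] tensor_form_scale[OF k(2)])
  qed
  then have "is_form l c (\<bullet>) (\<lambda>x y. g1 qI qI * h1 x y) (\<bullet>) (\<lambda>x y. k * h2 x y) B"
    using B unfolding is_form_iff by simp
  then show ?thesis by (rule that[OF euclidean_scale[OF p1 h1] euclidean_scale[OF k(1) h2]])
qed

lemma of_mm_nth [simp]:
  "fst (of_mm l M) = qre (px l M)"
  "fst (snd (of_mm l M)) $ 1 = ny l M"
  "fst (snd (of_mm l M)) $ 2 = px l M - qre (px l M) *\<^sub>R 1"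
  "snd (snd (of_mm l M)) $ 1 = nY l M" "snd (snd (of_mm l M)) $ 2 = pX l M"
  by (simp_all add: of_mm_def)

lemma mpart_coordinates [simp]:
  "ny l (mpart l M) = ny l M" "px l (mpart l M) = px l M" "nY l (mpart l M) = nY l M"
      "pX l (mpart l M) = pX l M"
  by (simp_all add: mpart_def)

lemma of_mm_mpart: "of_mm l (mpart l M) = of_mm l M"
  by (simp add: of_mm_def cong: if_cong)

lemma formB_mpart: "formB l c g1 h1 g2 h2 (mpart l M) (mpart l N) = formB l c g1 h1 g2 h2 M N"
  by (simp add: formB_def of_mm_mpart)

lemma formB_sym_bilinear:
  assumes "sym_bilinear_on UNIV h1" "sym_bilinear_on UNIV h2"
  shows "sym_bilinear_on S (formB l c (\<bullet>) h1 (\<bullet>) h2)"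
proof -
  have s: "h1 ax2 ax1 = h1 ax1 ax2" "h2 ax2 ax1 = h2 ax1 ax2"
    using assms by (simp_all add: sym_bilinear_on_def)
  show ?thesis
    unfolding sym_bilinear_on_def formB_def tensor_form_2 of_mm_nth s
    by (auto simp: coordinates_linear inner_add_left inner_diff_left algebra_simps)
      (simp add: inner_commute)
qed

lemma formB_Ad:
  assumes A: "A \<in> Kv l" and M: "M \<in> mm l" and N: "N \<in> mm l"
  shows "formB l c (\<bullet>) h1 (\<bullet>) h2 (Ad A M) (Ad A N) = formB l c (\<bullet>) h1 (\<bullet>) h2 M N"
proof -
  obtain a D where D: "A = hmat l a D" "norm a = 1" "D \<in> SpW l"
    using A by (auto simp: Kv_coordinates)
  have px: "px l (Ad A M) = a * px l M * qcnj a \<and> ny l (Ad A M) = a * ny l M * qcnj a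
     \<and> nY l (Ad A M) = rmul (D *v nY l M) (qcnj a) \<and> pX l (Ad A M) = rmul (D *v pX l M) (qcnj a)"
    if M: "M \<in> mm l" for M
  proof -
    obtain y Y x X where M: "M = mvec l y Y x X" "y \<in> ImH" "Y \<in> W l" "X \<in> W l"
      using M by (auto simp: mm_eq)
    then show ?thesis
      unfolding D(1) by (simp add: Ad_mvec[OF D(2,3)] rmul_W SpW_W[OF D(3)])
  qed
  have re: "qre (a * x * qcnj a) = qre x" for x
  proof -
    have "qre (a * x * qcnj a) = (norm a)\<^sup>2 * qre x"
      unfolding norm_quat_sq by (simp add: quat_mult_sel algebra_simps)
    then show ?thesis using D by simp
  qed
  have im: "a * x * qcnj a - qre x *\<^sub>R 1 = a * (x - qre x *\<^sub>R 1) * qcnj a" for x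
    using D(2) by (simp add: left_diff_distrib right_diff_distrib)
  show ?thesis
    unfolding formB_def tensor_form_2 of_mm_nth
    by (simp add: px[OF M] px[OF N] re im inner_Ad_ImH[OF D(2)] inner_Ad_W[OF D(2,3)])
qed

text \<open>
  With \<open>e\<^sub>s\<close> a standard basis vector of \<open>\<real>\<^sup>2\<close>, \<open>embed1 l s y\<close> is \<open>y \<otimes> e\<^sub>s\<close> in \<open>sp\<^sub>1 \<otimes> \<real>\<^sup>2\<close> and
  \<open>embed2 l s Y\<close> is \<open>Y \<otimes> e\<^sub>s\<close> in \<open>\<bbbH>\<^sup>n\<^sup>-\<^sup>1 \<otimes> \<real>\<^sup>2\<close>.
\<close>

definition embed1 :: "'n \<Rightarrow> 2 \<Rightarrow> quat \<Rightarrow> 'n::finite qmat1" where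
  "embed1 l s y = (if s = 1 then mvec l y 0 0 0 else mvec l 0 0 y 0)"

definition embed2 :: "'n \<Rightarrow> 2 \<Rightarrow> quat ^ 'n \<Rightarrow> 'n::finite qmat1" where
  "embed2 l s Y = (if s = 1 then mvec l 0 Y 0 0 else mvec l 0 0 0 Y)"

lemma embed_mm: "y \<in> ImH \<Longrightarrow> embed1 l s y \<in> mm l" "Y \<in> W l \<Longrightarrow> embed2 l s Y \<in> mm l" "vv l \<in> mm l"
proof -
  have 0: "0 \<in> ImH" "0 \<in> W l" by (simp_all add: ImH_def W_iff)
  have "vv l = mvec l 0 0 1 0" by (simp add: vv_eq_pmat mat_option_eq_iff)
  then show "y \<in> ImH \<Longrightarrow> embed1 l s y \<in> mm l" "Y \<in> W l \<Longrightarrow> embed2 l s Y \<in> mm l" "vv l \<in> mm l"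
    unfolding embed1_def embed2_def mm_eq using 0 by auto
qed

lemma embed_linear:
  "embed1 l s (x + y) = embed1 l s x + embed1 l s y" "embed1 l s (c *\<^sub>R x) = c *\<^sub>R embed1 l s x"
  "embed2 l s (X + Y) = embed2 l s X + embed2 l s Y" "embed2 l s (c *\<^sub>R X) = c *\<^sub>R embed2 l s X"
  by (simp_all add: embed1_def embed2_def mvec_linear)

lemma Ad_embed:
  assumes "norm a = 1" "A \<in> SpW l"
  shows "Ad (hmat l a A) (embed1 l s y) = embed1 l s (a * y * qcnj a)"
    "Y \<in> W l \<Longrightarrow> Ad (hmat l a A) (embed2 l s Y) = embed2 l s (rmul (A *v Y) (qcnj a))"
    "Ad (hmat l a A) (vv l) = vv l"
proof -
  have 0: "0 \<in> W l" "rmul (A *v 0) (qcnj a) = 0" by (simp_all add: W_iff vec_eq_iff)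
  have v: "vv l = mvec l 0 0 1 0" by (simp add: vv_eq_pmat mat_option_eq_iff)
  show "Ad (hmat l a A) (embed1 l s y) = embed1 l s (a * y * qcnj a)"
    "Y \<in> W l \<Longrightarrow> Ad (hmat l a A) (embed2 l s Y) = embed2 l s (rmul (A *v Y) (qcnj a))"
    "Ad (hmat l a A) (vv l) = vv l"
    using 0 assms(1) unfolding embed1_def embed2_def v by (simp_all add: Ad_mvec[OF assms])
qed

lemma mm_expand:
  assumes "M \<in> mm l"
  shows "M = qre (px l M) *\<^sub>R vv l + (embed1 l 1 (ny l M) + (embed1 l 2 (px l M - qre (px l M) *\<^sub>R 1)
    + (embed2 l 1 (nY l M) + embed2 l 2 (pX l M))))"
proof -
  have v: "vv l = mvec l 0 0 1 0" by (simp add: vv_eq_pmat mat_option_eq_iff)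
  have "mpart l M = qre (px l M) *\<^sub>R vv l + (embed1 l 1 (ny l M) + (embed1 l 2 (px l M - qre (px l M) *\<^sub>R 1)
    + (embed2 l 1 (nY l M) + embed2 l 2 (pX l M))))"
    unfolding embed1_def embed2_def v mpart_def by (simp add: mvec_linear)
  then show ?thesis by (simp only: mpart_id[OF assms])
qed

text \<open>
  Schur's lemma for the module \<open>m\<close>, by means of explicit group elements: \<open>-1\<close> on \<open>W\<close> separates
  \<open>\<bbbH>\<^sup>n\<^sup>-\<^sup>1 \<otimes> \<real>\<^sup>2\<close> from the rest, and the unit quaternions \<open>i, j\<close> separate \<open>sp\<^sub>1 \<otimes> \<real>\<^sup>2\<close> from \<open>\<real>v\<close>; within
  the two tensor products the form is given by invariant forms on \<open>sp\<^sub>1\<close> and \<open>\<bbbH>\<^sup>n\<^sup>-\<^sup>1\<close>.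
\<close>

lemma invariant_form_classification:
  fixes l :: "'n::finite"
  assumes B: "sym_bilinear_on (mm l) B"
    and inv: "\<And>A M N. A \<in> Kv l \<Longrightarrow> M \<in> mm l \<Longrightarrow> N \<in> mm l \<Longrightarrow> B (Ad A M) (Ad A N) = B M N"
  obtains c h1 h2 where "sym_bilinear_on UNIV h1" "sym_bilinear_on UNIV h2"
    "is_form l c (\<bullet>) h1 (\<bullet>) h2 B"
proof -
  have bl: "bilinear_on (mm l) B"
    by (rule sym_bilinear_on_imp_bilinear_on[OF subspace_mm B])
  have sym: "B M N = B N M" if "M \<in> mm l" "N \<in> mm l" for M N
    using B that by (simp add: sym_bilinear_on_def)
  note cl = embed_mm subspace_add[OF subspace_mm] subspace_scale[OF subspace_mm]
  have inv': "B (Ad (hmat l a A) M) (Ad (hmat l a A) N) = B M N"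
    if "norm a = 1" "A \<in> SpW l" "M \<in> mm l" "N \<in> mm l" for a A M N
    using inv that unfolding Kv_coordinates by blast
  have one: "mat 1 \<in> SpW l" by (simp add: SpW_def Spn_def)
  \<comment> \<open>The group element that is \<open>-1\<close> on \<open>W\<close> and trivial on \<open>\<bbbH>e\<^sub>0 + \<bbbH>e\<^sub>1\<close>.\<close>
  define D :: "'n qmat" where "D = diagm (\<lambda>i. if i = l then 1 else -1)"
  have D: "D \<in> SpW l" unfolding D_def by (rule diagm_SpW) auto
  have "D *v Y = - Y" if "Y \<in> W l" for Y
    using that by (auto simp: D_def vec_eq_iff W_iff)
  moreover have "rmul Y 1 = Y" for Y :: "quat ^ 'n" by (simp add: vec_eq_iff)
  ultimately have AdD: "Ad (hmat l 1 D) (embed2 l s Y) = - embed2 l s Y" if "Y \<in> W l" for s Y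
    using that Ad_embed(2)[OF norm_one_quat D that, of s] embed_linear(4)[of l s "-1" Y]
    by (simp add: rmul_minus)
  have cross1: "B (embed1 l s y) (embed2 l t Y) = 0" if "y \<in> ImH" "Y \<in> W l" for s y t Y
    using inv'[OF norm_one_quat D cl(1,2), OF that, of s t] that
    by (simp add: AdD Ad_embed(1)[OF norm_one_quat D] bilinear_on_minus[OF bl] cl)
  have cross2: "B (vv l) (embed2 l t Y) = 0" if "Y \<in> W l" for t Y
    using inv'[OF norm_one_quat D cl(3,2), OF that, of t] that
    by (simp add: AdD Ad_embed(3)[OF norm_one_quat D] bilinear_on_minus[OF bl] cl)
  have cross3: "B (vv l) (embed1 l s y) = 0" if "y \<in> ImH" for s y
  proof -
    have neg: "embed1 l s (- y) = - embed1 l s y" for y using embed_linear(2)[of l s "-1" y] by simp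
    have i: "B (vv l) (embed1 l s (a * y * qcnj a)) = B (vv l) (embed1 l s y)"
      if "norm a = 1" "y \<in> ImH" for a y
      using inv'[OF that(1) one cl(3,1), OF that(2), of s] by (simp add: Ad_embed[OF that(1) one])
    have "B (vv l) (embed1 l s qI) = 0" "B (vv l) (embed1 l s qJ) = 0" "B (vv l) (embed1 l s qK) = 0"
      using i[OF unit_quats(2), of qI] i[OF unit_quats(1), of qJ] i[OF unit_quats(1), of qK]
      by (simp_all add: neg bilinear_on_minus[OF bl] cl)
    moreover have "y = qi y *\<^sub>R qI + (qj y *\<^sub>R qJ + qk y *\<^sub>R qK)"
      using that by (simp add: quat_eq_iff ImH_def)
    then have "embed1 l s y = qi y *\<^sub>R embed1 l s qI + (qj y *\<^sub>R embed1 l s qJ + qk y *\<^sub>R embed1 l s qK)"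
      by (metis embed_linear(1,2))
    ultimately show ?thesis
      by (simp add: bilinear_onD[OF bl] bilinear_on_scaleR[OF bl] cl)
  qed
  have f1: "B (embed1 l s x) (embed1 l t y) = B (embed1 l s qI) (embed1 l t qI) * (x \<bullet> y)"
    if "x \<in> ImH" "y \<in> ImH" for s t x y
  proof (rule Ad_invariant_form_ImH[OF _ _ that])
    show "bilinear_on ImH (\<lambda>x y. B (embed1 l s x) (embed1 l t y))"
      unfolding bilinear_on_def by (simp add: embed_linear bilinear_onD[OF bl] bilinear_on_scaleR[OF bl]
          cl)
    show "B (embed1 l s (a * x * qcnj a)) (embed1 l t (a * y * qcnj a)) = B (embed1 l s x) (embed1 l t y)"
      if "norm a = 1" "x \<in> ImH" "y \<in> ImH" for a x y
      using inv'[OF that(1) one cl(1,1), OF that(2,3), of s t] by (simp add: Ad_embed[OF that(1) one])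
  qed
  have "\<exists>k. k 2 1 = k 1 2 \<and> (\<forall>s t. \<forall>X\<in>W l. \<forall>Y\<in>W l. B (embed2 l s X) (embed2 l t Y) = k s t * (X \<bullet> Y))"
  proof (cases "\<exists>m. m \<noteq> l")
    case True
    then obtain m where m: "m \<noteq> l" by blast
    let ?k = "\<lambda>s t. B (embed2 l s (axis m 1)) (embed2 l t (axis m 1))"
    have "B (embed2 l s X) (embed2 l t Y) = ?k s t * (X \<bullet> Y)"
      if "X \<in> W l" "Y \<in> W l" for s t X Y
    proof (rule Ad_invariant_form_W[OF _ _ m that])
      show "bilinear_on (W l) (\<lambda>X Y. B (embed2 l s X) (embed2 l t Y))"
        unfolding bilinear_on_def by (simp add: embed_linear bilinear_onD[OF bl]
            bilinear_on_scaleR[OF bl] cl)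
      show "B (embed2 l s (rmul (A *v X) (qcnj a))) (embed2 l t (rmul (A *v Y) (qcnj a)))
          = B (embed2 l s X) (embed2 l t Y)"
        if "norm a = 1" "A \<in> SpW l" "X \<in> W l" "Y \<in> W l" for a A X Y
        using inv'[OF that(1,2) cl(2,2), OF that(3,4), of s t] that by (simp add: Ad_embed[OF that(1,2)])
    qed
    moreover have "?k 2 1 = ?k 1 2" by (rule sym[OF cl(2) cl(2), OF axis_W[OF m] axis_W[OF m]])
    ultimately show ?thesis by (intro exI[of _ ?k]) blast
  next
    case False
    have "B (embed2 l s X) (embed2 l t Y) = 0" if "X \<in> W l" "Y \<in> W l" for s t X Y
    proof -
      have "X = 0" using False that by (auto simp: W_iff vec_eq_iff)
      then have "embed2 l s X = 0" using embed_linear(4)[of l s 0 X] by simp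
      then show ?thesis using bilinear_on_scaleR(1)[OF bl cl(2) cl(2), OF that(2) that(2), of 0 t t]
          by simp
    qed
    then show ?thesis by (intro exI[of _ "\<lambda>s t. 0"]) simp
  qed
  then obtain k2 where k2s: "k2 2 1 = k2 1 2"
    and f2: "\<And>s t X Y. X \<in> W l \<Longrightarrow> Y \<in> W l \<Longrightarrow> B (embed2 l s X) (embed2 l t Y) = k2 s t * (X \<bullet> Y)"
    by blast
  define k1 where "k1 s t = B (embed1 l s qI) (embed1 l t qI)" for s t
  have k1s: "k1 2 1 = k1 1 2" unfolding k1_def by (rule sym) (simp_all add: cl)
  \<comment> \<open>The symmetric form on \<open>\<real>\<^sup>2\<close> with matrix \<open>k\<close>; the entry \<open>k 2 1\<close> equals \<open>k 1 2\<close> for both of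
    \<open>k1\<close>, \<open>k2\<close>.\<close>
  define h where "h k x y = (x $ 1 * y $ 1 * k 1 1 + (x $ 1 * y $ 2 + x $ 2 * y $ 1) * k 1 2 + x $ 2 * y $ 2 * k 2 2)"
    for k :: "2 \<Rightarrow> 2 \<Rightarrow> real" and x y :: "real ^ 2"
  have hs: "sym_bilinear_on UNIV (h k)" for k
    by (simp add: sym_bilinear_on_def h_def algebra_simps)
  have hax: "h k ax1 ax1 = k 1 1" "h k ax1 ax2 = k 1 2" "h k ax2 ax1 = k 1 2" "h k ax2 ax2 = k 2 2" for k
    by (simp_all add: h_def axis_def)
  have "B M N = formB l (- B (vv l) (vv l)) (\<bullet>) (h k1) (\<bullet>) (h k2) M N" if M: "M \<in> mm l" and N: "N \<in> mm l"
      for M N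
  proof -
    have mem: "ny l M \<in> ImH" "ny l N \<in> ImH" "px l M - qre (px l M) *\<^sub>R 1 \<in> ImH"
        "px l N - qre (px l N) *\<^sub>R 1 \<in> ImH"
      using M N mm_subset_lie ny_lie by (auto simp: ImH_def)
    define r r' where r: "r = qre (px l M)" "r' = qre (px l N)"
    define x y X Y where xy: "x = px l M - r *\<^sub>R 1" "y = ny l M" "X = pX l M" "Y = nY l M"
    define x' y' X' Y' where xy': "x' = px l N - r' *\<^sub>R 1" "y' = ny l N" "X' = pX l N" "Y' = nY l N"
    have in': "x \<in> ImH" "y \<in> ImH" "X \<in> W l" "Y \<in> W l" "x' \<in> ImH" "y' \<in> ImH" "X' \<in> W l" "Y' \<in> W l"
      using mem by (simp_all add: r xy xy')
    have M': "M = r *\<^sub>R vv l + (embed1 l 1 y + (embed1 l 2 x + (embed2 l 1 Y + embed2 l 2 X)))"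
      unfolding xy r by (rule mm_expand[OF M])
    have N': "N = r' *\<^sub>R vv l + (embed1 l 1 y' + (embed1 l 2 x' + (embed2 l 1 Y' + embed2 l 2 X')))"
      unfolding xy' r by (rule mm_expand[OF N])
    have c': "B (embed2 l t Z) (embed1 l s z) = 0" "B (embed2 l t Z) (vv l) = 0"
        "B (embed1 l s z) (vv l) = 0"
      if "z \<in> ImH" "Z \<in> W l" for s t z Z
      using cross1[OF that] cross2[OF that(2)] cross3[OF that(1)] sym cl that by metis+
    have "B M N = r * r' * B (vv l) (vv l)
      + (k1 1 1 * (y \<bullet> y') + k1 1 2 * (y \<bullet> x') + (k1 2 1 * (x \<bullet> y') + k1 2 2 * (x \<bullet> x')))
      + (k2 1 1 * (Y \<bullet> Y') + k2 1 2 * (Y \<bullet> X') + (k2 2 1 * (X \<bullet> Y') + k2 2 2 * (X \<bullet> X')))"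
      unfolding M' N'
      by (simp add: bilinear_onD[OF bl] bilinear_on_scaleR[OF bl] cl in' cross1 cross2 cross3
          c'[OF in'(1) in'(3)]
          c'[OF in'(1) in'(4)] c'[OF in'(2) in'(3)] c'[OF in'(2) in'(4)]
          c'[OF in'(5) in'(3)] c'[OF in'(5) in'(4)] c'[OF in'(6) in'(3)] c'[OF in'(6) in'(4)]
              f1[folded k1_def] f2 algebra_simps)
    then show ?thesis
      unfolding formB_def tensor_form_2 of_mm_nth hax r[symmetric] xy[symmetric] xy'[symmetric]
      by (simp add: k1s k2s algebra_simps)
  qed
  then show ?thesis using that[OF hs hs] unfolding is_form_iff by blast
qed

section \<open>Invariant metrics on homogeneous manifolds of the group\<close>

lemma Sp1n_inverse:
  assumes "A \<in> Sp1n"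
  shows "matrix_inv A ** A = mat 1" "A ** matrix_inv A = mat 1" "matrix_inv A \<in> Sp1n"
  using assms unitary_matrix_inv[OF involution_JJ, of A "{}"] unitary_inv[OF involution_JJ, of A "{}"]
  by (simp_all add: Sp1n_eq)

lemma Sp1n_mult: "A \<in> Sp1n \<Longrightarrow> B \<in> Sp1n \<Longrightarrow> A ** B \<in> Sp1n"
  by (simp add: Sp1n_eq unitary_mult)

lemma Sp1n_one: "mat 1 \<in> Sp1n"
  by (simp add: Sp1n_eq unitary_one)

lemma Sp1n_cancel:
  assumes "A \<in> Sp1n"
  shows "A ** (matrix_inv A ** X) = X" "matrix_inv A ** (A ** X) = X"
    "X ** A ** matrix_inv A = X" "X ** matrix_inv A ** A = X"
  using Sp1n_inverse[OF assms] by (metis matrix_mul_assoc matrix_mul_lid matrix_mul_rid)+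

lemma subgroupD:
  assumes "is_subgroup Sp1n H" and "A \<in> H"
  shows "A \<in> Sp1n" "matrix_inv A \<in> H" "B \<in> H \<Longrightarrow> A ** B \<in> H" "mat 1 \<in> H"
  using assms by (auto simp: is_subgroup_def)

lemma subgroup_translate:
  assumes H: "is_subgroup Sp1n H" and A: "A \<in> H"
  shows "(**) A ` H = H"
proof (intro equalityI subsetI)
  fix X assume X: "X \<in> H"
  have "X = A ** (matrix_inv A ** X)" using Sp1n_cancel[OF subgroupD(1)[OF H A]] by simp
  then show "X \<in> (**) A ` H"
    using subgroupD(3)[OF H subgroupD(2)[OF H A] X] by blast
qed (use subgroupD(3)[OF H A] in blast)

lemma Sp1n_is_subgroup: "is_subgroup Sp1n Sp1n"
  by (auto simp: is_subgroup_def Sp1n_one Sp1n_mult Sp1n_inverse)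

lemma tangent_coset:
  assumes "g \<in> Sp1n"
  shows "tangent_at ((**) g ` H) g = (**) g ` lie H"
  using tangent_at_left_translate[OF Sp1n_inverse(2)[OF assms], of H "mat 1"]
  by (simp add: lie_def)

lemma tangent_subgroup:
  assumes "is_subgroup Sp1n H" "h \<in> H"
  shows "tangent_at H h = (**) h ` lie H"
  using tangent_coset[OF subgroupD(1)[OF assms], of H] subgroup_translate[OF assms] by simp

lemma tangent_Sp1n: "g \<in> Sp1n \<Longrightarrow> tangent_at Sp1n g = (**) g ` lie Sp1n"
  by (rule tangent_subgroup[OF Sp1n_is_subgroup])

lemma tangent_subgroup_left:
  assumes H: "is_subgroup Sp1n H" and "A \<in> H" "h \<in> H" "k \<in> tangent_at H h"
  shows "A ** k \<in> tangent_at H (A ** h)"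
  using tangent_at_left_translate[OF Sp1n_inverse(2)[OF subgroupD(1)[OF assms(1,2)]], of H h]
    subgroup_translate[OF H assms(2)] assms(4) by auto

text \<open>
  \<open>TH\<close> acts on \<open>TG\<close> from the right, and \<open>(g A, U A)\<close> is the image of \<open>(g, U)\<close> under the element
  \<open>(A, 0)\<close> of \<open>TH\<close>; so both represent the same tangent vector of \<open>G/H\<close>.
\<close>

lemma dproj_right:
  assumes H: "is_subgroup Sp1n H" and A: "A \<in> H"
  shows "dproj H (g ** A) (U ** A) = dproj H g U"
proof -
  have sub: "dproj H (g ** A) (U ** A) \<subseteq> dproj H g U" if A: "A \<in> H" for g A U
  proof
    fix x assume "x \<in> dproj H (g ** A) (U ** A)"
    then obtain h k where x: "x = (g ** A ** h, U ** A ** h + g ** A ** k)"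
        and h: "h \<in> H" "k \<in> tangent_at H h"
      unfolding dproj_def by blast
    have "A ** h \<in> H" "A ** k \<in> tangent_at H (A ** h)"
      using subgroupD(3)[OF H A h(1)] tangent_subgroup_left[OF H A h] by auto
    moreover have "x = (g ** (A ** h), U ** (A ** h) + g ** (A ** k))"
      by (simp add: x matrix_mul_assoc)
    ultimately show "x \<in> dproj H g U" unfolding dproj_def by blast
  qed
  have "dproj H (g ** A ** matrix_inv A) (U ** A ** matrix_inv A) \<subseteq> dproj H (g ** A) (U ** A)"
    by (rule sub[OF subgroupD(2)[OF H A]])
  then show ?thesis using sub[OF A] Sp1n_cancel[OF subgroupD(1)[OF H A]] by auto
qed

lemma metric_at_identity:
  assumes "invariant_lorentzian_metric Sp1n H q"
  shows "lorentzian_mod (lie Sp1n) (lie H) (\<lambda>U U'. q (dproj H (mat 1) U) (dproj H (mat 1) U'))"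
proof -
  have "(**) (mat 1) ` H = H" by simp
  then show ?thesis
    using assms Sp1n_one unfolding invariant_lorentzian_metric_def lie_def by metis
qed

lemma metric_translate:
  assumes q: "invariant_lorentzian_metric Sp1n H q" and g: "g \<in> Sp1n"
      and U: "U \<in> lie Sp1n" "U' \<in> lie Sp1n"
  shows "q (dproj H g (g ** U)) (dproj H g (g ** U')) = q (dproj H (mat 1) U) (dproj H (mat 1) U')"
proof -
  have "U \<in> tangent_at Sp1n (mat 1)" "U' \<in> tangent_at Sp1n (mat 1)" using U by (simp_all add: lie_def)
  then have "q (dproj H (g ** mat 1) (g ** U)) (dproj H (g ** mat 1) (g ** U')) = q (dproj H (mat 1) U) (dproj H (mat 1) U')"
    using q g Sp1n_one unfolding invariant_lorentzian_metric_def by blast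
  then show ?thesis by simp
qed

text \<open>
  For \<open>A\<close> in the isotropy group, \<open>(1, Ad A U)\<close> and \<open>(A, A U)\<close> represent the same tangent vector,
  and the latter is the left translate of \<open>(1, U)\<close> by \<open>A\<close>.
\<close>

lemma metric_Ad:
  assumes q: "invariant_lorentzian_metric Sp1n H q" and H: "is_subgroup Sp1n H" and A: "A \<in> H"
    and U: "U \<in> lie Sp1n" "U' \<in> lie Sp1n"
  shows "q (dproj H (mat 1) (Ad A U)) (dproj H (mat 1) (Ad A U')) = q (dproj H (mat 1) U) (dproj H (mat 1) U')"
proof -
  have "dproj H (mat 1) (Ad A U) = dproj H A (A ** U)" for U
    using dproj_right[OF H A, of "mat 1" "Ad A U"] Sp1n_cancel[OF subgroupD(1)[OF H A]]
    by (simp add: Ad_def)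
  then show ?thesis using metric_translate[OF q subgroupD(1)[OF H A] U] by simp
qed

lemma lorentzian_mod_transport:
  assumes L: "lorentzian_mod T N B" and T': "subspace T'" "N' \<subseteq> T'"
    and \<phi>: "\<And>x. x \<in> T' \<Longrightarrow> \<phi> x \<in> T" "\<And>x y. \<phi> (x + y) = \<phi> x + \<phi> y" "\<And>c x. \<phi> (c *\<^sub>R x) = c *\<^sub>R \<phi> x"
      "\<And>x. x \<in> T' \<Longrightarrow> \<phi> x \<in> N \<longleftrightarrow> x \<in> N'"
    and \<psi>: "\<And>t. t \<in> T \<Longrightarrow> \<psi> t \<in> T'" "\<And>t. t \<in> T \<Longrightarrow> \<phi> (\<psi> t) = t"
    and B': "\<And>x y. x \<in> T' \<Longrightarrow> y \<in> T' \<Longrightarrow> B' x y = B (\<phi> x) (\<phi> y)"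
  shows "lorentzian_mod T' N' B'"
proof -
  have "sym_bilinear_on T' B'"
    using L \<phi>(1) subspace_add[OF T'(1)] subspace_scale[OF T'(1)]
    unfolding lorentzian_mod_def sym_bilinear_on_def by (simp add: B' \<phi>(2,3))
  moreover have "B' x y = 0" if "x \<in> T'" "y \<in> N'" for x y
  proof -
    have y: "y \<in> T'" using that T'(2) by blast
    then have "\<phi> y \<in> N" using \<phi>(4) that by blast
    then have "B (\<phi> x) (\<phi> y) = 0" using L \<phi>(1)[OF that(1)] unfolding lorentzian_mod_def by blast
    then show ?thesis using B'[OF that(1) y] by simp
  qed
  moreover obtain t where t: "t \<in> T" "B t t < 0" "\<And>x. x \<in> T \<Longrightarrow> B t x = 0 \<Longrightarrow> x \<notin> N \<Longrightarrow> B x x > 0"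
    using L unfolding lorentzian_mod_def by blast
  have "\<psi> t \<in> T'" "B' (\<psi> t) (\<psi> t) < 0" using t \<psi> B' by simp_all
  moreover have "B' x x > 0" if "x \<in> T'" "B' (\<psi> t) x = 0" "x \<notin> N'" for x
    using t(3)[of "\<phi> x"] that \<phi> \<psi> t(1) B' by simp
  ultimately show ?thesis unfolding lorentzian_mod_def by blast
qed

subsection \<open>The metric defined by a scalar product\<close>

lemma coordinates_hh:
  assumes "M \<in> hh l"
  shows "ny l M = 0" "nY l M = 0" "px l M = 0" "pX l M = 0"
  using assms by (auto simp: hh_def ny_def nY_def px_def pX_def vec_eq_iff)

text \<open>
  Pulled back to the Lie algebra, the scalar product \<open>- c v\<^sup>* \<otimes> v\<^sup>* + g\<^sub>1 \<otimes> h\<^sub>1 + g\<^sub>2 \<otimes> h\<^sub>2\<close> has the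
  timelike vector \<open>v\<close>, whose orthogonal complement is positive definite modulo \<open>h\<close>.
\<close>

lemma formB_lorentzian:
  assumes c: "c > 0" and h1: "euclidean_on UNIV h1" and h2: "euclidean_on UNIV h2"
  shows "lorentzian_mod (lie Sp1n) (hh l) (formB l c (\<bullet>) h1 (\<bullet>) h2)"
proof -
  let ?B = "formB l c (\<bullet>) h1 (\<bullet>) h2"
  have s: "sym_bilinear_on UNIV h1" "sym_bilinear_on UNIV h2" using h1 h2
      by (simp_all add: euclidean_on_def)
  have v: "vv l = mvec l 0 0 1 0" by (simp add: vv_eq_pmat mat_option_eq_iff)
  have Wz: "0 \<in> W l" by (simp add: W_iff)
  have Bv: "?B (vv l) x = - c * qre (px l x)" for x
    unfolding formB_def tensor_form_2 of_mm_nth v by (simp add: Wz)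
  have "?B x y = 0" if "y \<in> hh l" for x y
  proof -
    show ?thesis unfolding formB_def tensor_form_2 of_mm_nth by (simp add: coordinates_hh[OF that])
  qed
  moreover have "vv l \<in> lie Sp1n" using embed_mm(3) mm_subset_lie by blast
  moreover have "?B (vv l) (vv l) < 0" unfolding Bv using c by (simp add: v)
  moreover have "?B x x > 0" if x: "x \<in> lie Sp1n" "?B (vv l) x = 0" "x \<notin> hh l" for x
  proof -
    have r: "qre (px l x) = 0" using x(2) c unfolding Bv by simp
    have "\<not> (fst (snd (of_mm l x)) = 0 \<and> snd (snd (of_mm l x)) = 0)"
    proof
      assume 0: "fst (snd (of_mm l x)) = 0 \<and> snd (snd (of_mm l x)) = 0"
      have "ny l x = 0" "px l x = 0" "nY l x = 0" "pX l x = 0"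
        using 0 r of_mm_nth(2-5)[of l x] by simp_all
      then have "mpart l x = 0" by (simp add: mpart_def mat_option_eq_iff)
      then show False using x mpart_eq_0_iff by blast
    qed
    then have "tensor_form (\<bullet>) h1 (fst (snd (of_mm l x))) (fst (snd (of_mm l x))) > 0
        \<or> tensor_form (\<bullet>) h2 (snd (snd (of_mm l x))) (snd (snd (of_mm l x))) > 0"
      using tensor_form_inner_pos[OF h1] tensor_form_inner_pos[OF h2] by blast
    then show ?thesis
      unfolding formB_def of_mm_nth(1) r
      using tensor_form_inner_nonneg[OF h1, of "fst (snd (of_mm l x))"]
          tensor_form_inner_nonneg[OF h2, of "snd (snd (of_mm l x))"]
      by (elim disjE) linarith+
  qed
  ultimately show ?thesis
    unfolding lorentzian_mod_def using formB_sym_bilinear[OF s] by blast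
qed

lemma formB_Ad_lie:
  assumes A: "A \<in> Kv l" and M: "M \<in> lie Sp1n" and N: "N \<in> lie Sp1n"
  shows "formB l c (\<bullet>) h1 (\<bullet>) h2 (Ad A M) (Ad A N) = formB l c (\<bullet>) h1 (\<bullet>) h2 M N"
  using formB_Ad[OF A mpart_mm[OF M] mpart_mm[OF N], of c h1 h2]
  by (simp add: mpart_Ad[OF A M, symmetric] mpart_Ad[OF A N, symmetric] formB_mpart)

text \<open>
  The field of scalar products obtained from \<open>B\<close> by left translation. It is well defined, as a
  different representative \<open>(g h, U h + g k)\<close> of the class of \<open>(g, U)\<close> replaces \<open>g\<^sup>-\<^sup>1 U\<close> by
  \<open>Ad (h\<^sup>-\<^sup>1) (g\<^sup>-\<^sup>1 U) + h\<^sup>-\<^sup>1 k\<close>, where \<open>h\<^sup>-\<^sup>1 k\<close> is in the Lie algebra of \<open>H\<close>.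
\<close>

definition left_field :: "('n::finite qmat1 \<Rightarrow> 'n qmat1 \<Rightarrow> real)
    \<Rightarrow> ('n qmat1 \<times> 'n qmat1) set \<Rightarrow> ('n qmat1 \<times> 'n qmat1) set \<Rightarrow> real" where
  "left_field B S S' = (SOME r. \<exists>g U U'. (g, U) \<in> S \<and> (g, U') \<in> S' \<and>
     r = B (matrix_inv g ** U) (matrix_inv g ** U'))"

lemma left_field_dproj:
  fixes B :: "'n::finite qmat1 \<Rightarrow> 'n qmat1 \<Rightarrow> real"
  assumes H: "is_subgroup Sp1n H" and L: "lie H \<subseteq> lie Sp1n"
    and Bs: "sym_bilinear_on (lie Sp1n) B"
    and rad: "\<And>x y. x \<in> lie Sp1n \<Longrightarrow> y \<in> lie H \<Longrightarrow> B x y = 0"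
    and inv: "\<And>A x y. A \<in> H \<Longrightarrow> x \<in> lie Sp1n \<Longrightarrow> y \<in> lie Sp1n \<Longrightarrow> B (Ad A x) (Ad A y) = B x y"
    and zero: "0 \<in> lie H"
    and g: "g \<in> Sp1n" and U: "U \<in> lie Sp1n" "U' \<in> lie Sp1n"
  shows "left_field B (dproj H g (g ** U)) (dproj H g (g ** U')) = B U U'"
proof -
  have bl: "bilinear_on (lie Sp1n) B"
    by (rule sym_bilinear_on_imp_bilinear_on[OF subspace_lie_Sp1n Bs])
  have sym: "B x y = B y x" if "x \<in> lie Sp1n" "y \<in> lie Sp1n" for x y
    using Bs that by (simp add: sym_bilinear_on_def)
  have rep: "\<exists>h\<in>H. \<exists>y\<in>lie H. g' = g ** h \<and> matrix_inv g' ** V' = Ad (matrix_inv h) V + y"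
    if V: "(g', V') \<in> dproj H g (g ** V)" for g' V' V
  proof -
    obtain h k where h: "h \<in> H" "k \<in> tangent_at H h" and eq: "g' = g ** h" "V' = g ** V ** h + g ** k"
      using V unfolding dproj_def by blast
    obtain y where y: "y \<in> lie H" "k = h ** y" using h tangent_subgroup[OF H h(1)] by blast
    have hS: "h \<in> Sp1n" by (rule subgroupD(1)[OF H h(1)])
    have "V' = g' ** (matrix_inv h ** V ** h + y)"
      by (simp add: eq y mmul_linear matrix_mul_assoc[symmetric] Sp1n_cancel[OF hS])
    then have "matrix_inv g' ** V' = matrix_inv h ** V ** h + y"
      using Sp1n_cancel(2)[OF Sp1n_mult[OF g hS]] eq(1) by simp
    moreover have "matrix_inv (matrix_inv h) = h" by (rule matrix_inv_eqI) (rule Sp1n_inverse(1)[OF hS])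
    ultimately show ?thesis using h(1) y(1) eq(1) by (auto simp: Ad_def)
  qed
  have val: "B (matrix_inv g' ** V) (matrix_inv g' ** V') = B U U'"
    if V: "(g', V) \<in> dproj H g (g ** U)" and V': "(g', V') \<in> dproj H g (g ** U')" for g' V V'
  proof -
    obtain h y where h: "h \<in> H" "y \<in> lie H" "g' = g ** h" "matrix_inv g' ** V = Ad (matrix_inv h) U + y"
      using rep[OF V] by blast
    obtain h' y' where h': "h' \<in> H" "y' \<in> lie H" "g' = g ** h'"
        "matrix_inv g' ** V' = Ad (matrix_inv h') U' + y'"
      using rep[OF V'] by blast
    have "h = h'" using h(3) h'(3) Sp1n_cancel(2)[OF g] by metis
    let ?A = "matrix_inv h"
    have A: "?A \<in> H" "?A \<in> Sp1n" using subgroupD[OF H] h(1) by blast+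
    have m: "Ad ?A U \<in> lie Sp1n" "Ad ?A U' \<in> lie Sp1n" "y \<in> lie Sp1n" "y' \<in> lie Sp1n"
      using Ad_lie_Sp1n[OF A(2)] U L h(2) h'(2) by auto
    have "B (Ad ?A U + y) (Ad ?A U' + y') = B (Ad ?A U) (Ad ?A U')"
      using rad[OF m(1) h'(2)] rad[OF m(2) h(2)] rad[OF m(3) h'(2)] sym[OF m(3) m(2)]
      by (simp add: bilinear_onD[OF bl] m subspace_add[OF subspace_lie_Sp1n])
    also have "\<dots> = B U U'" by (rule inv[OF A(1) U])
    finally show ?thesis using h(4) h'(4) \<open>h = h'\<close> by simp
  qed
  have ex: "(g, g ** V) \<in> dproj H g (g ** V)" for V
  proof -
    have one: "mat 1 \<in> H" using H by (simp add: is_subgroup_def)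
    have "(0 :: 'n qmat1) \<in> tangent_at H (mat 1)" using zero by (simp add: lie_def)
    moreover have "(g, g ** V) = (g ** mat 1, g ** V ** mat 1 + g ** 0)" by simp
    ultimately show ?thesis using one unfolding dproj_def by blast
  qed
  show ?thesis
    unfolding left_field_def
  proof (rule some_equality)
    show "\<exists>g' V V'. (g', V) \<in> dproj H g (g ** U) \<and> (g', V') \<in> dproj H g (g ** U') \<and>
       B U U' = B (matrix_inv g' ** V) (matrix_inv g' ** V')"
      using ex[of U] ex[of U'] val by metis
  qed (use val in blast)
qed

lemma left_field_invariant:
  fixes B :: "'n::finite qmat1 \<Rightarrow> 'n qmat1 \<Rightarrow> real"
  assumes H: "is_subgroup Sp1n H" and L: "lie H \<subseteq> lie Sp1n" and zero: "0 \<in> lie H"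
    and B: "lorentzian_mod (lie Sp1n) (lie H) B"
    and inv: "\<And>A x y. A \<in> H \<Longrightarrow> x \<in> lie Sp1n \<Longrightarrow> y \<in> lie Sp1n \<Longrightarrow> B (Ad A x) (Ad A y) = B x y"
  shows "invariant_lorentzian_metric Sp1n H (left_field B)"
proof -
  have Bs: "sym_bilinear_on (lie Sp1n) B" and rad: "\<And>x y. x \<in> lie Sp1n \<Longrightarrow> y \<in> lie H \<Longrightarrow> B x y = 0"
    using B by (auto simp: lorentzian_mod_def)
  have lf: "left_field B (dproj H g (g ** U)) (dproj H g (g ** U')) = B U U'"
    if "g \<in> Sp1n" "U \<in> lie Sp1n" "U' \<in> lie Sp1n" for g U U'
    by (rule left_field_dproj[OF H L Bs _ _ zero that]) (use rad inv in auto)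
  have lor: "lorentzian_mod (tangent_at Sp1n g) (tangent_at ((**) g ` H) g)
      (\<lambda>U U'. left_field B (dproj H g U) (dproj H g U'))" if g: "g \<in> Sp1n" for g
  proof -
    note inj = Sp1n_cancel[OF g]
    show ?thesis
      unfolding tangent_Sp1n[OF g] tangent_coset[OF g]
    proof (rule lorentzian_mod_transport[OF B, where \<phi> = "(**) (matrix_inv g)" and \<psi> = "(**) g"])
      show "subspace ((**) g ` lie Sp1n)"
        by (rule subspace_linear_image[OF subspace_lie_Sp1n]) (simp_all add: mmul_linear)
      show "matrix_inv g ** x \<in> lie H \<longleftrightarrow> x \<in> (**) g ` lie H" if "x \<in> (**) g ` lie Sp1n" for x
      proof
        assume "matrix_inv g ** x \<in> lie H"
        then show "x \<in> (**) g ` lie H" using inj(1)[of x] by (metis imageI)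
      qed (auto simp: inj)
      show "left_field B (dproj H g x) (dproj H g y) = B (matrix_inv g ** x) (matrix_inv g ** y)"
        if "x \<in> (**) g ` lie Sp1n" "y \<in> (**) g ` lie Sp1n" for x y
        using that lf[OF g] by (auto simp: inj)
    qed (use L in \<open>auto simp: inj mmul_linear\<close>)
  qed
  have "left_field B (dproj H (a ** g) (a ** U)) (dproj H (a ** g) (a ** U')) = left_field B (dproj H g U) (dproj H g U')"
    if a: "a \<in> Sp1n" and g: "g \<in> Sp1n" and U: "U \<in> tangent_at Sp1n g" "U' \<in> tangent_at Sp1n g"
        for a g U U'
  proof -
    obtain V V' where V: "V \<in> lie Sp1n" "U = g ** V" "V' \<in> lie Sp1n" "U' = g ** V'"
      using U unfolding tangent_Sp1n[OF g] by blast
    then show ?thesis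
      using lf[OF g V(1,3)] lf[OF Sp1n_mult[OF a g] V(1,3)] by (simp add: matrix_mul_assoc)
  qed
  with lor show ?thesis unfolding invariant_lorentzian_metric_def by blast
qed

lemma norm_le_sum_components: "norm x \<le> (\<Sum>i\<in>UNIV. norm (x $ i))"
    for x :: "'a::real_normed_vector ^ 'm::finite"
  by (simp add: norm_vec_def L2_set_le_sum)

text \<open>
  Elements of \<open>K\<close> preserve the positive definite Hermitian form as well, so their columns have length
  one.
\<close>

lemma compact_Kv: "compact (Kv l)"
proof -
  have "norm (A :: 'a qmat1) \<le> (\<Sum>i\<in>(UNIV :: 'a option set). \<Sum>j\<in>(UNIV :: 'a option set). 1)"
      if A: "A \<in> Kv l" for A
  proof -
    have "adjoint_mat A ** JJ ** A = JJ" "A ** JJ = JJ ** A"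
      using A by (simp_all add: Kv_eq unitary_def)
    then have "adjoint_mat A ** A ** JJ = JJ" by (metis matrix_mul_assoc)
    then have "adjoint_mat A ** A ** (JJ ** JJ) = JJ ** JJ" by (metis matrix_mul_assoc)
    then have AA: "adjoint_mat A ** A = mat 1"
      using involution_JJ[where 'n = 'a] by (simp add: involution_def)
    have entry: "norm (A $ i $ j) \<le> 1" for i j
    proof -
      have "hform (A *v axis j 1) (A *v axis j 1) = hform (axis j 1) (axis j 1)"
        by (simp add: hform_mvmul matrix_vector_mul_assoc AA)
      then have "(norm (A *v axis j 1))\<^sup>2 *\<^sub>R (1::quat) = 1"
        by (simp add: hform_self[symmetric]) (simp add: hform_axis)
      then have "(norm (A *v axis j 1))\<^sup>2 = 1" by (simp add: quat_eq_iff)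
      then have "norm (A *v axis j 1) = 1" using norm_ge_zero power2_eq_1_iff
          by (metis abs_norm_cancel abs_minus abs_one)
      then show ?thesis using Finite_Cartesian_Product.norm_nth_le[of "A *v axis j 1" i]
          mvmul_axis[of A j i] by simp
    qed
    have "norm A \<le> (\<Sum>i\<in>UNIV. norm (A $ i))" by (rule norm_le_sum_components)
    also have "\<dots> \<le> (\<Sum>i\<in>UNIV. \<Sum>j\<in>UNIV. norm (A $ i $ j))"
      by (intro sum_mono norm_le_sum_components)
    also have "\<dots> \<le> (\<Sum>i\<in>(UNIV :: 'a option set). \<Sum>j\<in>(UNIV :: 'a option set). 1)"
      by (intro sum_mono entry)
    finally show ?thesis .
  qed
  then have "bounded (Kv l)" unfolding bounded_iff by blast
  moreover have "closed (Kv l)" unfolding Kv_eq by (rule closed_unitary)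
  ultimately show ?thesis by (simp add: compact_eq_bounded_closed)
qed

lemma Kv_is_subgroup: "is_subgroup Sp1n (Kv l)"
  unfolding Kv_eq Sp1n_eq by (rule unitary_is_subgroup) simp

lemma cc_subgroup_Kv: "cc_subgroup Sp1n (Kv l)"
  by (simp add: cc_subgroup_def Kv_is_subgroup compact_Kv) (simp add: Kv_def)

lemma form_defines_metric:
  assumes c: "c > 0" and h1: "euclidean_on UNIV h1" and h2: "euclidean_on UNIV h2"
    and B: "is_form l c (\<bullet>) h1 (\<bullet>) h2 B"
  shows "\<exists>q. invariant_lorentzian_metric Sp1n (Kv l) q \<and> defined_by Sp1n (Kv l) (mm l) B q"
proof -
  let ?B = "formB l c (\<bullet>) h1 (\<bullet>) h2"
  let ?q = "left_field ?B"
  have L: "lie (Kv l) \<subseteq> lie Sp1n" "0 \<in> lie (Kv l)"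
    by (simp_all add: lie_Kv hh_subset_lie subspace_0[OF subspace_hh])
  have lor: "lorentzian_mod (lie Sp1n) (lie (Kv l)) ?B"
    unfolding lie_Kv by (rule formB_lorentzian[OF c h1 h2])
  have "invariant_lorentzian_metric Sp1n (Kv l) ?q"
    by (rule left_field_invariant[OF Kv_is_subgroup L lor formB_Ad_lie])
  moreover have "?q (dproj (Kv l) g (g ** X)) (dproj (Kv l) g (g ** Y)) = B X Y"
    if "g \<in> Sp1n" "X \<in> mm l" "Y \<in> mm l" for g X Y
  proof -
    have X: "X \<in> lie Sp1n" "Y \<in> lie Sp1n" using that mm_subset_lie by blast+
    have "?q (dproj (Kv l) g (g ** X)) (dproj (Kv l) g (g ** Y)) = ?B X Y"
      by (rule left_field_dproj[OF Kv_is_subgroup L(1) _ _ _ L(2) that(1) X])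
        (use lor formB_Ad_lie in \<open>auto simp: lorentzian_mod_def\<close>)
    then show ?thesis using B that(2,3) unfolding is_form_iff by simp
  qed
  ultimately show ?thesis unfolding defined_by_def by blast
qed

lemma linear_functional_ImH_kernel:
  fixes L :: "quat \<Rightarrow> real"
  assumes "\<And>x y. x \<in> ImH \<Longrightarrow> y \<in> ImH \<Longrightarrow> L (x + y) = L x + L y"
    and "\<And>c x. x \<in> ImH \<Longrightarrow> L (c *\<^sub>R x) = c * L x"
  obtains y where "y \<in> ImH" "y \<noteq> 0" "L y = 0"
proof (cases "L qI = 0")
  case True
  then show ?thesis using that[of qI] by (simp add: quat_eq_iff)
next
  case False
  let ?y = "L qJ *\<^sub>R qI + (- L qI) *\<^sub>R qJ"
  have "?y \<in> ImH" by (simp add: ImH_def)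
  moreover have "?y \<noteq> 0" using False by (simp add: quat_eq_iff)
  moreover have "L ?y = L (L qJ *\<^sub>R qI) + L ((- L qI) *\<^sub>R qJ)"
    by (rule assms(1)) (simp_all add: ImH_def)
  then have "L ?y = 0" by (simp only: assms(2)[OF units_ImH(1)] assms(2)[OF units_ImH(2)]) simp
  ultimately show ?thesis by (rule that)
qed

text \<open>
  A Lorentzian form is positive on the vectors orthogonal to the timelike vector \<open>t\<close>, its kernel \<open>N\<close>
  excepted, and the orthogonal complement of \<open>t\<close> meets every subspace of dimension at least two. So if
  a subspace of dimension three carries a multiple \<open>k\<close> of a Euclidean form, then \<open>k\<close> is positive. This
  will be applied to the subspaces \<open>sp\<^sub>1 \<otimes> a\<close> and \<open>(e\<^sub>m Im \<bbbH>) \<otimes> a\<close> of \<open>m\<close>, where \<open>k\<close> is the value of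
  \<open>h\<^sub>1\<close> or \<open>h\<^sub>2\<close> at \<open>(a, a)\<close>.
\<close>

lemma lorentzian_positive:
  assumes B: "lorentzian_mod T N B" and T: "subspace T"
    and E: "\<And>y. y \<in> ImH \<Longrightarrow> E y \<in> T" "\<And>x y. E (x + y) = E x + E y" "\<And>c x. E (c *\<^sub>R x) = c *\<^sub>R E x"
    and N: "\<And>y. y \<in> ImH \<Longrightarrow> E y \<in> N \<Longrightarrow> y = 0"
    and val: "\<And>y. y \<in> ImH \<Longrightarrow> B (E y) (E y) = (y \<bullet> y) * k"
  shows "k > 0"
proof -
  obtain t where t: "t \<in> T" "\<And>x. x \<in> T \<Longrightarrow> B t x = 0 \<Longrightarrow> x \<notin> N \<Longrightarrow> B x x > 0"
    using B unfolding lorentzian_mod_def by blast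
  have bl: "bilinear_on T B"
    using B T by (intro sym_bilinear_on_imp_bilinear_on) (auto simp: lorentzian_mod_def)
  obtain y where y: "y \<in> ImH" "y \<noteq> 0" "B t (E y) = 0"
  proof (rule linear_functional_ImH_kernel[of "\<lambda>y. B t (E y)"])
    show "B t (E (x + y)) = B t (E x) + B t (E y)" if "x \<in> ImH" "y \<in> ImH" for x y
      by (simp add: E bilinear_onD[OF bl] that t)
    show "B t (E (c *\<^sub>R x)) = c * B t (E x)" if "x \<in> ImH" for c x
      by (simp add: E bilinear_on_scaleR[OF bl] that t)
  qed
  have "B (E y) (E y) > 0" using t(2)[of "E y"] E(1)[OF y(1)] y N by blast
  then have "(y \<bullet> y) * k > 0" by (simp add: val[OF y(1)])
  then show ?thesis using inner_ge_zero[of y] by (simp add: zero_less_mult_iff)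
qed

lemma vec2_eq_0: "a = 0 \<longleftrightarrow> a $ 1 = 0 \<and> a $ 2 = 0" for a :: "real ^ 2"
  by (simp add: vec_eq_iff forall_2)

lemma tensor_form_product:
  assumes "sym_bilinear_on UNIV h" "z $ 1 = (a $ 1) *\<^sub>R u" "z $ 2 = (a $ 2) *\<^sub>R u"
  shows "tensor_form (\<bullet>) h z z = (u \<bullet> u) * h a a"
proof -
  have "h ax2 ax1 = h ax1 ax2" using assms(1) by (simp add: sym_bilinear_on_def)
  then show ?thesis
    unfolding sym_bilinear_R2_expand[OF assms(1), of a a] tensor_form_2 assms(2,3)
    by (simp add: algebra_simps)
qed

text \<open>
  As \<open>h\<^sub>1\<close> and \<open>h\<^sub>2\<close> must be positive definite, a negative value of the form can only come from the
  summand \<open>- c v\<^sup>* \<otimes> v\<^sup>*\<close>. For \<open>n = 1\<close> nothing follows for \<open>h\<^sub>2\<close>, which is multiplied by the zero form; in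
  this case it is replaced by the standard scalar product.
\<close>

lemma lorentzian_form_signs:
  fixes l :: "'n::finite"
  assumes B: "lorentzian_mod (lie Sp1n) (hh l) B"
    and h: "sym_bilinear_on UNIV h1" "sym_bilinear_on UNIV h2"
    and form: "is_form l c (\<bullet>) h1 (\<bullet>) h2 B"
  obtains k2 where "c > 0" "euclidean_on UNIV h1" "euclidean_on UNIV k2"
    "is_form l c (\<bullet>) h1 (\<bullet>) k2 B"
proof -
  have form': "B M N = formB l c (\<bullet>) h1 (\<bullet>) h2 M N" if "M \<in> mm l" "N \<in> mm l" for M N
    using form that by (simp add: is_form_iff)
  have ImH_scale: "c *\<^sub>R y \<in> ImH" if "y \<in> ImH" for c y using that
      by (rule subspace_scale[OF subspace_ImH])
  have Wz: "0 \<in> W l" by (simp add: W_iff)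
  have h1: "euclidean_on UNIV h1"
    unfolding euclidean_on_def
  proof (intro conjI h ballI impI)
    fix a :: "real ^ 2" assume a: "a \<noteq> 0"
    let ?E = "\<lambda>y. mvec l (a $ 1 *\<^sub>R y) 0 (a $ 2 *\<^sub>R y) 0"
    have E: "?E y \<in> mm l" if "y \<in> ImH" for y
      unfolding mm_eq using that ImH_scale Wz by blast
    show "h1 a a > 0"
    proof (rule lorentzian_positive[OF B subspace_lie_Sp1n, of ?E])
      show "?E y \<in> lie Sp1n" if "y \<in> ImH" for y using E[OF that] mm_subset_lie by blast
      show "?E (x + y) = ?E x + ?E y" "?E (c *\<^sub>R x) = c *\<^sub>R ?E x" for x y c
        by (simp_all add: mvec_linear scaleR_add_right mult.commute)
      show "y = 0" if "y \<in> ImH" "?E y \<in> hh l" for y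
        using coordinates_hh(1,3)[OF that(2)] a by (auto simp: vec2_eq_0)
      show "B (?E y) (?E y) = (y \<bullet> y) * h1 a a" if y: "y \<in> ImH" for y
        using y unfolding form'[OF E[OF y] E[OF y]] formB_def
        by (subst tensor_form_product[OF h(1), where a = a and u = y])
          (simp_all add: ImH_def Wz tensor_form_2)
    qed
  qed
  have h2: "euclidean_on UNIV h2" if m: "m \<noteq> l" for m
    unfolding euclidean_on_def
  proof (intro conjI h ballI impI)
    fix a :: "real ^ 2" assume a: "a \<noteq> 0"
    let ?E = "\<lambda>y. mvec l 0 (axis m (a $ 1 *\<^sub>R y)) 0 (axis m (a $ 2 *\<^sub>R y))"
    have E: "?E y \<in> mm l" for y
      unfolding mm_eq using axis_W[OF m] subspace_0[OF subspace_ImH] by blast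
    show "h2 a a > 0"
    proof (rule lorentzian_positive[OF B subspace_lie_Sp1n, of ?E])
      show "?E y \<in> lie Sp1n" for y using E mm_subset_lie by blast
      show "?E (x + y) = ?E x + ?E y" "?E (c *\<^sub>R x) = c *\<^sub>R ?E x" for x y c
        by (simp_all add: mvec_linear scaleR_add_right mult.commute flip: axis_linear(1,2))
      show "y = 0" if y: "y \<in> ImH" "?E y \<in> hh l" for y
        using coordinates_hh(2,4)[OF y(2)] a by (auto simp: vec2_eq_0 axis_W[OF m] axis_eq_0_iff)
      show "B (?E y) (?E y) = (y \<bullet> y) * h2 a a" for y
      proof -
        have "tensor_form (\<bullet>) h2 (snd (snd (of_mm l (?E y)))) (snd (snd (of_mm l (?E y))))
            = (axis m y \<bullet> axis m y) * h2 a a"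
          by (rule tensor_form_product[OF h(2)]) (simp_all add: axis_W[OF m] axis_linear
              subspace_scale[OF subspace_W])
        moreover have "axis m y \<bullet> axis m y = y \<bullet> y" by (simp add: inner_axis_axis)
        moreover have "tensor_form (\<bullet>) h1 (fst (snd (of_mm l (?E y)))) (fst (snd (of_mm l (?E y)))) = 0"
          by (simp add: tensor_form_2)
        ultimately show ?thesis unfolding form'[OF E E] formB_def by simp
      qed
    qed
  qed
  define k2 where "k2 = (if \<exists>m. m \<noteq> l then h2 else (\<bullet>))"
  have k2: "euclidean_on UNIV k2"
    using h2 euclidean_inner by (auto simp: k2_def)
  have Weq: "X = 0" if "\<not> (\<exists>m. m \<noteq> l)" "X \<in> W l" for X
    using that by (auto simp: W_iff vec_eq_iff)
  have eq: "formB l c (\<bullet>) h1 (\<bullet>) k2 M N = formB l c (\<bullet>) h1 (\<bullet>) h2 M N" for M N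
  proof (cases "\<exists>m. m \<noteq> l")
    case False
    have "nY l M = 0" "nY l N = 0" "pX l M = 0" "pX l N = 0"
      using Weq[OF False] coordinates_W by blast+
    then show ?thesis by (simp add: formB_def tensor_form_2)
  qed (simp add: k2_def)
  then have form2: "is_form l c (\<bullet>) h1 (\<bullet>) k2 B"
    using form by (simp add: is_form_iff)
  obtain t where t: "t \<in> lie Sp1n" "B t t < 0"
    using B unfolding lorentzian_mod_def by blast
  have bl: "bilinear_on (lie Sp1n) B"
    using B by (intro sym_bilinear_on_imp_bilinear_on[OF subspace_lie_Sp1n])
      (simp add: lorentzian_mod_def)
  have "B t t = B (mpart l t) (mpart l t)"
  proof -
    have m: "mpart l t \<in> lie Sp1n" "t - mpart l t \<in> hh l" "t - mpart l t \<in> lie Sp1n"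
      using mpart_mm[OF t(1)] hpart_hh[OF t(1)] mm_subset_lie hh_subset_lie by blast+
    have rad: "B x y = 0 \<and> B y x = 0" if "x \<in> lie Sp1n" "y \<in> hh l" for x y
      using B that hh_subset_lie unfolding lorentzian_mod_def sym_bilinear_on_def by (metis subsetD)
    have "B t t = B (mpart l t + (t - mpart l t)) (mpart l t + (t - mpart l t))" by simp
    also have "\<dots> = B (mpart l t) (mpart l t)"
      using rad[OF m(1,2)] rad[OF m(3,2)]
      by (simp only: bilinear_onD[OF bl] m subspace_add[OF subspace_lie_Sp1n])
    finally show ?thesis .
  qed
  also have "\<dots> = formB l c (\<bullet>) h1 (\<bullet>) k2 (mpart l t) (mpart l t)"
    using form' mpart_mm[OF t(1)] eq by simp
  finally have "formB l c (\<bullet>) h1 (\<bullet>) k2 t t < 0" using t(2) by (simp add: formB_mpart)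
  then have "- c * qre (px l t) * qre (px l t) < 0"
    using tensor_form_inner_nonneg[OF h1, of "fst (snd (of_mm l t))"]
        tensor_form_inner_nonneg[OF k2, of "snd (snd (of_mm l t))"]
    unfolding formB_def of_mm_nth(1) by linarith
  then have "c * (qre (px l t) * qre (px l t)) > 0" by simp
  then have "c > 0" using zero_le_square[of "qre (px l t)"] by (auto simp: zero_less_mult_iff)
  then show ?thesis using that h1 k2 form2 by blast
qed

lemma metric_classification:
  assumes q: "invariant_lorentzian_metric Sp1n (Kv l) q"
  obtains c h1 h2 B where "c > 0" "euclidean_on UNIV h1" "euclidean_on UNIV h2"
    "is_form l c (\<bullet>) h1 (\<bullet>) h2 B" "defined_by Sp1n (Kv l) (mm l) B q"
proof -
  define B where "B = (\<lambda>U U'. q (dproj (Kv l) (mat 1) U) (dproj (Kv l) (mat 1) U'))"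
  have lor: "lorentzian_mod (lie Sp1n) (hh l) B"
    using metric_at_identity[OF q] by (simp add: B_def lie_Kv)
  then have "sym_bilinear_on (lie Sp1n) B" by (simp add: lorentzian_mod_def)
  then have sym: "sym_bilinear_on (mm l) B"
    using mm_subset_lie unfolding sym_bilinear_on_def by (meson subsetD)
  have "B (Ad A M) (Ad A N) = B M N" if "A \<in> Kv l" "M \<in> mm l" "N \<in> mm l" for A M N
    unfolding B_def using that mm_subset_lie by (intro metric_Ad[OF q Kv_is_subgroup]) auto
  then obtain c h1 h2 where "sym_bilinear_on UNIV h1" "sym_bilinear_on UNIV h2"
      "is_form l c (\<bullet>) h1 (\<bullet>) h2 B"
    using invariant_form_classification[OF sym] by blast
  then obtain k2 where "c > 0" "euclidean_on UNIV h1" "euclidean_on UNIV k2"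
      "is_form l c (\<bullet>) h1 (\<bullet>) k2 B"
    using lorentzian_form_signs[OF lor] by blast
  moreover have "defined_by Sp1n (Kv l) (mm l) B q"
    unfolding defined_by_def B_def using mm_subset_lie by (intro ballI metric_translate[OF q]) auto
  ultimately show ?thesis by (rule that)
qed

section \<open>A fixed point theorem for compact groups\<close>

text \<open>
  A compact group of linear maps has a fixed point in every invariant compact convex set \<open>C\<close>: with
  \<open>f u\<close> the largest norm of a vector in the orbit of \<open>u\<close>, the function \<open>f\<close> is continuous, being
  convex, and has a minimum on \<open>C\<close>, which is attained at one point only, as the norm is strictly
  convex. By invariance of \<open>f\<close>, this point is fixed.
\<close>

lemma compact_group_fixed_point:
  fixes \<rho> :: "'g::topological_space \<Rightarrow> 'a::euclidean_space \<Rightarrow> 'a"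
  assumes H: "compact H" "H \<noteq> {}"
    and cont: "\<And>x. continuous_on H (\<lambda>h. \<rho> h x)"
    and lin: "\<And>h. h \<in> H \<Longrightarrow> linear (\<rho> h)"
    and inj: "\<And>h x. h \<in> H \<Longrightarrow> \<rho> h x = 0 \<Longrightarrow> x = 0"
    and comp: "\<And>g h. g \<in> H \<Longrightarrow> h \<in> H \<Longrightarrow> \<exists>k\<in>H. \<forall>x. \<rho> h (\<rho> g x) = \<rho> k x"
    and C: "compact C" "convex C" "C \<noteq> {}"
    and inv: "\<And>h x. h \<in> H \<Longrightarrow> x \<in> C \<Longrightarrow> \<rho> h x \<in> C"
  obtains u where "u \<in> C" "\<And>h. h \<in> H \<Longrightarrow> \<rho> h u = u"
proof -
  define f where "f u = (SUP h\<in>H. norm (\<rho> h u))" for u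
  have attained: "\<exists>h\<in>H. f u = norm (\<rho> h u)" and upper: "\<And>h. h \<in> H \<Longrightarrow> norm (\<rho> h u) \<le> f u" for u
  proof -
    have "continuous_on H (\<lambda>h. norm (\<rho> h u))" by (intro continuous_on_norm cont)
    then obtain h where h: "h \<in> H" "\<And>k. k \<in> H \<Longrightarrow> norm (\<rho> k u) \<le> norm (\<rho> h u)"
      using continuous_attains_sup[OF H] by metis
    then have "f u = norm (\<rho> h u)"
      unfolding f_def by (intro cSup_eq_maximum) auto
    then show "\<exists>h\<in>H. f u = norm (\<rho> h u)" "\<And>h. h \<in> H \<Longrightarrow> norm (\<rho> h u) \<le> f u" using h by auto
  qed
  have "convex_on UNIV f"
  proof (rule convex_onI)
    fix t :: real and x y assume t: "0 < t" "t < 1"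
    obtain h where h: "h \<in> H" "f ((1 - t) *\<^sub>R x + t *\<^sub>R y) = norm (\<rho> h ((1 - t) *\<^sub>R x + t *\<^sub>R y))"
      using attained by blast
    then have "f ((1 - t) *\<^sub>R x + t *\<^sub>R y) = norm ((1 - t) *\<^sub>R \<rho> h x + t *\<^sub>R \<rho> h y)"
      using lin[OF h(1)] by (simp add: linear_add linear_cmul)
    also have "\<dots> \<le> (1 - t) * norm (\<rho> h x) + t * norm (\<rho> h y)"
      using t by (intro norm_triangle_le) simp
    also have "\<dots> \<le> (1 - t) * f x + t * f y"
      using t upper[OF h(1)] by (intro add_mono mult_left_mono) auto
    finally show "f ((1 - t) *\<^sub>R x + t *\<^sub>R y) \<le> (1 - t) * f x + t * f y" .
  qed simp
  then have "continuous_on C f"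
    using convex_on_continuous[of UNIV f] continuous_on_subset by blast
  then obtain u where u: "u \<in> C" "\<And>x. x \<in> C \<Longrightarrow> f u \<le> f x"
    using continuous_attains_inf[OF C(1,3)] by blast
  have "\<rho> g u = u" if g: "g \<in> H" for g
  proof -
    let ?w = "\<rho> g u"
    have w: "?w \<in> C" "f ?w \<le> f u"
    proof -
      show "?w \<in> C" by (rule inv[OF g u(1)])
      obtain h where h: "h \<in> H" "f ?w = norm (\<rho> h ?w)" using attained by blast
      then show "f ?w \<le> f u" using comp[OF g h(1)] upper by force
    qed
    have mid: "midpoint u ?w \<in> C"
      using convexD[OF C(2) u(1) w(1), of "1/2" "1/2"] by (simp add: midpoint_def scaleR_add_right)
    obtain h where h: "h \<in> H" "f (midpoint u ?w) = norm (\<rho> h (midpoint u ?w))" using attained by blast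
    \<comment> \<open>As \<open>u\<close> is a minimum, \<open>|a|, |b| \<le> f u \<le> |a + b| / 2\<close>, and \<open>a = b\<close> by the parallelogram law.\<close>
    define a b where "a = \<rho> h u" and "b = \<rho> h ?w"
    have "\<rho> h (midpoint u ?w) = (1/2) *\<^sub>R (a + b)"
      using lin[OF h(1)] by (simp add: midpoint_def linear_add linear_cmul a_def b_def)
    then have "f u \<le> norm (a + b) / 2" using u(2)[OF mid] h(2) by simp
    moreover have ab: "norm a \<le> f u" "norm b \<le> f u" using upper[OF h(1)] w(2)
        by (auto simp: a_def b_def intro: order_trans)
    ultimately have "(2 * f u)\<^sup>2 \<le> (norm (a + b))\<^sup>2"
      using norm_ge_zero[of a] by (intro power_mono) linarith+
    moreover have "(norm (a + b))\<^sup>2 + (norm (a - b))\<^sup>2 = 2 * (norm a)\<^sup>2 + 2 * (norm b)\<^sup>2"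
      by (simp add: power2_norm_eq_inner inner_add_left inner_add_right inner_diff_left inner_diff_right
          inner_commute[of b a])
    moreover have "(norm a)\<^sup>2 \<le> (f u)\<^sup>2" "(norm b)\<^sup>2 \<le> (f u)\<^sup>2" using ab by (auto intro: power_mono)
    moreover have "(2 * f u)\<^sup>2 = 4 * (f u)\<^sup>2" by (simp add: power_mult_distrib)
    ultimately have "(norm (a - b))\<^sup>2 \<le> 0" by linarith
    then have "a = b" by simp
    then have "\<rho> h (u - ?w) = 0" using lin[OF h(1)] by (simp add: linear_diff a_def b_def)
    then show ?thesis using inj[OF h(1)] by fastforce
  qed
  with u(1) show ?thesis by (rule that)
qed

section \<open>Minimality\<close>

lemma norm_power_quat: "norm (x ^ m) = norm (x::quat) ^ m"
  by (induction m) (simp_all add: norm_mult_quat)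

lemma power_bounded_norm_le_1:
  assumes "\<And>m. norm (x ^ m) \<le> C" shows "norm (x::quat) \<le> 1"
proof (rule ccontr)
  assume "\<not> norm x \<le> 1"
  then obtain m where "C < norm x ^ m" using real_arch_pow[of "norm x" C] by auto
  then show False using assms[of m] by (simp add: norm_power_quat)
qed

text \<open>
  The centralizer of \<open>v\<close> in \<open>Sp\<^sub>1\<^sub>,\<^sub>n\<close> is the product of \<open>K\<^sub>v\<close> and the one-parameter group of \<open>v\<close>, which
  is not compact. In terms of the matrix entries \<open>a = A\<^sub>0\<^sub>0 = A\<^sub>1\<^sub>1\<close> and \<open>b = A\<^sub>0\<^sub>1 = A\<^sub>1\<^sub>0\<close>, the numbers
  \<open>a + b\<close> and \<open>a - b\<close> are multiplicative in \<open>A\<close> and satisfy \<open>(a + b)\<^sup>* (a - b) = 1\<close>. On a bounded group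
  their norm is at most one, hence equal to one, which implies \<open>b = 0\<close>.
\<close>

lemma bounded_centralizer_subset_Kv:
  fixes l :: "'n::finite"
  assumes H: "is_subgroup Sp1n H" and bounded: "bounded H"
    and A: "A \<in> H" and comm: "A ** vv l = vv l ** A"
  shows "A \<in> Kv l"
proof -
  have AS: "A \<in> Sp1n" by (rule subgroupD(1)[OF H A])
  define a b where "a = A $ None $ None" and "b = A $ Some l $ None"
  have e: "A $ Some l $ Some l = a" "A $ None $ Some l = b" "\<And>i. i \<noteq> l \<Longrightarrow> A $ None $ Some i = 0"
    "\<And>i. i \<noteq> l \<Longrightarrow> A $ Some l $ Some i = 0" "\<And>i. i \<noteq> l \<Longrightarrow> A $ Some i $ None = 0"
        "\<And>i. i \<noteq> l \<Longrightarrow> A $ Some i $ Some l = 0"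
    using comm unfolding commutes_vv_iff a_def b_def by auto
  have e': "A $ Some i $ None = (if i = l then b else 0)" "A $ None $ Some i = (if i = l then b else 0)"
    "A $ Some i $ Some l = (if i = l then a else 0)" "A $ Some l $ Some i = (if i = l then a else 0)"
        for i
    using e by (auto simp: b_def)
  have U: "- (qcnj (A $ None $ i) * A $ None $ j) + (\<Sum>k\<in>UNIV. qcnj (A $ Some k $ i) * A $ Some k $ j)
      = (if i = j then sgn0 i else 0)" for i j
    using AS unfolding Sp1n_eq unitary_JJ_iff by blast
  have 1: "- (qcnj a * a) + qcnj b * b = -1"
    using U[of None None] by (simp add: e' a_def[symmetric] if_distrib[of qcnj] cong: if_cong)
  have 2: "- (qcnj a * b) + qcnj b * a = 0"
    using U[of None "Some l"] by (simp add: e' a_def[symmetric] if_distrib[of qcnj] cong: if_cong)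
  have sd: "qcnj (a + b) * (a - b) = 1"
    using 1 2 by (simp add: qcnj_add algebra_simps)
  \<comment> \<open>The powers of \<open>A\<close>, all of which are in the bounded set \<open>H\<close>.\<close>
  define P where "P m = (((**) A) ^^ m) (mat 1)" for m
  have PH: "P m \<in> H" for m
  proof (induction m)
    case 0 then show ?case using H by (simp add: P_def is_subgroup_def)
  next
    case (Suc m) then show ?case using subgroupD(3)[OF H A] by (simp add: P_def)
  qed
  have P0: "P m $ None $ None + P m $ Some l $ None = (a + b) ^ m"
    "P m $ None $ None - P m $ Some l $ None = (a - b) ^ m" for m
  proof (induction m)
    case 0
    show "P 0 $ None $ None + P 0 $ Some l $ None = (a + b) ^ 0"
      "P 0 $ None $ None - P 0 $ Some l $ None = (a - b) ^ 0"
      by (simp_all add: P_def mat_def)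
  next
    case (Suc m)
    have "P (Suc m) $ None $ None = a * P m $ None $ None + b * P m $ Some l $ None"
      "P (Suc m) $ Some l $ None = b * P m $ None $ None + a * P m $ Some l $ None"
      by (simp_all add: P_def mmul_nth sum_UNIV_option e' a_def[symmetric] cong: if_cong)
    then show "P (Suc m) $ None $ None + P (Suc m) $ Some l $ None = (a + b) ^ Suc m"
      "P (Suc m) $ None $ None - P (Suc m) $ Some l $ None = (a - b) ^ Suc m"
      by (simp_all add: Suc[symmetric] algebra_simps)
  qed
  obtain C where C: "\<And>X. X \<in> H \<Longrightarrow> norm X \<le> C" using bounded unfolding bounded_iff by blast
  have entry: "norm (P m $ i $ j) \<le> C" for m i j
    using C[OF PH[of m]] Finite_Cartesian_Product.norm_nth_le[of "P m" i]
        Finite_Cartesian_Product.norm_nth_le[of "P m $ i" j]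
    by linarith
  have "norm ((a + b) ^ m) \<le> C + C" for m
    unfolding P0[symmetric] using norm_triangle_le[OF add_mono[OF entry entry]] .
  then have s: "norm (a + b) \<le> 1" by (rule power_bounded_norm_le_1)
  have "norm ((a - b) ^ m) \<le> C + C" for m
    unfolding P0[symmetric] using norm_triangle_le_diff[OF add_mono[OF entry entry]] .
  then have d: "norm (a - b) \<le> 1" by (rule power_bounded_norm_le_1)
  have "norm (a + b) * norm (a - b) = 1"
    using arg_cong[OF sd, of norm] by (simp add: norm_mult_quat)
  then have "norm (a + b) = 1"
    using s d mult_left_le[of "norm (a - b)" "norm (a + b)"] by (metis antisym mult_left_le norm_ge_zero)
  then have "a - b = (a + b) * (qcnj (a + b) * (a - b))"
    by (simp add: mult.assoc[symmetric] del: mult_1_right)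
  then have "a - b = a + b" by (simp add: sd)
  then have "b = 0" by (simp add: quat_eq_iff)
  then have "A ** JJ = JJ ** A"
    unfolding commutes_JJ_iff by (simp add: e')
  then show ?thesis using AS comm by (simp add: Kv_eq Sp1n_eq unitary_def)
qed

lemma continuous_on_matrix_inv: "continuous_on Sp1n matrix_inv"
proof -
  have "continuous_on Sp1n (\<lambda>A. JJ ** adjoint_mat A ** JJ)"
    by (intro continuous_intros linear_continuous_on bounded_linear_adjoint)
  then show ?thesis
    by (rule continuous_on_eq) (simp add: Sp1n_eq unitary_inverse(3)[OF involution_JJ])
qed

lemma continuous_on_Ad: "continuous_on Sp1n (\<lambda>A. Ad A X)"
  unfolding Ad_def by (intro continuous_on_mmul continuous_on_id continuous_on_const
      continuous_on_matrix_inv)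

lemma Ad_mult: "A \<in> Sp1n \<Longrightarrow> B \<in> Sp1n \<Longrightarrow> Ad A (Ad B X) = Ad (A ** B) X"
proof -
  assume A: "A \<in> Sp1n" and B: "B \<in> Sp1n"
  have "matrix_inv (A ** B) = matrix_inv B ** matrix_inv A"
    using Sp1n_inverse[OF A] Sp1n_inverse[OF B]
    by (intro matrix_inv_eqI) (metis matrix_mul_assoc matrix_mul_rid)
  then show ?thesis by (simp add: Ad_def matrix_mul_assoc)
qed

lemma Ad_eq_0:
  assumes A: "A \<in> Sp1n" and "Ad A X = 0" shows "X = 0"
proof -
  have "A ** X = Ad A X ** A" by (simp add: Ad_def Sp1n_cancel[OF A])
  then have "matrix_inv A ** (A ** X) = 0" using assms(2) by simp
  then show ?thesis by (simp add: Sp1n_cancel[OF A])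
qed

text \<open>
  A linear form on the Lie algebra is continuous, as it extends to all matrices by means of the
  projection \<open>X \<mapsto> (X - J X\<^sup>* J) / 2\<close>.
\<close>

lemma continuous_on_lie_functional:
  fixes L :: "'n::finite qmat1 \<Rightarrow> real"
  assumes L: "\<And>x y. x \<in> lie Sp1n \<Longrightarrow> y \<in> lie Sp1n \<Longrightarrow> L (x + y) = L x + L y"
    "\<And>c x. x \<in> lie Sp1n \<Longrightarrow> L (c *\<^sub>R x) = c * L x"
  shows "continuous_on (lie Sp1n) L"
proof -
  define P where "P X = (1/2) *\<^sub>R (X - JJ ** adjoint_mat X ** JJ)" for X :: "'n qmat1"
  have JJ: "JJ ** JJ = mat 1" using involution_JJ by (simp add: involution_def)
  have "adjoint_mat JJ = (JJ :: 'n qmat1)"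
  proof -
    have "qcnj (sgn0 i) = sgn0 i" for i :: "'n option" by (cases i) simp_all
    then show ?thesis by (simp add: vec_eq_iff)
  qed
  note JJ = this JJ
  have JX: "JJ ** (JJ ** X) = X" "X ** JJ ** JJ = X" for X :: "'n qmat1"
    by (simp_all add: matrix_mul_assoc JJ) (simp add: matrix_mul_assoc[symmetric] JJ)
  have lie: "X \<in> lie Sp1n \<longleftrightarrow> adjoint_mat X ** JJ + JJ ** X = 0" for X :: "'n qmat1"
    by (simp add: Sp1n_eq lie_unitary unitary_alg_def)
  have Plie: "P X \<in> lie Sp1n" for X
    unfolding lie P_def by (simp add: mmul_linear adjoint_mmul JJ JX matrix_mul_assoc)
      (simp add: matrix_mul_assoc[symmetric] JX algebra_simps flip: scaleR_add_right)
  have PX: "P X = X" if "X \<in> lie Sp1n" for X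
  proof -
    have "adjoint_mat X ** JJ = - (JJ ** X)" using that by (simp add: lie eq_neg_iff_add_eq_0)
    then have "JJ ** adjoint_mat X ** JJ = - X" by (simp add: matrix_mul_assoc[symmetric] mmul_linear JX)
    then show ?thesis by (simp add: P_def scaleR_2[symmetric])
  qed
  have "linear (\<lambda>X. L (P X))"
  proof (rule linearI)
    have "P (X + Y) = P X + P Y" "P (c *\<^sub>R X) = c *\<^sub>R P X" for X Y c
      by (simp_all add: P_def mmul_linear algebra_simps)
    then show "L (P (X + Y)) = L (P X) + L (P Y)" "L (P (c *\<^sub>R X)) = c *\<^sub>R L (P X)" for X Y c
      by (simp_all add: L Plie)
  qed
  then have "continuous_on (lie Sp1n) (\<lambda>X. L (P X))"
    by (intro linear_continuous_on) (simp add: linear_conv_bounded_linear)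
  then show ?thesis by (rule continuous_on_eq) (simp add: PX)
qed

text \<open>
  Let \<open>H \<supseteq> K\<^sub>v\<close> be compact and connected, with an invariant Lorentzian metric on the quotient. The
  orbit of a timelike vector \<open>t\<close> stays in one half of the time cone, since it is connected and no
  timelike vector is orthogonal to \<open>t\<close>. So \<open>0\<close> is not in its convex hull, which contains a vector
  fixed by \<open>H\<close>. This vector is fixed by \<open>K\<^sub>v\<close>, hence a multiple of \<open>v\<close>, and \<open>H\<close> centralizes \<open>v\<close>.
\<close>

lemma Kv_maximal_admissible:
  fixes l :: "'n::finite"
  assumes H: "cc_subgroup Sp1n H" and sub: "Kv l \<subseteq> H" and adm: "admissible Sp1n H"
  shows "H = Kv l"
proof -
  obtain q where q: "invariant_lorentzian_metric Sp1n H q" using adm by (auto simp: admissible_def)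
  have Hs: "is_subgroup Sp1n H" "compact H" "connected H" using H by (auto simp: cc_subgroup_def)
  have HS: "H \<subseteq> Sp1n" using Hs(1) by (simp add: is_subgroup_def)
  have one: "mat 1 \<in> H" using Hs(1) by (simp add: is_subgroup_def)
  define B where "B = (\<lambda>U U'. q (dproj H (mat 1) U) (dproj H (mat 1) U'))"
  have lor: "lorentzian_mod (lie Sp1n) (lie H) B"
    using metric_at_identity[OF q] by (simp add: B_def)
  have inv: "B (Ad A x) (Ad A y) = B x y" if "A \<in> H" "x \<in> lie Sp1n" "y \<in> lie Sp1n" for A x y
    unfolding B_def by (rule metric_Ad[OF q Hs(1) that])
  have bl: "bilinear_on (lie Sp1n) B"
    using lor by (intro sym_bilinear_on_imp_bilinear_on[OF subspace_lie_Sp1n])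
      (simp add: lorentzian_mod_def)
  obtain t where t: "t \<in> lie Sp1n" "B t t < 0" "\<And>x. x \<in> lie Sp1n \<Longrightarrow> B t x = 0 \<Longrightarrow> x \<notin> lie H \<Longrightarrow> B x x > 0"
    and rad: "\<And>x y. x \<in> lie Sp1n \<Longrightarrow> y \<in> lie H \<Longrightarrow> B x y = 0"
    using lor unfolding lorentzian_mod_def by blast
  have orbit: "Ad A t \<in> lie Sp1n" if "A \<in> H" for A
    using that HS t(1) Ad_lie_Sp1n by blast
  have Ad1: "Ad (mat 1) t = t" using matrix_inv_eqI[of "mat 1 :: 'n qmat1" "mat 1"] by (simp add: Ad_def)
  have contB: "continuous_on (lie Sp1n) (B t)"
    by (rule continuous_on_lie_functional) (simp_all add: bilinear_onD[OF bl] bilinear_on_scaleR[OF bl]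
        t(1))
  have contO: "continuous_on H (\<lambda>A. Ad A t)" using continuous_on_Ad HS continuous_on_subset by blast
  \<comment> \<open>A vector of the orbit is timelike, whereas vectors orthogonal to \<open>t\<close> are spacelike or in the kernel.\<close>
  have nz: "B t (Ad A t) \<noteq> 0" if A: "A \<in> H" for A
  proof
    assume 0: "B t (Ad A t) = 0"
    have neg: "B (Ad A t) (Ad A t) < 0" using inv[OF A t(1) t(1)] t(2) by simp
    then have "Ad A t \<notin> lie H" using rad[OF orbit[OF A]] by force
    then show False using t(3)[OF orbit[OF A] 0] neg by simp
  qed
  have "connected ((\<lambda>A. B t (Ad A t)) ` H)"
    using continuous_on_compose2[OF contB contO] orbit Hs(3) by (intro connected_continuous_image) auto
  then have neg: "B t (Ad A t) < 0" if "A \<in> H" for A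
    using connectedD_interval[of "(\<lambda>A. B t (Ad A t)) ` H" "B t (Ad (mat 1) t)" "B t (Ad A t)" 0] nz that
        one t(2)
    by (force simp: Ad1 not_less)
  \<comment> \<open>A compact convex set that is invariant under \<open>H\<close> and does not contain \<open>0\<close>.\<close>
  define C where "C = convex hull ((\<lambda>A. Ad A t) ` H)"
  have "C \<subseteq> {x \<in> lie Sp1n. B t x < 0}"
    unfolding C_def
  proof (rule hull_minimal)
    show "(\<lambda>A. Ad A t) ` H \<subseteq> {x \<in> lie Sp1n. B t x < 0}" using orbit neg by blast
    show "convex {x \<in> lie Sp1n. B t x < 0}"
    proof (rule convexI)
      fix x y and r s :: real
      assume x: "x \<in> {x \<in> lie Sp1n. B t x < 0}" "y \<in> {x \<in> lie Sp1n. B t x < 0}"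
          and r: "0 \<le> r" "0 \<le> s" "r + s = 1"
      have "r *\<^sub>R x \<in> lie Sp1n" "s *\<^sub>R y \<in> lie Sp1n" using x subspace_scale[OF subspace_lie_Sp1n]
          by blast+
      moreover from this have "B t (r *\<^sub>R x + s *\<^sub>R y) = r * B t x + s * B t y"
        using x t(1) by (simp add: bilinear_onD[OF bl] bilinear_on_scaleR[OF bl])
      moreover have "r * B t x + s * B t y < 0"
        using convex_bound_lt[of "B t x" 0 "B t y" r s] x r by simp
      ultimately show "r *\<^sub>R x + s *\<^sub>R y \<in> {x \<in> lie Sp1n. B t x < 0}"
        using subspace_add[OF subspace_lie_Sp1n] by simp
    qed
  qed
  note Csub = this
  have lin: "linear (Ad A)" for A :: "'n qmat1" by (rule linearI) (simp_all add: Ad_linear)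
  obtain u where u: "u \<in> C" "\<And>A. A \<in> H \<Longrightarrow> Ad A u = u"
  proof (rule compact_group_fixed_point[of H Ad C])
    show "continuous_on H (\<lambda>A. Ad A x)" for x using continuous_on_Ad HS continuous_on_subset by blast
    show "\<exists>k\<in>H. \<forall>x. Ad h (Ad g x) = Ad k x" if "g \<in> H" "h \<in> H" for g h
      using that subgroupD(3)[OF Hs(1)] Ad_mult HS by blast
    show "compact C" unfolding C_def by (intro compact_convex_hull compact_continuous_image contO Hs(2))
    show "convex C" unfolding C_def by (rule convex_convex_hull)
    show "C \<noteq> {}" unfolding C_def using one by auto
    show "Ad A x \<in> C" if A: "A \<in> H" and x: "x \<in> C" for A x
    proof -
      have "Ad A ` C = convex hull (Ad A ` (\<lambda>B. Ad B t) ` H)"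
        unfolding C_def by (rule convex_hull_linear_image[OF lin])
      also have "\<dots> \<subseteq> C"
        unfolding C_def
      proof (rule hull_mono)
        show "Ad A ` (\<lambda>B. Ad B t) ` H \<subseteq> (\<lambda>B. Ad B t) ` H"
          using A subgroupD(3)[OF Hs(1) A] Ad_mult HS by (force simp: subset_iff)
      qed
      finally show ?thesis using x by blast
    qed
  qed (use Hs(2) one lin Ad_eq_0 HS that in blast)+
  have ul: "u \<in> lie Sp1n" "B t u < 0" using u(1) Csub by blast+
  have Ad_comm: "A ** u = u ** A" if "A \<in> H" for A
    using u(2)[OF that] Ad_eq_iff[OF involution_JJ, of A "{}" u u] that HS by (auto simp: Sp1n_eq)
  then have "u \<in> Rv l" using fixed_by_Kv[OF ul(1)] sub by blast
  then obtain r where r: "u = r *\<^sub>R vv l" by (auto simp: Rv_def)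
  have "r \<noteq> 0"
  proof
    assume "r = 0"
    then have "B t u = 0" using bilinear_on_scaleR(2)[OF bl t(1) t(1), of 0] by (simp add: r)
    then show False using ul(2) by simp
  qed
  have "A \<in> Kv l" if A: "A \<in> H" for A
  proof (rule bounded_centralizer_subset_Kv[OF Hs(1) compact_imp_bounded[OF Hs(2)] A])
    have "r *\<^sub>R (A ** vv l) = r *\<^sub>R (vv l ** A)" using Ad_comm[OF A] by (simp add: r mmul_linear)
    then show "A ** vv l = vv l ** A" using \<open>r \<noteq> 0\<close> by simp
  qed
  with sub show ?thesis by blast
qed

section \<open>Conjugate subgroups\<close>

lemma tangent_at_mono: "S \<subseteq> T \<Longrightarrow> tangent_at S p \<subseteq> tangent_at T p"
  unfolding tangent_at_def by blast

lemma Ad_one: "Ad (mat 1) X = X"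
proof -
  have "matrix_inv (mat 1 :: 'a qmat1) = mat 1" by (rule matrix_inv_eqI) simp
  then show ?thesis by (simp add: Ad_def)
qed

lemma Ad_inverse:
  assumes "a \<in> Sp1n"
  shows "Ad a (Ad (matrix_inv a) X) = X" "Ad (matrix_inv a) (Ad a X) = X"
  using Ad_mult[OF assms Sp1n_inverse(3)[OF assms]] Ad_mult[OF Sp1n_inverse(3)[OF assms] assms]
  by (simp_all add: Sp1n_inverse[OF assms] Ad_one)

lemma bounded_linear_Ad: "bounded_linear (Ad A)"
  unfolding linear_conv_bounded_linear[symmetric] by (rule linearI) (simp_all add: Ad_linear)

lemma conj_subgroup:
  assumes H: "is_subgroup Sp1n H" and a: "a \<in> Sp1n"
  shows "is_subgroup Sp1n (Ad a ` H)"
proof -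
  have mult: "Ad a A ** Ad a B = Ad a (A ** B)" for A B
    by (simp add: Ad_def matrix_mul_assoc Sp1n_cancel[OF a])
  have one: "Ad a (mat 1) = mat 1" by (simp add: Ad_def Sp1n_inverse[OF a])
  have G: "Ad a A \<in> Sp1n" if "A \<in> H" for A
    using subgroupD(1)[OF H that] a by (simp add: Ad_def Sp1n_mult Sp1n_inverse)
  have inv: "matrix_inv (Ad a A) = Ad a (matrix_inv A)" if "A \<in> H" for A
    by (rule matrix_inv_eqI) (simp add: mult one Sp1n_inverse[OF subgroupD(1)[OF H that]])
  have one_H: "mat 1 \<in> H" using H by (simp add: is_subgroup_def)
  show ?thesis
    unfolding is_subgroup_def
  proof (intro conjI ballI)
    show "Ad a ` H \<subseteq> Sp1n" using G by blast
    show "mat 1 \<in> Ad a ` H" using one one_H by (metis imageI)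
    show "A ** B \<in> Ad a ` H" if "A \<in> Ad a ` H" "B \<in> Ad a ` H" for A B
      using that subgroupD(3)[OF H] by (auto simp: mult)
    show "matrix_inv A \<in> Ad a ` H" if "A \<in> Ad a ` H" for A
      using that subgroupD(2)[OF H] by (auto simp: inv)
  qed
qed

lemma conj_cc_subgroup:
  assumes H: "cc_subgroup Sp1n H" and a: "a \<in> Sp1n"
  shows "cc_subgroup Sp1n (Ad a ` H)"
proof -
  have "continuous_on H (Ad a)" by (rule linear_continuous_on[OF bounded_linear_Ad])
  then show ?thesis
    using H conj_subgroup[OF _ a] unfolding cc_subgroup_def
    by (blast intro: compact_continuous_image connected_continuous_image)
qed

text \<open>
  Right translation by \<open>a\<close> induces a \<open>G\<close>-equivariant diffeomorphism \<open>G / a H a\<^sup>-\<^sup>1 \<rightarrow> G / H\<close>, by which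
  invariant metrics are pulled back.
\<close>

lemma admissible_conj:
  assumes adm: "admissible Sp1n H" and a: "a \<in> Sp1n"
  shows "admissible Sp1n (Ad a ` H)"
proof -
  obtain q where q: "invariant_lorentzian_metric Sp1n H q" and cc: "cc_subgroup Sp1n H"
    using adm by (auto simp: admissible_def)
  let ?H = "Ad a ` H"
  have Hs: "is_subgroup Sp1n H" using cc by (simp add: cc_subgroup_def)
  have Hs': "is_subgroup Sp1n ?H" by (rule conj_subgroup[OF Hs a])
  note ca = Sp1n_cancel[OF a]
  define sh where "sh S = (\<lambda>(g, U). (g ** a, U ** a)) ` S" for S :: "('a qmat1 \<times> 'a qmat1) set"
  have tan: "tangent_at ?H (Ad a h) = Ad a ` tangent_at H h" for h
    by (rule tangent_at_linear_image[OF bounded_linear_Ad bounded_linear_Ad[of "matrix_inv a"]])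
        (simp_all add: Ad_inverse[OF a])
  have sh: "sh (dproj ?H g U) = dproj H (g ** a) (U ** a)" for g U
  proof -
    have e: "X ** Ad a Y ** a = X ** a ** Y" for X Y :: "'a qmat1"
      by (simp add: Ad_def matrix_mul_assoc ca)
    show ?thesis
    proof (intro equalityI subsetI)
      fix x assume "x \<in> sh (dproj ?H g U)"
      then obtain h' k' where h': "h' \<in> ?H" "k' \<in> tangent_at ?H h'"
        and x': "x = (g ** h' ** a, (U ** h' + g ** k') ** a)"
        unfolding sh_def dproj_def by auto
      obtain h where "h \<in> H" "h' = Ad a h" using h'(1) by blast
      moreover from this obtain k where "k \<in> tangent_at H h" "k' = Ad a k" using h'(2) tan by auto
      ultimately have h: "h \<in> H" "k \<in> tangent_at H h"
        and x: "x = (g ** Ad a h ** a, (U ** Ad a h + g ** Ad a k) ** a)"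
        using x' by simp_all
      have "x = (g ** a ** h, U ** a ** h + g ** a ** k)" by (simp add: x mmul_linear e)
      then show "x \<in> dproj H (g ** a) (U ** a)" using h unfolding dproj_def by blast
    next
      fix x assume "x \<in> dproj H (g ** a) (U ** a)"
      then obtain h k where h: "h \<in> H" "k \<in> tangent_at H h"
        and x: "x = (g ** a ** h, U ** a ** h + g ** a ** k)"
        unfolding dproj_def by blast
      have "(g ** Ad a h, U ** Ad a h + g ** Ad a k) \<in> dproj ?H g U"
        unfolding dproj_def using h tan by blast
      moreover have "x = (g ** Ad a h ** a, (U ** Ad a h + g ** Ad a k) ** a)"
        by (simp add: x mmul_linear e)
      ultimately show "x \<in> sh (dproj ?H g U)" unfolding sh_def by force
    qed
  qed
  have rt: "tangent_at ((\<lambda>X. X ** a) ` S) (p ** a) = (\<lambda>X. X ** a) ` tangent_at S p"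
    for S and p :: "'a qmat1"
    by (rule tangent_at_right_translate[OF Sp1n_inverse(2)[OF a]])
  have Ga: "(\<lambda>X. X ** a) ` Sp1n = Sp1n"
  proof (intro equalityI subsetI)
    fix X :: "'a qmat1" assume "X \<in> Sp1n"
    then have "X ** matrix_inv a \<in> Sp1n" using Sp1n_mult Sp1n_inverse(3)[OF a] by blast
    moreover have "X = X ** matrix_inv a ** a" by (simp add: ca)
    ultimately show "X \<in> (\<lambda>X. X ** a) ` Sp1n" by blast
  qed (use Sp1n_mult a in blast)
  have tG: "tangent_at Sp1n (g ** a) = (\<lambda>X. X ** a) ` tangent_at Sp1n g" for g :: "'a qmat1"
    using rt[of Sp1n g] by (simp add: Ga)
  have tN: "tangent_at ((**) (g ** a) ` H) (g ** a) = (\<lambda>X. X ** a) ` tangent_at ((**) g ` ?H) g"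
      for g :: "'a qmat1"
  proof -
    have "(\<lambda>X. X ** a) ` (**) g ` ?H = (**) (g ** a) ` H"
      by (simp add: image_image Ad_def matrix_mul_assoc ca)
    then show ?thesis using rt[of "(**) g ` ?H" g] by simp
  qed
  let ?q = "\<lambda>S S'. q (sh S) (sh S')"
  have "lorentzian_mod (tangent_at Sp1n g) (tangent_at ((**) g ` ?H) g)
      (\<lambda>U U'. ?q (dproj ?H g U) (dproj ?H g U'))" if g: "g \<in> Sp1n" for g
  proof -
    have ga: "g ** a \<in> Sp1n" by (rule Sp1n_mult[OF g a])
    have L: "lorentzian_mod (tangent_at Sp1n (g ** a)) (tangent_at ((**) (g ** a) ` H) (g ** a))
        (\<lambda>U U'. q (dproj H (g ** a) U) (dproj H (g ** a) U'))"
      using q ga unfolding invariant_lorentzian_metric_def by blast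
    have "(**) g ` ?H \<subseteq> Sp1n" using Hs' g Sp1n_mult unfolding is_subgroup_def by blast
    then have sub: "tangent_at ((**) g ` ?H) g \<subseteq> tangent_at Sp1n g" by (rule tangent_at_mono)
    have inj: "X ** a = Y ** a \<longleftrightarrow> X = Y" for X Y :: "'a qmat1" by (metis ca(3))
    show ?thesis
    proof (rule lorentzian_mod_transport[OF L _ sub, where \<phi> = "\<lambda>X. X ** a" and \<psi> = "\<lambda>X. X ** matrix_inv a"])
      show "subspace (tangent_at Sp1n g)"
        unfolding tangent_Sp1n[OF g]
        by (rule subspace_linear_image[OF subspace_lie_Sp1n]) (simp_all add: mmul_linear)
    qed (auto simp: sh tG tN mmul_linear ca inj)
  qed
  moreover have "?q (dproj ?H (b ** g) (b ** U)) (dproj ?H (b ** g) (b ** U')) = ?q (dproj ?H g U) (dproj ?H g U')"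
    if b: "b \<in> Sp1n" and g: "g \<in> Sp1n" and U: "U \<in> tangent_at Sp1n g" "U' \<in> tangent_at Sp1n g"
        for b g U U'
  proof -
    have "U ** a \<in> tangent_at Sp1n (g ** a)" "U' ** a \<in> tangent_at Sp1n (g ** a)"
      using U by (simp_all add: tG)
    then have "q (dproj H (b ** (g ** a)) (b ** (U ** a))) (dproj H (b ** (g ** a)) (b ** (U' ** a)))
        = q (dproj H (g ** a) (U ** a)) (dproj H (g ** a) (U' ** a))"
      using q b Sp1n_mult[OF g a] unfolding invariant_lorentzian_metric_def by blast
    then show ?thesis by (simp add: sh matrix_mul_assoc)
  qed
  ultimately have "invariant_lorentzian_metric Sp1n ?H ?q"
    unfolding invariant_lorentzian_metric_def by blast
  then show ?thesis using conj_cc_subgroup[OF cc a] unfolding admissible_def by blast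
qed

section \<open>Class II\<close>

lemma K_subset_Sp1n: "K \<subseteq> Sp1n"
  by (auto simp: K_eq Sp1n_eq unitary_def)

text \<open>
  Already the factor \<open>Sp\<^sub>n\<close> of \<open>K\<close> acts transitively on the spheres of \<open>p = \<bbbH>\<^sup>n\<close>.
\<close>

lemma K_transitive_pp:
  fixes l :: "'n::finite"
  assumes X: "X \<in> pp" "X \<noteq> 0"
  obtains k r where "k \<in> K" "r \<noteq> 0" "k ** X = (r *\<^sub>R vv l) ** k"
proof -
  obtain Z where Z: "X = block2 0 (vcnj Z) Z 0" using X(1) by (auto simp: pp_def)
  have Z0: "Z \<noteq> 0"
  proof
    assume "Z = 0"
    then have "X = 0" by (simp add: Z mat_option_eq_iff vcnj_def)
    then show False using X(2) by simp
  qed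
  define r where "r = norm Z"
  have "norm Z = norm (axis l (r *\<^sub>R (1::quat)))"
      by (simp add: r_def norm_eq_sqrt_inner[of "axis l _"] inner_axis_axis) (simp add: inner_quat_def)
  then obtain B where B: "B \<in> Spn" "B *v Z = axis l (r *\<^sub>R 1)" using Spn_transitive by blast
  have "adjoint_mat B ** B = mat 1" using B(1) by (simp add: Spn_eq unitary_def)
  then have "Z = adjoint_mat B *v (B *v Z)" by (simp add: matrix_vector_mul_assoc)
  also have "\<dots> = adjoint_mat B *v axis l (r *\<^sub>R 1)" by (simp add: B)
  finally have Zj: "Z $ j = r *\<^sub>R qcnj (B $ l $ j)" for j
    by (metis (no_types) adjoint_nth axis_linear(2)
        bounded_bilinear.scaleR_right[OF bounded_bilinear_mvmul]
        mvmul_axis vector_scaleR_component)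
  define k where "k = block2 1 0 0 B"
  have "k \<in> K" unfolding K_def k_def using B(1) norm_one_quat by blast
  moreover have "r \<noteq> 0" using Z0 by (simp add: r_def)
  moreover have "k ** X = (r *\<^sub>R vv l) ** k"
  proof -
    have BZ: "(\<Sum>m\<in>UNIV. B $ i $ m * Z $ m) = (if i = l then r *\<^sub>R 1 else 0)" for i
      using arg_cong[OF B(2), of "\<lambda>x. x $ i"] by (simp add: mvmul_nth axis_def)
    show ?thesis
      unfolding mat_option_eq_iff
    proof (intro conjI allI)
      fix i j
      show "(k ** X) $ None $ None = (r *\<^sub>R vv l ** k) $ None $ None"
        by (simp add: mmul_nth sum_UNIV_option k_def Z vv_eq_pmat)
      show "(k ** X) $ None $ Some j = (r *\<^sub>R vv l ** k) $ None $ Some j"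
        by (simp add: mmul_nth sum_UNIV_option k_def Z vv_eq_pmat vcnj_def Zj
            if_distrib[of "\<lambda>x. r *\<^sub>R x"]
            if_distrib[of qcnj] cong: if_cong flip: scaleR_sum_right)
      show "(k ** X) $ Some i $ None = (r *\<^sub>R vv l ** k) $ Some i $ None"
        by (simp add: mmul_nth sum_UNIV_option k_def Z vv_eq_pmat BZ)
      show "(k ** X) $ Some i $ Some j = (r *\<^sub>R vv l ** k) $ Some i $ Some j"
        by (simp add: mmul_nth sum_UNIV_option k_def Z vv_eq_pmat)
    qed
  qed
  ultimately show ?thesis by (rule that)
qed

lemma admissible_Kv: "admissible Sp1n (Kv l)"
proof -
  have "is_form l 1 (\<bullet>) (\<bullet>) (\<bullet>) (\<bullet>) (formB l 1 (\<bullet>) (\<bullet>) (\<bullet>) (\<bullet>))"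
    by (simp add: is_form_iff)
  then show ?thesis
    using form_defines_metric[OF zero_less_one euclidean_inner euclidean_inner] cc_subgroup_Kv
    unfolding admissible_def by blast
qed

lemma minimal_admissible_Kv: "minimal_admissible Sp1n (Kv l)"
  unfolding minimal_admissible_def using admissible_Kv Kv_maximal_admissible by blast

lemma class_II_Kv: "class_II (Kv l)"
proof -
  have "Kv l \<subseteq> K" by (auto simp: Kv_eq K_eq unitary_def)
  moreover have "vv l \<in> invariants (Kv l) pp"
  proof -
    have "vv l = block2 0 (vcnj (axis l 1)) (axis l 1) 0"
      by (simp add: vv_eq_pmat mat_option_eq_iff vcnj_def axis_def)
    then have "vv l \<in> pp" unfolding pp_def by blast
    moreover have "Ad A (vv l) = vv l" if "A \<in> Kv l" for A
      using that Ad_eq_iff[OF involution_JJ] Kv_commutes_vv[OF that] unfolding Kv_eq by blast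
    ultimately show ?thesis unfolding invariants_def by blast
  qed
  ultimately show ?thesis unfolding class_II_def using admissible_Kv vv_nonzero by blast
qed

text \<open>
  A nonzero \<open>H\<close>-invariant vector in \<open>p\<close> is conjugate under \<open>K\<close> to a multiple of \<open>v\<close>. So a conjugate of
  \<open>H\<close> is contained in \<open>K\<^sub>v\<close>; as the conjugates of \<open>K\<^sub>v\<close> are admissible, too, the minimality of \<open>G/H\<close>
  forces equality.
\<close>

lemma class_II_conjugate:
  fixes l :: "'n::finite"
  assumes min: "minimal_admissible Sp1n H" and II: "class_II H"
  shows "\<exists>a\<in>Sp1n. H = Ad a ` Kv l"
proof -
  have HK: "H \<subseteq> K" and ne: "invariants H pp \<noteq> {0}" using II by (auto simp: class_II_def)
  have HS: "H \<subseteq> Sp1n" using HK K_subset_Sp1n by blast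
  have "0 \<in> pp"
  proof -
    have "0 = block2 0 (vcnj 0) 0 0" by (simp add: mat_option_eq_iff vcnj_def)
    then show ?thesis unfolding pp_def by blast
  qed
  then have "0 \<in> invariants H pp" by (simp add: invariants_def Ad_def)
  then obtain X where X: "X \<in> invariants H pp" "X \<noteq> 0" using ne by blast
  then have Xp: "X \<in> pp" by (simp add: invariants_def)
  obtain k r where k: "k \<in> K" "r \<noteq> 0" "k ** X = (r *\<^sub>R vv l) ** k"
    using K_transitive_pp[OF Xp X(2)] by blast
  have kS: "k \<in> Sp1n" using k(1) K_subset_Sp1n by blast
  let ?a = "matrix_inv k"
  have aS: "?a \<in> Sp1n" by (rule Sp1n_inverse(3)[OF kS])
  note ck = Sp1n_cancel[OF kS]
  have "Ad k A \<in> Kv l" if A: "A \<in> H" for A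
  proof -
    have AX: "A ** X = X ** A"
      using X(1) A HS Ad_eq_iff[OF involution_JJ, of A "{}" X X] by (auto simp: invariants_def Sp1n_eq)
    have "Ad k A ** (r *\<^sub>R vv l) ** k = Ad k A ** (k ** X)" using k(3) by (simp add: matrix_mul_assoc)
    also have "\<dots> = k ** (A ** X)" by (simp add: Ad_def matrix_mul_assoc[symmetric] ck)
    also have "\<dots> = (r *\<^sub>R vv l) ** k ** A" by (simp add: AX matrix_mul_assoc k(3))
    also have "\<dots> = (r *\<^sub>R vv l) ** Ad k A ** k" by (simp add: Ad_def matrix_mul_assoc ck)
    finally have "Ad k A ** (r *\<^sub>R vv l) = (r *\<^sub>R vv l) ** Ad k A" using ck(3) by metis
    then have comm: "Ad k A ** vv l = vv l ** Ad k A" using k(2) by (simp add: mmul_linear)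
    have "k \<in> unitary JJ {JJ}" "A \<in> unitary JJ {JJ}" using k(1) A HK by (auto simp: K_eq)
    then have "Ad k A \<in> unitary JJ {JJ}"
      unfolding Ad_def by (intro unitary_mult unitary_inv[OF involution_JJ])
    then show ?thesis using comm by (simp add: Kv_eq unitary_def)
  qed
  then have sub: "H \<subseteq> Ad ?a ` Kv l"
    using Ad_inverse(2)[OF kS] by (metis image_eqI subsetI)
  have "H = Ad ?a ` Kv l"
  proof (rule ccontr)
    assume "H \<noteq> Ad ?a ` Kv l"
    then have "H \<subset> Ad ?a ` Kv l" using sub by blast
    then show False
      using min conj_cc_subgroup[OF cc_subgroup_Kv aS] admissible_conj[OF admissible_Kv aS]
      unfolding minimal_admissible_def by blast
  qed
  then show ?thesis using aS by blast
qed

theorem proposition15: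
  fixes l :: "'n::finite"
  shows "
    (Kv l = {hmat l a A | a A. norm a = 1 \<and> A \<in> SpW l} \<and> lie (Kv l) = hh l) \<and>
    (minimal_admissible Sp1n (Kv l) \<and> class_II (Kv l) \<and>
      (\<forall>H :: 'n qmat1 set. minimal_admissible Sp1n H \<and> class_II H
         \<longrightarrow> (\<exists>a\<in>Sp1n. H = Ad a ` Kv l))) \<and>
    (direct_sum (lie Sp1n) [hh l, mm l] \<and>
      (\<forall>A\<in>Kv l. Ad A ` mm l \<subseteq> mm l) \<and>
      direct_sum (mm l) [nIm l, n' l, Rv l, ImHv l, p' l] \<and>
      module_iso (hpairs l) (W l) act_W (n' l) (act_mat l) (nmat l 0) \<and>
      module_iso (hpairs l) (W l) act_W (p' l) (act_mat l) (pmat l 0)) \<and>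
    (invariants (Kv l) (mm l) = Rv l \<and> dim (invariants (Kv l) (mm l)) = 1) \<and>
    module_iso (hpairs l) (model l) act_model (mm l) (act_mat l) (to_mm l) \<and>
    (\<forall>q. invariant_lorentzian_metric Sp1n (Kv l) q \<longrightarrow>
       (\<exists>c g1 h1 g2 h2 B. c > 0 \<and>
          euclidean_on ImH g1 \<and> invariant_form (hpairs l) ImH act_sp1 g1 \<and>
          euclidean_on (W l) g2 \<and> invariant_form (hpairs l) (W l) act_W g2 \<and>
          euclidean_on UNIV h1 \<and> euclidean_on UNIV h2 \<and>
          is_form l c g1 h1 g2 h2 B \<and> defined_by Sp1n (Kv l) (mm l) B q)) \<and>
    (\<forall>c g1 h1 g2 h2 B. c > 0 \<and>
          euclidean_on ImH g1 \<and> invariant_form (hpairs l) ImH act_sp1 g1 \<and>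
          euclidean_on (W l) g2 \<and> invariant_form (hpairs l) (W l) act_W g2 \<and>
          euclidean_on UNIV h1 \<and> euclidean_on UNIV h2 \<and>
          is_form l c g1 h1 g2 h2 B \<longrightarrow>
       (\<exists>q. invariant_lorentzian_metric Sp1n (Kv l) q \<and> defined_by Sp1n (Kv l) (mm l) B q))"
proof (intro conjI allI impI ballI)
  show "Kv l = {hmat l a A | a A. norm a = 1 \<and> A \<in> SpW l}" by (rule Kv_coordinates)
  show "lie (Kv l) = hh l" by (rule lie_Kv)
  show "minimal_admissible Sp1n (Kv l)" by (rule minimal_admissible_Kv)
  show "class_II (Kv l)" by (rule class_II_Kv)
  show "\<exists>a\<in>Sp1n. H = Ad a ` Kv l" if "minimal_admissible Sp1n H \<and> class_II H" for H :: "'n qmat1 set"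
    using that class_II_conjugate by blast
  show "direct_sum (lie Sp1n) [hh l, mm l]" by (rule direct_sum_lie)
  show "Ad A ` mm l \<subseteq> mm l" if "A \<in> Kv l" for A using Ad_mm[OF that] by blast
  show "direct_sum (mm l) [nIm l, n' l, Rv l, ImHv l, p' l]" by (rule direct_sum_mm)
  show "module_iso (hpairs l) (W l) act_W (n' l) (act_mat l) (nmat l 0)" by (rule module_iso_n')
  show "module_iso (hpairs l) (W l) act_W (p' l) (act_mat l) (pmat l 0)" by (rule module_iso_p')
  show "invariants (Kv l) (mm l) = Rv l" by (rule invariants_Kv)
  show "dim (invariants (Kv l) (mm l)) = 1" by (simp add: invariants_Kv dim_Rv)
  show "module_iso (hpairs l) (model l) act_model (mm l) (act_mat l) (to_mm l)" by (rule module_iso_mm)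
next
  fix q assume "invariant_lorentzian_metric Sp1n (Kv l) q"
  then obtain c h1 h2 B where "c > 0" "euclidean_on UNIV h1" "euclidean_on UNIV h2"
    "is_form l c (\<bullet>) h1 (\<bullet>) h2 B" "defined_by Sp1n (Kv l) (mm l) B q"
    by (rule metric_classification)
  then show "\<exists>c g1 h1 g2 h2 B. c > 0 \<and>
          euclidean_on ImH g1 \<and> invariant_form (hpairs l) ImH act_sp1 g1 \<and>
          euclidean_on (W l) g2 \<and> invariant_form (hpairs l) (W l) act_W g2 \<and>
          euclidean_on UNIV h1 \<and> euclidean_on UNIV h2 \<and>
          is_form l c g1 h1 g2 h2 B \<and> defined_by Sp1n (Kv l) (mm l) B q"
    by (intro exI[of _ c] exI[of _ "(\<bullet>)"] exI[of _ h1] exI[of _ "(\<bullet>)"] exI[of _ h2] exI[of _ B])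
      (simp add: euclidean_inner inner_invariant_ImH inner_invariant_W)
next
  fix c g1 h1 g2 h2 B
  assume *: "c > 0 \<and>
          euclidean_on ImH g1 \<and> invariant_form (hpairs l) ImH act_sp1 g1 \<and>
          euclidean_on (W l) g2 \<and> invariant_form (hpairs l) (W l) act_W g2 \<and>
          euclidean_on UNIV h1 \<and> euclidean_on UNIV h2 \<and>
          is_form l c g1 h1 g2 h2 B"
  obtain k1 k2 where k: "euclidean_on UNIV k1" "euclidean_on UNIV k2" "is_form l c (\<bullet>) k1 (\<bullet>) k2 B"
    by (rule is_form_standard[of g1 l g2 h1 h2 c B]) (use * in simp_all)
  have "c > 0" using * by simp
  then show "\<exists>q. invariant_lorentzian_metric Sp1n (Kv l) q \<and> defined_by Sp1n (Kv l) (mm l) B q"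
    using k by (rule form_defines_metric)
qed

end
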